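(* Consider the $n$-dimensional linear SDE $$dy_t=\frac1\varepsilon A(t)y_t\,dt+\frac{\sigma}{\sqrt\varepsilon}G(t)\,dW_t,\qquad y_0=0,$$ where all eigenvalues of $A(t)$ have real parts smaller than $-a_0<0$ for all $t$. Let $\bar X(t)$ be the particular solution of $$\varepsilon\frac{d}{dt}X(t)=A(t)X(t)+X(t)A(t)^T+\sigma^2G(t)G(t)^T$$ admitting an asymptotic expansion $\bar X(t)=\bar X_0(t)+\varepsilon\bar X_1(t)+\varepsilon^2\bar X_2(t)+\cdots$, whose terms solve $A\bar X_0+\bar X_0A^T=-\sigma^2GG^T$ and $A\bar X_k+\bar X_kA^T=\frac{d}{dt}\bar X_{k-1}$ for $k\ge1$. Assume that $\sigma^2\bar X(s)^{-1}$ is bounded in norm. Then for all $t>0$, $h>0$ and any $\kappa\in(0,1/2)$, $$\mathbb P^{0,0}\Bigl\{\sup_{0\le s\le t}\langle y_s,\bar X(s)^{-1}y_s\rangle\ge h^2\Bigr\}\le C_n(t,\varepsilon)\,e^{-\kappa h^2(1-O(\varepsilon))},\qquad C_n(t,\varepsilon)=\Bigl(\frac{t}{\varepsilon^2}+1\Bigr)\Bigl(\frac1{1-2\kappa}\Bigr)^n.$$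
   Context: $W_t$ is a standard Brownian motion (vector-valued), $A(t)$ and $G(t)$ are smooth bounded matrix-valued functions of slow time $t$, $\varepsilon,\sigma>0$ small, $\langle\cdot,\cdot\rangle$ the Euclidean inner product. $O(\varepsilon)$ denotes a quantity bounded by a constant independent of $\varepsilon,\sigma,t,h$ times $\varepsilon$. *)

theory Defs
  imports "HOL-Analysis.Analysis" "HOL-Probability.Probability"
begin

definition cmat :: "real^'n^'n \<Rightarrow> complex^'n^'n" where
  "cmat A = (\<chi> i j. complex_of_real (A $ i $ j))"

definition complex_eigenvalue :: "real^'n^'n \<Rightarrow> complex \<Rightarrow> bool" where
  "complex_eigenvalue A z \<longleftrightarrow> det (cmat A - mat z) = 0"

definition smooth_on :: "real set \<Rightarrow> (real \<Rightarrow> 'a::real_normed_vector) \<Rightarrow> bool" where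
  "smooth_on S f \<longleftrightarrow> (\<exists>D. D 0 = f \<and>
     (\<forall>k. \<forall>t\<in>S. (D k has_vector_derivative D (Suc k) t) (at t within S)))"

definition std_brownian_motion :: "'a measure \<Rightarrow> (real \<Rightarrow> 'a \<Rightarrow> real^'k) \<Rightarrow> bool" where
  "std_brownian_motion M W \<longleftrightarrow> prob_space M \<and>
     (\<forall>t\<ge>0. W t \<in> borel_measurable M) \<and>
     (\<forall>\<omega>\<in>space M. W 0 \<omega> = 0 \<and> continuous_on {0..} (\<lambda>t. W t \<omega>)) \<and>
     (\<forall>(m::nat) (ts::nat \<Rightarrow> real). 0 \<le> ts 0 \<and> (\<forall>i<m. ts i < ts (Suc i)) \<longrightarrow>
        prob_space.indep_vars M (\<lambda>_. borel)
           (\<lambda>(i, j) \<omega>. (W (ts (Suc i)) \<omega> - W (ts i) \<omega>) $ j) ({..<m} \<times> UNIV) \<and>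
        (\<forall>i<m. \<forall>j. distributed M lborel (\<lambda>\<omega>. (W (ts (Suc i)) \<omega> - W (ts i) \<omega>) $ j)
             (\<lambda>x. ennreal (normal_density 0 (sqrt (ts (Suc i) - ts i)) x))))"

text \<open>Solution (started at 0) of  dy = (1/eps) A(t) y dt + (sigma/sqrt eps) G(t) dW.
  Since G is deterministic and C^1, the Wiener integral is defined pathwise by
  integration by parts:  int_0^t G dW = G(t) W_t - int_0^t G'(s) W_s ds.\<close>
definition solves_linear_sde ::
  "'a measure \<Rightarrow> real \<Rightarrow> real \<Rightarrow> (real \<Rightarrow> real^'n^'n) \<Rightarrow> (real \<Rightarrow> real^'k^'n)
    \<Rightarrow> (real \<Rightarrow> 'a \<Rightarrow> real^'k) \<Rightarrow> (real \<Rightarrow> 'a \<Rightarrow> real^'n) \<Rightarrow> bool" where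
  "solves_linear_sde M \<epsilon> \<sigma> A G W y \<longleftrightarrow>
     (\<forall>t\<ge>0. y t \<in> borel_measurable M) \<and>
     (\<forall>\<omega>\<in>space M. continuous_on {0..} (\<lambda>t. y t \<omega>)) \<and>
     (AE \<omega> in M. \<forall>t\<ge>0.
        y t \<omega> = (1 / \<epsilon>) *\<^sub>R integral {0..t} (\<lambda>s. A s *v y s \<omega>)
               + (\<sigma> / sqrt \<epsilon>) *\<^sub>R (G t *v W t \<omega>
                   - integral {0..t} (\<lambda>s. vector_derivative G (at s within {0..}) *v W s \<omega>)))"

end

theory Submission
  imports Defs "HOL-Computational_Algebra.Fundamental_Theorem_Algebra"
begin

text \<open>Let \<open>V' = - (1/\<epsilon>) V A\<close>, \<open>V 0 = 1\<close>. Then \<open>N = V y\<close> is a Wiener integral with the deterministic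
  integrand \<open>(\<sigma>/\<surd>\<epsilon>) F\<close>, \<open>F = V G\<close>, and \<open>P = V X V\<^sup>T\<close>, for \<open>X\<close> the given solution, satisfies
  \<open>P' = (\<sigma>\<^sup>2/\<epsilon>) F F\<^sup>T\<close>. So \<open>P\<close> is nondecreasing and dominates the covariance of \<open>N\<close>, provided that
  \<open>X\<close> is positive definite; this holds for small \<open>\<epsilon>\<close> because \<open>X\<close> is invertible and close to the
  solution \<open>X\<^sub>0\<close> of a Lyapunov equation with a stable matrix, which is symmetric and nonnegative.
  Since \<open>exp (\<kappa> (x \<bullet> P\<inverse>x))\<close> is a Gaussian mixture of the exponentials \<open>exp (x \<bullet> \<xi>)\<close>, a maximal
  inequality for such mixtures bounds \<open>sup (N \<bullet> P(u)\<inverse>N)\<close> over \<open>[0,u]\<close>. Finally \<open>\<sigma>\<^sup>2 G G\<^sup>T \<le> C X\<close>, so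
  that over a time \<open>\<epsilon>\<^sup>2\<close> the form \<open>P\<close> grows at most by the factor \<open>e\<^sup>C\<^sup>\<epsilon>\<close>, and on each of
  \<open>\<lceil>t/\<epsilon>\<^sup>2\<rceil>\<close> time intervals the form \<open>y \<bullet> X\<inverse>y\<close> is at most \<open>e\<^sup>C\<^sup>\<epsilon>\<close> times \<open>N \<bullet> P(u)\<inverse>N\<close>, \<open>u\<close> being the
  right end point. As \<open>X\<close> need not be symmetric, \<open>P\<close> is
  built from its symmetric part.\<close>

section \<open>Matrix norms and quadratic forms\<close>

text \<open>The obstacle is twofold: \<open>y\<close> lacks independent increments, and the form in
  the supremum changes with time, whereas an exponential mixture gives a maximal inequality only for
  one fixed form. Multiplication by \<open>V\<close> cures the first defect, freezing the form at
  the right end point of a block the second. The relative growth rate of \<open>P\<close> is at most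
  C/\<epsilon>, so freezing over a time \<epsilon>^2 costs a factor 1 + O(\<epsilon>), and it is
  this block length that puts t/\<epsilon>^2 into the prefactor. Neither symmetry nor positivity of
  \<open>X\<close> is given, only a bound on its inverse. The Gaussian comparison depends on
  positivity, which is why the algebra of stable matrices comes in. Stability acts through a
  decreasing quadratic form, built from the linear factors of an annihilating polynomial, instead of
  through decay of a matrix exponential. The stochastic side is free of Ito calculus: Wiener
  integrals are pathwise, by integration by parts, and the probability estimates are made for
  Gaussian random walks on grids.\<close>

lemma norm_vec_sq: "(norm (x :: 'b::real_normed_vector ^ 'n))\<^sup>2 = (\<Sum>i\<in>UNIV. (norm (x $ i))\<^sup>2)"
  by (simp add: norm_vec_def L2_set_def sum_nonneg)

lemma norm_transpose: "norm (transpose (A :: real^'n^'m)) = norm A"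
proof -
  have "(norm (transpose A))\<^sup>2 = (norm A)\<^sup>2"
    unfolding norm_vec_sq by (subst sum.swap) (simp add: transpose_def)
  then show ?thesis by simp
qed

lemma norm_matrix_vector_mult_le: "norm ((A :: real^'n^'m) *v x) \<le> norm A * norm x"
proof (rule power2_le_imp_le)
  have "(norm (A *v x))\<^sup>2 = (\<Sum>i\<in>UNIV. (A $ i \<bullet> x)\<^sup>2)"
    by (simp add: norm_vec_sq matrix_vector_mult_def inner_vec_def)
  also have "\<dots> \<le> (\<Sum>i\<in>UNIV. (norm (A $ i))\<^sup>2 * (norm x)\<^sup>2)"
    by (intro sum_mono) (metis Cauchy_Schwarz_ineq power2_norm_eq_inner)
  also have "\<dots> = (norm A * norm x)\<^sup>2"
    by (simp add: norm_vec_sq[of A] power_mult_distrib sum_distrib_right)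
  finally show "(norm (A *v x))\<^sup>2 \<le> (norm A * norm x)\<^sup>2" .
qed simp

lemma norm_matrix_matrix_mult_le:
  "norm ((A :: real^'n^'m) ** (B :: real^'k^'n)) \<le> norm A * norm B"
proof (rule power2_le_imp_le)
  have row: "(A ** B) $ i = transpose B *v (A $ i)" for i
    by (simp add: vec_eq_iff matrix_matrix_mult_def matrix_vector_mult_def transpose_def mult.commute)
  have "(norm (A ** B))\<^sup>2 = (\<Sum>i\<in>UNIV. (norm (transpose B *v (A $ i)))\<^sup>2)"
    by (simp only: norm_vec_sq[of "A ** B"] row)
  also have "\<dots> \<le> (\<Sum>i\<in>UNIV. (norm B * norm (A $ i))\<^sup>2)"
    by (intro sum_mono power_mono)
      (use norm_matrix_vector_mult_le[of "transpose B"] in \<open>auto simp: norm_transpose\<close>)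
  also have "\<dots> = (norm A * norm B)\<^sup>2"
    by (simp add: norm_vec_sq[of A] power_mult_distrib sum_distrib_left mult.commute)
  finally show "(norm (A ** B))\<^sup>2 \<le> (norm A * norm B)\<^sup>2" .
qed simp

lemma bounded_bilinear_matrix_vector_mult:
  "bounded_bilinear ((*v) :: real^'n^'m \<Rightarrow> real^'n \<Rightarrow> real^'m)"
proof
  show "\<exists>K. \<forall>(a::real^'n^'m) b. norm (a *v b) \<le> norm a * norm b * K"
    using norm_matrix_vector_mult_le by (intro exI[of _ 1]) auto
qed (auto simp: matrix_vector_mult_add_rdistrib matrix_vector_right_distrib
    scaleR_matrix_vector_assoc matrix_vector_mult_scaleR)

lemma bounded_bilinear_matrix_matrix_mult:
  "bounded_bilinear ((**) :: real^'n^'m \<Rightarrow> real^'k^'n \<Rightarrow> real^'k^'m)"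
proof
  show "\<exists>K. \<forall>(a::real^'n^'m) (b::real^'k^'n). norm (a ** b) \<le> norm a * norm b * K"
    using norm_matrix_matrix_mult_le by (intro exI[of _ 1]) auto
qed (auto simp: vec_eq_iff matrix_matrix_mult_def sum_distrib_left algebra_simps sum.distrib)

lemma bounded_linear_transpose: "bounded_linear (transpose :: real^'n^'m \<Rightarrow> real^'m^'n)"
  by (rule bounded_linear_intro[where K=1]) (simp_all add: norm_transpose, simp_all add: transpose_def vec_eq_iff)

text \<open>At a minimiser of \<open>b v v / h v v\<close> the rates of change of the two forms along \<open>L\<close> are
  proportional, the factor being the minimum itself.\<close>
lemma form_nonneg_if_decreasing:
  fixes b h :: "'v::euclidean_space \<Rightarrow> 'v \<Rightarrow> real"
  assumes b: "bilinear b" and h: "bilinear h" and L: "linear L"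
    and hpos: "\<And>v. v \<noteq> 0 \<Longrightarrow> h v v > 0"
    and hdec: "\<And>v. v \<noteq> 0 \<Longrightarrow> h v (L v) + h (L v) v < 0"
    and bdec: "\<And>v. b v (L v) + b (L v) v \<le> 0"
  shows "b v v \<ge> 0"
proof (rule ccontr)
  assume neg: "\<not> b v v \<ge> 0"
  then have v0: "v \<noteq> 0" using bilinear_lzero[OF b] by auto
  define R where "R u = b u u / h u u" for u
  have cont: "continuous_on (sphere 0 1) R"
    unfolding R_def
  proof (intro continuous_intros bilinear_continuous_on_compose[OF _ _ b]
        bilinear_continuous_on_compose[OF _ _ h])
    show "\<forall>u\<in>sphere 0 1. h u u \<noteq> 0"
      using hpos by (metis dist_0_norm less_irrefl mem_sphere norm_zero zero_neq_one)
  qed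
  have "v /\<^sub>R norm v \<in> sphere 0 1" using v0 by simp
  then obtain w where w: "w \<in> sphere 0 1" and wmin: "\<And>u. u \<in> sphere 0 1 \<Longrightarrow> R w \<le> R u"
    using continuous_attains_inf[OF compact_sphere _ cont] by blast
  have Rscale: "R (c *\<^sub>R u) = R u" if "c \<noteq> 0" for c u
    using that by (simp add: R_def bilinear_lmul[OF b] bilinear_rmul[OF b] bilinear_lmul[OF h] bilinear_rmul[OF h])
  have wmin': "R w \<le> R u" if "u \<noteq> 0" for u
    using wmin[of "u /\<^sub>R norm u"] Rscale[of "inverse (norm u)" u] that by simp
  define \<mu> where "\<mu> = - R w"
  have "R v < 0" using neg hpos[OF v0] by (simp add: R_def divide_less_0_iff)
  then have mu: "\<mu> > 0" using wmin'[OF v0] by (simp add: \<mu>_def)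
  \<comment> \<open>The form \<open>b\<close>, lifted by the most negative value of the quotient, is
    nonnegative and vanishes at \<open>w\<close>; yet its rate of change at \<open>w\<close> along
    \<open>L\<close> is strictly negative, which is the contradiction aimed at.\<close>
  define g where "g u u' = b u u' + \<mu> * h u u'" for u u'
  have g0: "g u u \<ge> 0" for u
  proof (cases "u = 0")
    case True then show ?thesis by (simp add: g_def bilinear_lzero[OF b] bilinear_lzero[OF h])
  next
    case False
    then show ?thesis using wmin'[OF False] hpos[OF False]
      by (simp add: g_def \<mu>_def R_def[of u] field_simps)
  qed
  have wn: "w \<noteq> 0" using w by auto
  have gw: "g w w = 0" using hpos[OF wn] by (simp add: g_def \<mu>_def R_def)
  define c1 where "c1 = g w (L w) + g (L w) w"
  have c1: "c1 < 0"
    using bdec[of w] mult_pos_neg[OF mu hdec[OF wn]] by (simp add: c1_def g_def algebra_simps)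
  define c2 where "c2 = g (L w) (L w)"
  have quad: "s * c1 + s\<^sup>2 * c2 \<ge> 0" for s
    using g0[of "w + s *\<^sub>R L w"] gw
    by (simp add: g_def c1_def c2_def bilinear_ladd[OF b] bilinear_radd[OF b] bilinear_lmul[OF b] bilinear_rmul[OF b]
        bilinear_ladd[OF h] bilinear_radd[OF h] bilinear_lmul[OF h] bilinear_rmul[OF h] algebra_simps power2_eq_square)
  \<comment> \<open>A step so small that the linear term dominates; the summand 1 keeps the
    denominator positive when \<open>c2\<close> is 0.\<close>
  define s where "s = - c1 / (2 * (c2 + 1))"
  have c2: "c2 \<ge> 0" using g0 by (simp add: c2_def)
  have s: "s > 0" using c1 c2 by (auto simp: s_def field_simps)
  have "s * c2 \<le> s * (c2 + 1)" using s by simp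
  also have "\<dots> = - c1 / 2" using c2 by (simp add: s_def field_simps)
  finally have "c1 + s * c2 < 0" using c1 by simp
  from mult_pos_neg[OF s this] quad[of s] show False by (simp add: algebra_simps power2_eq_square)
qed

text \<open>At a minimiser of the form on the unit sphere the first variation vanishes,
  so the minimiser is an eigenvector.\<close>
lemma symmetric_psd_lower_bound:
  fixes X :: "real^'n^'n"
  assumes sym: "transpose X = X" and psd: "\<And>z. z \<bullet> (X *v z) \<ge> 0"
    and below: "\<And>z. norm (X *v z) \<ge> \<beta> * norm z"
  shows "z \<bullet> (X *v z) \<ge> \<beta> * (norm z)\<^sup>2"
proof -
  define R where "R u = u \<bullet> (X *v u)" for u
  have cont: "continuous_on (sphere 0 1) R"
    unfolding R_def
    by (intro continuous_intros linear_continuous_on_compose[OF _ matrix_vector_mul_linear])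
  \<comment> \<open>Any coordinate vector will do: it shows that the sphere is nonempty.\<close>
  have "(axis undefined 1 :: real^'n) \<in> sphere 0 1" by (simp add: norm_axis_1)
  then obtain w where w: "w \<in> sphere 0 1" and wmin: "\<And>u. u \<in> sphere 0 1 \<Longrightarrow> R w \<le> R u"
    using continuous_attains_inf[OF compact_sphere _ cont] by blast
  define \<mu> where "\<mu> = R w"
  have ww: "w \<bullet> w = 1" using w by (simp add: norm_eq_1)
  have wmin': "\<mu> * (u \<bullet> u) \<le> R u" for u
  proof (cases "u = 0")
    case True then show ?thesis by (simp add: R_def)
  next
    case False
    have "\<mu> \<le> R (u /\<^sub>R norm u)" unfolding \<mu>_def using False by (intro wmin) simp
    also have "\<dots> = R u / (u \<bullet> u)"
      by (simp add: R_def matrix_vector_mult_scaleR dot_square_norm power2_eq_square field_simps)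
    finally show ?thesis using False by (simp add: field_simps)
  qed
  have adj: "(X *v u) \<bullet> u' = u \<bullet> (X *v u')" for u u'
    by (metis dot_lmul_matrix sym transpose_matrix_vector)
  \<comment> \<open>The residual of the eigenvector equation. Moving \<open>w\<close> in this very
    direction has first variation \<open>2 * s * (d \<bullet> d)\<close>, so minimality forces
    \<open>d = 0\<close>.\<close>
  define d where "d = X *v w - \<mu> *\<^sub>R w"
  have quad: "0 \<le> 2 * s * (d \<bullet> d) + s\<^sup>2 * (R d - \<mu> * (d \<bullet> d))" for s
  proof -
    have "0 \<le> R (w + s *\<^sub>R d) - \<mu> * ((w + s *\<^sub>R d) \<bullet> (w + s *\<^sub>R d))"
      using wmin'[of "w + s *\<^sub>R d"] by simp
    also have "\<dots> = R w + 2 * s * (d \<bullet> (X *v w)) + s\<^sup>2 * R d - \<mu> * (w \<bullet> w + 2 * s * (d \<bullet> w) + s\<^sup>2 * (d \<bullet> d))"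
      using adj[of w d] by (simp add: R_def matrix_vector_right_distrib matrix_vector_mult_scaleR
          inner_add_left inner_add_right algebra_simps power2_eq_square inner_commute)
    also have "\<dots> = 2 * s * (d \<bullet> (X *v w - \<mu> *\<^sub>R w)) + s\<^sup>2 * (R d - \<mu> * (d \<bullet> d))"
      using ww by (simp add: \<mu>_def inner_diff_right algebra_simps)
    finally show ?thesis by (simp add: d_def)
  qed
  have "d \<bullet> d = 0"
  proof (rule ccontr)
    assume "d \<bullet> d \<noteq> 0"
    then have dd: "d \<bullet> d > 0" by simp
    define c where "c = R d - \<mu> * (d \<bullet> d)"
    have c: "c \<ge> 0" using wmin'[of d] by (simp add: c_def)
    \<comment> \<open>The step is negative, against the residual, and short enough for the linear
      term to win.\<close>
    define s where "s = - (d \<bullet> d) / (c + 1)"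
    have s: "s < 0" using dd c by (auto simp: s_def field_simps)
    have "(- s) * c \<le> (- s) * (c + 1)" using s by simp
    also have "\<dots> = d \<bullet> d" using c by (simp add: s_def)
    finally have "2 * (d \<bullet> d) + s * c > 0" using dd by linarith
    from mult_neg_pos[OF s this] quad[of s] show False
      by (simp add: c_def algebra_simps power2_eq_square)
  qed
  then have Xw: "X *v w = \<mu> *\<^sub>R w" by (simp add: d_def)
  have "\<mu> \<ge> 0" using psd by (simp add: \<mu>_def R_def)
  moreover have "norm w = 1" using w by simp
  ultimately have "\<mu> \<ge> \<beta>" using below[of w] by (simp add: Xw)
  then have "\<beta> * (z \<bullet> z) \<le> \<mu> * (z \<bullet> z)" by (intro mult_right_mono) auto
  with wmin'[of z] show ?thesis by (simp add: R_def dot_square_norm)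
qed

section \<open>The Lyapunov equation\<close>

definition matpow :: "'b::semiring_1^'n^'n \<Rightarrow> nat \<Rightarrow> 'b^'n^'n" where
  "matpow B k = (((**) B) ^^ k) (mat 1)"

lemma matpow_0 [simp]: "matpow B 0 = mat 1" and matpow_Suc: "matpow B (Suc k) = B ** matpow B k"
  by (simp_all add: matpow_def)

definition poly_mv :: "complex poly \<Rightarrow> complex^'n^'n \<Rightarrow> complex^'n \<Rightarrow> complex^'n" where
  "poly_mv p B v = (\<Sum>k\<le>degree p. coeff p k *s (matpow B k *v v))"

lemma poly_mv_altdef:
  assumes "degree p \<le> n"
  shows "poly_mv p B v = (\<Sum>k\<le>n. coeff p k *s (matpow B k *v v))"
  unfolding poly_mv_def
  by (rule sum.mono_neutral_left) (use assms in \<open>auto simp: coeff_eq_0\<close>)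

lemma matpow_Suc_mv: "matpow B (Suc k) *v v = B *v (matpow B k *v v)"
  by (simp add: matpow_Suc matrix_vector_mul_assoc)

lemma matpow_Suc_mv': "matpow B (Suc k) *v v = matpow B k *v (B *v v)"
  by (induction k) (simp_all add: matpow_Suc_mv)

lemma poly_mv_0 [simp]: "poly_mv 0 B v = 0"
  by (simp add: poly_mv_def)

lemma poly_mv_pCons: "poly_mv (pCons a p) B v = a *s v + poly_mv p B (B *v v)"
proof -
  have "poly_mv (pCons a p) B v = (\<Sum>k\<le>Suc (degree p). coeff (pCons a p) k *s (matpow B k *v v))"
    by (rule poly_mv_altdef) (simp add: degree_pCons_le)
  also have "\<dots> = a *s v + (\<Sum>k\<le>degree p. coeff p k *s (matpow B k *v (B *v v)))"
    by (subst sum.atMost_Suc_shift) (simp add: matpow_Suc_mv')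
  finally show ?thesis by (simp add: poly_mv_def)
qed

lemma poly_mv_add: "poly_mv (p + q) B v = poly_mv p B v + poly_mv q B v"
proof -
  define n where "n = max (degree p) (degree q)"
  have "degree (p + q) \<le> n" by (simp add: n_def degree_add_le_max)
  then show ?thesis
    by (simp add: poly_mv_altdef[of _ n] n_def vec_eq_iff sum.distrib algebra_simps)
qed

lemma poly_mv_smult: "poly_mv (smult c p) B v = c *s poly_mv p B v"
  by (subst poly_mv_altdef[of _ "degree p"])
    (simp_all add: degree_smult_le poly_mv_def vec_eq_iff sum_distrib_left mult.assoc)

abbreviation shift_mv :: "complex^'n^'n \<Rightarrow> complex \<Rightarrow> complex^'n \<Rightarrow> complex^'n" where
  "shift_mv B l v \<equiv> B *v v - l *s v"

lemma shift_mv_commute: "shift_mv B l (shift_mv B m v) = shift_mv B m (shift_mv B l v)"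
  by (simp add: vec_eq_iff matrix_vector_mult_def sum_subtractf sum_distrib_left algebra_simps)

lemma poly_mv_diff_arg: "poly_mv p B (v - w) = poly_mv p B v - poly_mv p B w"
  by (simp add: poly_mv_def vec_eq_iff matrix_vector_mult_def sum_subtractf sum_distrib_left algebra_simps)

lemma poly_mv_smult_arg: "poly_mv p B (c *s v) = c *s poly_mv p B v"
  by (simp add: poly_mv_def vec_eq_iff matrix_vector_mult_def sum_distrib_left algebra_simps)

lemma poly_mv_linear_factor: "poly_mv ([:- l, 1:] * q) B v = poly_mv q B (shift_mv B l v)"
proof -
  have "[:- l, 1:] * q = smult (- l) q + pCons 0 q" by simp
  then show ?thesis
    by (simp only: poly_mv_add poly_mv_smult poly_mv_pCons poly_mv_diff_arg poly_mv_smult_arg)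
       (simp add: vec_eq_iff)
qed

text \<open>A product of commuting factors \<open>B - l\<close>, kept as a list with the head acting
  first, because the Lyapunov form below is built by recursion over the factors.\<close>

fun shifts_mv :: "complex^'n^'n \<Rightarrow> complex list \<Rightarrow> complex^'n \<Rightarrow> complex^'n" where
  "shifts_mv B [] v = v"
| "shifts_mv B (l # ls) v = shifts_mv B ls (shift_mv B l v)"

lemma shifts_mv_shift_commute: "shifts_mv B ls (shift_mv B m v) = shift_mv B m (shifts_mv B ls v)"
proof (induction ls arbitrary: v)
  case (Cons l ls)
  have "shift_mv B l (shift_mv B m v) = shift_mv B m (shift_mv B l v)" by (rule shift_mv_commute)
  then show ?case by (simp only: shifts_mv.simps Cons.IH)
qed simp

text \<open>Linear factors of the polynomial belonging to points that are not eigenvalues are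
  injective and can be dropped.\<close>
lemma shifts_mv_eq_0_of_poly:
  fixes B :: "complex^'n^'n"
  assumes "p \<noteq> 0"
  shows "\<exists>ls. (\<forall>l\<in>set ls. det (B - mat l) = 0) \<and> (\<forall>v. poly_mv p B v = 0 \<longrightarrow> shifts_mv B ls v = 0)"
  using assms
proof (induction "degree p" arbitrary: p)
  case 0
  then obtain a where "p = [:a:]" "a \<noteq> 0" by (metis degree_eq_zeroE pCons_0_0)
  then show ?case by (intro exI[of _ "[]"]) (auto simp: poly_mv_pCons vec_eq_iff)
next
  case (Suc n)
  then have "\<not> constant (poly p)" by (simp add: constant_degree)
  then obtain l where "poly p l = 0" using fundamental_theorem_of_algebra by blast
  then obtain q where q: "p = [:- l, 1:] * q" by (metis dvdE poly_eq_0_iff_dvd)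
  with Suc.prems have "q \<noteq> 0" by auto
  then have "degree p = Suc (degree q)" unfolding q by (subst degree_mult_eq) auto
  with Suc.hyps(2) have "n = degree q" by simp
  from Suc.hyps(1)[OF this \<open>q \<noteq> 0\<close>] obtain ls where ls: "\<forall>l\<in>set ls. det (B - mat l) = 0"
    and lsv: "\<And>v. poly_mv q B v = 0 \<Longrightarrow> shifts_mv B ls v = 0" by blast
  have v: "shifts_mv B ls (shift_mv B l v) = 0" if "poly_mv p B v = 0" for v
    using lsv that by (simp add: q poly_mv_linear_factor del: mult_pCons_left)
  show ?case
  proof (cases "det (B - mat l) = 0")
    case True
    then show ?thesis using ls v by (intro exI[of _ "l # ls"]) auto
  next
    case False
    then have "invertible (B - mat l)" by (simp add: invertible_det_nz)
    then obtain C where C: "C ** (B - mat l) = mat 1" by (auto simp: invertible_def)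
    have shift: "shift_mv B l v = (B - mat l) *v v" for v
      by (simp add: vec_eq_iff matrix_vector_mult_def mat_def if_distrib[where f="\<lambda>x. x * _"]
          sum_subtractf left_diff_distrib cong: if_cong)
    have "shifts_mv B ls v = 0" if "poly_mv p B v = 0" for v
    proof -
      have "(B - mat l) *v shifts_mv B ls v = 0"
        using v[OF that] by (simp only: shifts_mv_shift_commute flip: shift)
      then have "(C ** (B - mat l)) *v shifts_mv B ls v = 0"
        by (simp flip: matrix_vector_mul_assoc)
      then show ?thesis by (simp add: C)
    qed
    then show ?thesis using ls by blast
  qed
qed

lemma cmat_mult: "cmat (A ** B) = cmat A ** cmat B"
  by (simp add: cmat_def matrix_matrix_mult_def vec_eq_iff)

lemma cmat_matpow: "cmat (matpow A k) = matpow (cmat A) k"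
  by (induction k) (simp_all add: matpow_Suc cmat_mult, simp add: cmat_def mat_def vec_eq_iff)

text \<open>A dimension count: \<open>N + 1\<close> powers in the \<open>N\<close>-dimensional space
  of real matrices satisfy a linear relation. This can stand in for Cayley-Hamilton because roots of
  the polynomial that are not eigenvalues are discarded anyway.\<close>

lemma matpow_annihilating:
  fixes A :: "real^'n^'n"
  shows "\<exists>p. p \<noteq> 0 \<and> (\<forall>v. poly_mv p (cmat A) v = 0)"
proof -
  define N where "N = DIM(real^'n^'n)"
  obtain a where a: "\<exists>k\<le>N. a k \<noteq> (0::real)" "(\<Sum>k\<le>N. a k *\<^sub>R matpow A k) = 0"
  proof (cases "inj_on (matpow A) {..N}")
    case True
    then have "card (matpow A ` {..N}) = Suc N" by (simp add: card_image)
    then have "dependent (matpow A ` {..N})"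
      unfolding N_def by (intro dependent_biggerset) auto
    then obtain u where u: "\<exists>v\<in>matpow A ` {..N}. u v \<noteq> 0" "(\<Sum>v\<in>matpow A ` {..N}. u v *\<^sub>R v) = 0"
      using real_vector.dependent_finite[of "matpow A ` {..N}"] by auto
    show ?thesis
      by (rule that[of "u \<circ> matpow A"]) (use u True in \<open>auto simp: sum.reindex\<close>)
  next
    \<comment> \<open>If two powers coincide, the set of powers may be too small for the count, but
      their difference is already a relation.\<close>
    case False
    then obtain i j where ij: "i \<le> N" "j \<le> N" "i \<noteq> j" "matpow A i = matpow A j"
      by (auto simp: inj_on_def)
    let ?a = "\<lambda>k. if k = i then 1 else if k = j then - 1 else (0::real)"
    have "(\<Sum>k\<le>N. ?a k *\<^sub>R matpow A k)
        = (\<Sum>k\<le>N. (if k = i then matpow A k else 0) - (if k = j then matpow A k else 0))"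
      using ij by (intro sum.cong) auto
    also have "\<dots> = 0" using ij by (simp add: sum_subtractf)
    finally show ?thesis using ij by (intro that[of ?a]) auto
  qed
  define p where "p = (\<Sum>k\<le>N. monom (complex_of_real (a k)) k)"
  have cp: "coeff p k = (if k \<le> N then of_real (a k) else 0)" for k
    by (simp add: p_def coeff_sum if_distrib cong: if_cong)
  have deg: "degree p \<le> N" by (rule degree_le) (simp add: cp)
  have "p \<noteq> 0" using a(1) cp by (metis coeff_0 of_real_eq_0_iff)
  moreover have "poly_mv p (cmat A) v = 0" for v
  proof -
    have "poly_mv p (cmat A) v $ i = 0" for i
    proof -
      have "poly_mv p (cmat A) v $ i
          = (\<Sum>k\<le>N. of_real (a k) * (\<Sum>j\<in>UNIV. of_real (matpow A k $ i $ j) * v $ j))"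
        by (simp add: poly_mv_altdef[OF deg] cp flip: cmat_matpow)
          (simp add: cmat_def matrix_vector_mult_def)
      also have "\<dots> = (\<Sum>j\<in>UNIV. of_real ((\<Sum>k\<le>N. a k *\<^sub>R matpow A k) $ i $ j) * v $ j)"
        by (simp add: sum_distrib_left sum_distrib_right mult.assoc) (subst sum.swap, simp)
      also have "\<dots> = 0" by (simp add: a(2))
      finally show ?thesis .
    qed
    then show ?thesis by (simp add: vec_eq_iff)
  qed
  ultimately show ?thesis by blast
qed

text \<open>The form is built along the chain \<open>z\<close>, \<open>(B - l\<^sub>1)z\<close>, \<open>(B - l\<^sub>2)(B - l\<^sub>1)z\<close>, ..., with weights
  chosen so that each member absorbs the cross term of its predecessor.\<close>
lemma lyapunov_form_chain:
  fixes B :: "complex^'n^'n"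
  assumes "\<And>l. l \<in> set ls \<Longrightarrow> Re l < 0"
  shows "\<exists>(h :: complex^'n \<Rightarrow> complex^'n \<Rightarrow> real) a. a > 0 \<and> bilinear h \<and> (\<forall>z. h z z \<ge> (norm z)\<^sup>2) \<and>
     (\<forall>z. shifts_mv B ls z = 0 \<longrightarrow> h z (B *v z) + h (B *v z) z \<le> - a * (norm z)\<^sup>2)"
  using assms
proof (induction ls)
  case Nil
  \<comment> \<open>For the empty chain the condition says \<open>z = 0\<close>, so the inner
    product itself serves and 1 is an arbitrary rate.\<close>
  show ?case
    by (intro exI[of _ inner] exI[of _ 1])
       (auto simp: power2_norm_eq_inner bilinear_conv_bounded_bilinear bounded_bilinear_inner)
next
  case (Cons l ls)
  then obtain h :: "complex^'n \<Rightarrow> complex^'n \<Rightarrow> real" and a where a: "a > 0" and h: "bilinear h"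
    and h1: "\<And>z. h z z \<ge> (norm z)\<^sup>2"
    and h2: "\<And>z. shifts_mv B ls z = 0 \<Longrightarrow> h z (B *v z) + h (B *v z) z \<le> - a * (norm z)\<^sup>2"
    by (metis list.set_intros(2))
  define b where "b = - Re l"
  have b: "b > 0" using Cons.prems by (simp add: b_def)
  \<comment> \<open>The cross term \<open>2 * (z \<bullet> w)\<close> with \<open>w = S z\<close> is
    at most \<open>b\<close> times the square of \<open>norm z\<close> plus \<open>1 / b\<close>
    times that of \<open>norm w\<close>. The weight makes the decay of the tail,
    \<open>d * a = 1 / b\<close>, cancel the second summand exactly; the first takes half of the
    decay \<open>2 * b\<close> of the head.\<close>
  define d where "d = 1 / (a * b)"
  have d: "d > 0" using a b by (simp add: d_def)
  define S where "S = shift_mv B l"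
  define h' where "h' z w = z \<bullet> w + d * h (S z) (S w)" for z w
  have lin: "linear S"
    by (rule linearI) (simp_all add: S_def,simp_all add: vec_eq_iff matrix_vector_mult_def sum.distrib sum_distrib_left algebra_simps scaleR_sum_right)
  have "bilinear h'"
    unfolding bilinear_def h'_def
    by (auto intro!: linearI simp: linear_add[OF lin] linear_scale[OF lin] bilinear_ladd[OF h] bilinear_radd[OF h]
        bilinear_lmul[OF h] bilinear_rmul[OF h] inner_add_left inner_add_right algebra_simps)
  moreover have "h' z z \<ge> (norm z)\<^sup>2" for z
    using mult_nonneg_nonneg[of d "h (S z) (S z)"] d h1[of "S z"] zero_le_power2[of "norm (S z)"]
    unfolding h'_def power2_norm_eq_inner by linarith
  moreover have "h' z (B *v z) + h' (B *v z) z \<le> - b * (norm z)\<^sup>2" if "shifts_mv B (l # ls) z = 0" for z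
  proof -
    define w where "w = S z"
    have Bz: "B *v z = l *s z + w" by (simp add: w_def S_def)
    have sB: "S (B *v z) = B *v w"
      by (simp add: w_def S_def vec_eq_iff matrix_vector_mult_def sum_subtractf sum_distrib_left algebra_simps)
    have "shifts_mv B ls w = 0" using that by (simp add: w_def S_def)
    from h2[OF this] have dh: "d * (h w (B *v w) + h (B *v w) w) \<le> d * (- a * (norm w)\<^sup>2)"
      using d by (intro mult_left_mono) auto
    \<comment> \<open>The real inner product on complex vectors sees only the real part of
      \<open>l\<close>.\<close>
    have zl: "z \<bullet> (l *s z) = - b * (norm z)\<^sup>2"
      unfolding power2_norm_eq_inner
      by (simp add: inner_vec_def b_def sum_distrib_left inner_complex_def algebra_simps)
    have "0 \<le> (norm (b *\<^sub>R z - w))\<^sup>2" by simp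
    also have "\<dots> = b\<^sup>2 * (norm z)\<^sup>2 - 2 * b * (z \<bullet> w) + (norm w)\<^sup>2"
      unfolding power2_norm_eq_inner
      by (simp add: inner_diff_left inner_diff_right inner_commute algebra_simps power2_eq_square)
    finally have "2 * (z \<bullet> w) * b \<le> (b * (norm z)\<^sup>2 + (norm w)\<^sup>2 / b) * b"
      using b by (simp add: algebra_simps power2_eq_square)
    then have "2 * (z \<bullet> w) \<le> b * (norm z)\<^sup>2 + (norm w)\<^sup>2 / b" using b by simp
    moreover have "d * (- a * (norm w)\<^sup>2) = - ((norm w)\<^sup>2 / b)" using a by (simp add: d_def)
    moreover have "h' z (B *v z) + h' (B *v z) z = 2 * (z \<bullet> (l *s z)) + 2 * (z \<bullet> w) + d * (h w (B *v w) + h (B *v w) w)"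
      unfolding h'_def sB w_def[symmetric] unfolding Bz
      by (simp add: inner_add_left inner_add_right inner_commute algebra_simps)
    ultimately show ?thesis using dh zl by simp
  qed
  ultimately show ?case using b by blast
qed

text \<open>The chain over all kept roots annihilates every vector, so the decrease of the chain
  form holds without restriction, and the form can be pulled back to real vectors. The transpose
  appears because the left side of the Lyapunov equation is the derivative of the form of
  \<open>X\<close> along the flow of \<open>transpose A\<close>.\<close>

lemma lyapunov_form:
  fixes A :: "real^'n^'n"
  assumes eig: "\<And>z. complex_eigenvalue A z \<Longrightarrow> Re z < 0"
  shows "\<exists>h :: real^'n \<Rightarrow> real^'n \<Rightarrow> real. bilinear h \<and> (\<forall>z. z \<noteq> 0 \<longrightarrow> h z z > 0) \<and>
     (\<forall>z. z \<noteq> 0 \<longrightarrow> h z (transpose A *v z) + h (transpose A *v z) z < 0)"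
proof -
  let ?B = "cmat (transpose A)"
  obtain p where p: "p \<noteq> 0" "\<And>v. poly_mv p ?B v = 0" using matpow_annihilating by blast
  obtain ls where ls: "\<And>l. l \<in> set ls \<Longrightarrow> det (?B - mat l) = 0" "\<And>v. shifts_mv ?B ls v = 0"
    using shifts_mv_eq_0_of_poly[OF p(1)] p(2) by blast
  have "Re l < 0" if "l \<in> set ls" for l
  proof (rule eig)
    have "?B - mat l = transpose (cmat A - mat l)"
      by (simp add: cmat_def transpose_def mat_def vec_eq_iff)
    then show "complex_eigenvalue A l"
      using ls(1)[OF that] by (simp add: complex_eigenvalue_def det_transpose)
  qed
  from lyapunov_form_chain[of ls ?B, OF this] obtain h :: "complex^'n \<Rightarrow> complex^'n \<Rightarrow> real" and a
    where h: "a > 0" "bilinear h" "\<And>z. h z z \<ge> (norm z)\<^sup>2"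
    "\<And>z. h z (?B *v z) + h (?B *v z) z \<le> - a * (norm z)\<^sup>2" using ls(2) by metis
  define c :: "real^'n \<Rightarrow> complex^'n" where "c z = (\<chi> i. complex_of_real (z $ i))" for z
  have lin: "linear c" by (rule linearI) (simp_all add: c_def vec_eq_iff complex_eq_iff)
  have cB: "c (transpose A *v z) = ?B *v c z" for z
    by (simp add: c_def cmat_def matrix_vector_mult_def vec_eq_iff)
  have c0: "norm (c z) > 0" if "z \<noteq> 0" for z using that by (auto simp: c_def vec_eq_iff)
  have "bilinear (\<lambda>z w. h (c z) (c w))"
    unfolding bilinear_def
    by (auto intro!: linearI simp: linear_add[OF lin] linear_scale[OF lin] bilinear_ladd[OF h(2)] bilinear_radd[OF h(2)]
        bilinear_lmul[OF h(2)] bilinear_rmul[OF h(2)])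
  moreover have "h (c z) (c z) > 0" if "z \<noteq> 0" for z
    using h(3)[of "c z"] c0[OF that] by (smt (verit) zero_less_power)
  moreover have "h (c z) (c (transpose A *v z)) + h (c (transpose A *v z)) (c z) < 0" if "z \<noteq> 0" for z
  proof -
    have "a * (norm (c z))\<^sup>2 > 0" using c0[OF that] h(1) by simp
    then show ?thesis using h(4)[of "c z"] unfolding cB by linarith
  qed
  ultimately show ?thesis by blast
qed

section \<open>Sign and symmetry of solutions of the Lyapunov equation\<close>

lemma bilinear_matrix_form: "bilinear (\<lambda>z w. z \<bullet> ((X :: real^'n^'n) *v w))"
  unfolding bilinear_def
  by (auto intro!: linearI simp: inner_add_left inner_add_right matrix_vector_right_distrib matrix_vector_mult_scaleR)

lemma form_lyapunov_eq:
  fixes A X :: "real^'n^'n"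
  shows "z \<bullet> (X *v (transpose A *v w)) + (transpose A *v z) \<bullet> (X *v w) = z \<bullet> ((A ** X + X ** transpose A) *v w)"
proof -
  have "(transpose A *v z) \<bullet> (X *v w) = z \<bullet> (A *v (X *v w))"
    unfolding transpose_matrix_vector by (rule dot_lmul_matrix)
  then show ?thesis
    by (simp only: matrix_vector_mult_add_rdistrib inner_add_right matrix_vector_mul_assoc add.commute)
qed

text \<open>Along the flow of \<open>transpose A\<close> the form of \<open>X\<close> has derivative
  given by \<open>- Q\<close>, hence does not increase; comparison with a strictly decreasing
  positive form then excludes negative values. This replaces the representation of \<open>X\<close>
  as an integral of exp(sA) Q exp(sA^T) over s > 0.\<close>

theorem lyapunov_solution_psd:
  fixes A X Q :: "real^'n^'n"
  assumes eig: "\<And>z. complex_eigenvalue A z \<Longrightarrow> Re z < 0"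
    and X: "A ** X + X ** transpose A = - Q" and Q: "\<And>z. z \<bullet> (Q *v z) \<ge> 0"
  shows "z \<bullet> (X *v z) \<ge> 0"
proof -
  obtain h :: "real^'n \<Rightarrow> real^'n \<Rightarrow> real" where h: "bilinear h" "\<And>z. z \<noteq> 0 \<Longrightarrow> h z z > 0"
    "\<And>z. z \<noteq> 0 \<Longrightarrow> h z (transpose A *v z) + h (transpose A *v z) z < 0" using lyapunov_form[OF eig] by blast
  show ?thesis
    by (rule form_nonneg_if_decreasing[where b="\<lambda>z w. z \<bullet> (X *v w)" and h=h and L="(*v) (transpose A)",
          OF bilinear_matrix_form h(1) matrix_vector_mul_linear h(2,3)])
      (unfold form_lyapunov_eq X, use Q in \<open>auto simp: bounded_bilinear.minus_left[OF bounded_bilinear_matrix_vector_mult]\<close>)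
qed

text \<open>The antisymmetric difference \<open>K\<close> solves the homogeneous equation. Its
  quadratic form vanishes identically and carries no information, so the bilinear form is read as a
  quadratic form on pairs \<open>(z, w)\<close>; being constant along the flow it is nonnegative,
  and changing the sign of \<open>z\<close> makes it zero.\<close>

theorem lyapunov_solution_symmetric:
  fixes A X Q :: "real^'n^'n"
  assumes eig: "\<And>z. complex_eigenvalue A z \<Longrightarrow> Re z < 0"
    and X: "A ** X + X ** transpose A = - Q" and Q: "transpose Q = Q"
  shows "transpose X = X"
proof -
  obtain h :: "real^'n \<Rightarrow> real^'n \<Rightarrow> real" where h: "bilinear h" "\<And>z. z \<noteq> 0 \<Longrightarrow> h z z > 0"
    "\<And>z. z \<noteq> 0 \<Longrightarrow> h z (transpose A *v z) + h (transpose A *v z) z < 0" using lyapunov_form[OF eig] by blast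
  define K where "K = X - transpose X"
  have "transpose (A ** X + X ** transpose A) = - Q"
    unfolding X using Q by (simp add: transpose_def vec_eq_iff)
  then have "A ** transpose X + transpose X ** transpose A = - Q"
    by (simp add: matrix_transpose_mul bounded_linear.linear[OF bounded_linear_transpose, THEN linear_add] add.commute)
  with X have K: "A ** K + K ** transpose A = 0"
    by (simp add: K_def bounded_bilinear.diff_left[OF bounded_bilinear_matrix_matrix_mult]
        bounded_bilinear.diff_right[OF bounded_bilinear_matrix_matrix_mult]) (simp add: algebra_simps)
  define L where "L v = (transpose A *v fst v, transpose A *v snd v)" for v :: "(real^'n) \<times> (real^'n)"
  have lin: "linear L" by (rule linearI) (auto simp: L_def matrix_vector_right_distrib matrix_vector_mult_scaleR)
  have h0: "h 0 w = 0" "h w 0 = 0" for w by (simp_all add: bilinear_lzero[OF h(1)] bilinear_rzero[OF h(1)])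
  have hnn: "h z z \<ge> 0" and hnn': "h z (transpose A *v z) + h (transpose A *v z) z \<le> 0" for z
    using h(2,3)[of z] h0 by (cases "z = 0"; force)+
  have 1: "fst v \<bullet> (K *v snd v) \<ge> 0" for v :: "(real^'n) \<times> (real^'n)"
  proof (rule form_nonneg_if_decreasing[where b="\<lambda>v w. fst v \<bullet> (K *v snd w)"
        and h="\<lambda>v w. h (fst v) (fst w) + h (snd v) (snd w)" and L=L])
    show "bilinear (\<lambda>v w. fst v \<bullet> (K *v snd w))"
      unfolding bilinear_def
      by (auto intro!: linearI simp: inner_add_left inner_add_right matrix_vector_right_distrib matrix_vector_mult_scaleR)
    show "bilinear (\<lambda>v w. h (fst v) (fst w) + h (snd v) (snd w))"
      unfolding bilinear_def
      by (auto intro!: linearI simp: bilinear_ladd[OF h(1)] bilinear_radd[OF h(1)]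
        bilinear_lmul[OF h(1)] bilinear_rmul[OF h(1)] algebra_simps)
    fix v :: "(real^'n) \<times> (real^'n)"
    show "h (fst v) (fst v) + h (snd v) (snd v) > 0" if "v \<noteq> 0"
      using that h(2)[of "fst v"] h(2)[of "snd v"] hnn[of "fst v"] hnn[of "snd v"] by (auto simp: prod_eq_iff add_pos_nonneg add_nonneg_pos)
    show "h (fst v) (fst (L v)) + h (snd v) (snd (L v)) + (h (fst (L v)) (fst v) + h (snd (L v)) (snd v)) < 0" if "v \<noteq> 0"
    proof -
      from that have "fst v \<noteq> 0 \<or> snd v \<noteq> 0" by (auto simp: prod_eq_iff)
      then show ?thesis
      proof
        assume "fst v \<noteq> 0"
        from h(3)[OF this] hnn'[of "snd v"] show ?thesis by (simp add: L_def)
      next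
        assume "snd v \<noteq> 0"
        from h(3)[OF this] hnn'[of "fst v"] show ?thesis by (simp add: L_def)
      qed
    qed
    show "fst v \<bullet> (K *v snd (L v)) + fst (L v) \<bullet> (K *v snd v) \<le> 0"
      using form_lyapunov_eq[of "fst v" K A "snd v"] by (simp add: L_def K)
  qed (rule lin)
  have "z \<bullet> (K *v w) = 0" for z w
    using 1[of "(z, w)"] 1[of "(- z, w)"] by simp
  then have "K *v w = 0" for w by (metis inner_eq_zero_iff)
  then have "K = 0" by (metis matrix_eq matrix_vector_mult_0)
  then show ?thesis by (simp add: K_def)
qed

section \<open>Linear matrix differential equations\<close>

text \<open>The iterated integrals of Picard's method are summed; their factorial decay gives
  uniform convergence, and the series is differentiated term by term.\<close>

lemma linear_matrix_ode_exists:
  fixes B :: "real \<Rightarrow> real^'n^'n"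
  assumes B: "continuous_on {0..T} B" and T: "T \<ge> 0"
  shows "\<exists>V. V 0 = mat 1 \<and> (\<forall>t\<in>{0..T}. (V has_vector_derivative V t ** B t) (at t within {0..T}))"
proof -
  interpret mm: bounded_bilinear "(**) :: real^'n^'n \<Rightarrow> real^'n^'n \<Rightarrow> real^'n^'n"
    by (rule bounded_bilinear_matrix_matrix_mult)
  obtain b where b: "b > 0" "\<And>t. t \<in> {0..T} \<Longrightarrow> norm (B t) \<le> b"
    using compact_imp_bounded[OF compact_continuous_image[OF B compact_Icc]]
    by (auto simp: bounded_pos)
  define P where "P = rec_nat (\<lambda>_. mat 1 :: real^'n^'n) (\<lambda>n p t. integral {0..t} (\<lambda>s. p s ** B s))"
  have P0: "P 0 t = mat 1" and PS: "P (Suc n) t = integral {0..t} (\<lambda>s. P n s ** B s)" for n t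
    by (simp_all add: P_def)
  have contP: "continuous_on {0..T} (P n)" for n
  proof (induction n)
    case 0 show ?case by (simp add: P0)
  next
    case (Suc n)
    have "continuous_on {0..T} (\<lambda>t. integral {0..t} (\<lambda>s. P n s ** B s))"
      by (intro indefinite_integral_continuous_1 integrable_continuous_interval mm.continuous_on Suc B)
    then show ?case by (simp add: PS[abs_def])
  qed
  have derP: "(P (Suc n) has_vector_derivative P n t ** B t) (at t within {0..T})" if "t \<in> {0..T}" for n t
    unfolding PS[abs_def]
    by (rule integral_has_vector_derivative) (intro mm.continuous_on contP B that)+
  define K where "K = norm (mat 1 :: real^'n^'n)"
  have bound: "norm (P n t) \<le> K * (b * t) ^ n / fact n" if "t \<in> {0..T}" for n t
    using that
  proof (induction n arbitrary: t)
    case 0 then show ?case by (simp add: P0 K_def)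
  next
    case (Suc n)
    have int: "((\<lambda>s. b * (K * (b * s) ^ n / fact n)) has_integral
        K * (b * t) ^ Suc n / fact (Suc n) - K * (b * 0) ^ Suc n / fact (Suc n)) {0..t}"
    proof (rule fundamental_theorem_of_calculus)
      fix s
      have "((\<lambda>s. K * (b * s) ^ Suc n / fact (Suc n)) has_real_derivative
          K * (of_nat (Suc n) * (b * 1 * (b * s) ^ n)) / fact (Suc n)) (at s within {0..t})"
        using DERIV_power[of "\<lambda>s. b * s" b s "{0..t}" "Suc n"]
        by (auto intro!: derivative_eq_intros simp del: power_Suc)
      also have "K * (of_nat (Suc n) * (b * 1 * (b * s) ^ n)) / fact (Suc n) = b * (K * (b * s) ^ n / fact n)"
        unfolding fact_Suc by (simp del: of_nat_Suc)
      finally show "((\<lambda>s. K * (b * s) ^ Suc n / fact (Suc n)) has_vector_derivative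
          b * (K * (b * s) ^ n / fact n)) (at s within {0..t})"
        by (simp add: has_real_derivative_iff_has_vector_derivative)
    qed (use Suc.prems in auto)
    have "norm (P (Suc n) t) \<le> integral {0..t} (\<lambda>s. b * (K * (b * s) ^ n / fact n))"
      unfolding PS
    proof (rule integral_norm_bound_integral)
      show "(\<lambda>s. P n s ** B s) integrable_on {0..t}"
        by (intro integrable_continuous_interval mm.continuous_on continuous_on_subset[OF contP]
            continuous_on_subset[OF B]) (use Suc.prems in auto)
      show "(\<lambda>s. b * (K * (b * s) ^ n / fact n)) integrable_on {0..t}" using int by blast
      fix s assume s: "s \<in> {0..t}"
      then have sT: "s \<in> {0..T}" using Suc.prems by auto
      have "norm (P n s ** B s) \<le> norm (P n s) * norm (B s)" by (rule norm_matrix_matrix_mult_le)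
      also have "\<dots> \<le> (K * (b * s) ^ n / fact n) * b"
        using Suc.IH[OF sT] b(2)[OF sT] order_trans[OF norm_ge_zero Suc.IH[OF sT]] by (intro mult_mono) auto
      finally show "norm (P n s ** B s) \<le> b * (K * (b * s) ^ n / fact n)" by (simp add: mult.commute)
    qed
    then show ?case using integral_unique[OF int] by simp
  qed
  have K0: "K \<ge> 0" by (simp add: K_def)
  have bound': "norm (P n t) \<le> K * ((b * T) ^ n / fact n)" if "t \<in> {0..T}" for n t
  proof -
    have "norm (P n t) \<le> K * ((b * t) ^ n / fact n)" using bound[OF that, of n] by simp
    also have "\<dots> \<le> K * ((b * T) ^ n / fact n)"
      using that b K0 by (intro mult_left_mono divide_right_mono power_mono) auto
    finally show ?thesis .
  qed
  have summ: "summable (\<lambda>n. K * ((b * T) ^ n / fact n))"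
    by (intro summable_mult) (use summable_exp[of "b * T"] in \<open>simp add: field_simps\<close>)
  have unif: "uniform_limit {0..T} (\<lambda>n t. \<Sum>i<n. P i t) (\<lambda>t. \<Sum>i. P i t) sequentially"
    by (rule Weierstrass_m_test[OF bound' summ])
  have sumsP: "(\<lambda>n. P n t) sums (\<Sum>i. P i t)" if "t \<in> {0..T}" for t
    by (rule summable_sums, rule summable_comparison_test'[OF summ bound'[OF that]])
  \<comment> \<open>The derivatives of the terms. Their partial sums are those of \<open>P\<close>,
    one index behind, times \<open>B t\<close>, so uniform convergence of the series itself yields
    that of its derivatives.\<close>
  define f' where "f' n t = (case n of 0 \<Rightarrow> 0 | Suc m \<Rightarrow> P m t ** B t)" for n t
  define V where "V t = (\<Sum>i. P i t)" for t
  have "\<exists>g. \<forall>x\<in>{0..T}. (\<lambda>n. P n x) sums g x \<and> (g has_derivative (\<lambda>h. h *\<^sub>R (V x ** B x))) (at x within {0..T})"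
  proof (rule has_derivative_series[where f' = "\<lambda>n x h. h *\<^sub>R f' n x"])
    show "0 \<in> {0..T}" using T by simp
    show "(\<lambda>n. P n 0) sums V 0" unfolding V_def using T by (intro sumsP) simp
    show "(P n has_derivative (\<lambda>h. h *\<^sub>R f' n x)) (at x within {0..T})" if "x \<in> {0..T}" for n x
    proof (cases n)
      case 0 then show ?thesis by (simp add: f'_def P0[abs_def])
    next
      case (Suc m)
      then show ?thesis using derP[OF that, of m] by (simp add: f'_def has_vector_derivative_def)
    qed
    show "\<forall>\<^sub>F n in sequentially. \<forall>x\<in>{0..T}. \<forall>h.
        norm ((\<Sum>i<n. h *\<^sub>R f' i x) - h *\<^sub>R (V x ** B x)) \<le> e * norm h" if e: "e > 0" for e
    proof -
      have "\<forall>\<^sub>F n in sequentially. \<forall>x\<in>{0..T}. dist (\<Sum>i<n. P i x) (V x) < e / b"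
        using unif e b by (simp add: uniform_limit_iff V_def)
      then have "\<forall>\<^sub>F n in sequentially. \<forall>x\<in>{0..T}. \<forall>h.
        norm ((\<Sum>i<Suc n. h *\<^sub>R f' i x) - h *\<^sub>R (V x ** B x)) \<le> e * norm h"
      proof eventually_elim
        case (elim n)
        show ?case
        proof (intro ballI allI)
          fix x h assume x: "x \<in> {0..T}"
          have "(\<Sum>i<Suc n. h *\<^sub>R f' i x) = h *\<^sub>R ((\<Sum>i<n. P i x) ** B x)"
            unfolding sum.lessThan_Suc_shift by (simp add: f'_def mm.sum_left scaleR_sum_right)
          then have "norm ((\<Sum>i<Suc n. h *\<^sub>R f' i x) - h *\<^sub>R (V x ** B x))
              = \<bar>h\<bar> * norm (((\<Sum>i<n. P i x) - V x) ** B x)"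
            by (simp add: mm.diff_left flip: scaleR_diff_right)
          also have "\<dots> \<le> \<bar>h\<bar> * (norm ((\<Sum>i<n. P i x) - V x) * norm (B x))"
            by (intro mult_left_mono norm_matrix_matrix_mult_le) auto
          also have "\<dots> \<le> \<bar>h\<bar> * (e / b * b)"
            using elim x b e by (intro mult_left_mono mult_mono) (auto simp: dist_norm intro: less_imp_le)
          also have "\<dots> = e * norm h" using b by simp
          finally show "norm ((\<Sum>i<Suc n. h *\<^sub>R f' i x) - h *\<^sub>R (V x ** B x)) \<le> e * norm h" .
        qed
      qed
      then show ?thesis by (subst (asm) eventually_sequentially_Suc)
    qed
  qed simp
  then obtain g where g: "\<And>x. x \<in> {0..T} \<Longrightarrow> (\<lambda>n. P n x) sums g x"
    "\<And>x. x \<in> {0..T} \<Longrightarrow> (g has_derivative (\<lambda>h. h *\<^sub>R (V x ** B x))) (at x within {0..T})" by blast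
  have gV: "g x = V x" if "x \<in> {0..T}" for x
    unfolding V_def using sums_unique[OF g(1)[OF that]] .
  have "(V has_vector_derivative V t ** B t) (at t within {0..T})" if "t \<in> {0..T}" for t
    unfolding has_vector_derivative_def
    by (rule has_derivative_transform[OF that _ g(2)[OF that]]) (simp add: gV)
  moreover have "V 0 = mat 1"
  proof -
    have "P n 0 = 0" if "n > 0" for n using that by (cases n) (auto simp: PS)
    then have "(\<lambda>n. P n 0) sums (\<Sum>i\<in>{0}. P i 0)" by (intro sums_finite) auto
    then show ?thesis using sums_unique[of "\<lambda>n. P n 0"] by (simp add: V_def P0)
  qed
  ultimately show ?thesis by blast
qed

text \<open>The inverse solves the adjoint equation: with U' = A U, the product V U has derivative
  zero and starts at the identity. \<open>U\<close> is obtained as a transpose, as the existence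
  lemma puts the coefficient on the right.\<close>

lemma linear_matrix_ode_invertible:
  fixes A :: "real \<Rightarrow> real^'n^'n"
  assumes A: "continuous_on {0..T} A" and T: "T \<ge> 0"
  shows "\<exists>V. V 0 = mat 1 \<and> (\<forall>t\<in>{0..T}. (V has_vector_derivative - (V t ** A t)) (at t within {0..T}) \<and> invertible (V t))"
proof -
  interpret mm: bounded_bilinear "(**) :: real^'n^'n \<Rightarrow> real^'n^'n \<Rightarrow> real^'n^'n"
    by (rule bounded_bilinear_matrix_matrix_mult)
  have "continuous_on {0..T} (\<lambda>t. - A t)" by (intro continuous_intros A)
  from linear_matrix_ode_exists[OF this T] obtain V where V: "V 0 = mat 1"
    "\<And>t. t \<in> {0..T} \<Longrightarrow> (V has_vector_derivative - (V t ** A t)) (at t within {0..T})"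
    by (auto simp: mm.minus_right)
  have "continuous_on {0..T} (\<lambda>t. transpose (A t))"
    by (rule bounded_linear.continuous_on[OF bounded_linear_transpose A])
  from linear_matrix_ode_exists[OF this T] obtain Z where Z: "Z 0 = mat 1"
    "\<And>t. t \<in> {0..T} \<Longrightarrow> (Z has_vector_derivative Z t ** transpose (A t)) (at t within {0..T})"
    by blast
  define U where "U t = transpose (Z t)" for t
  have U: "(U has_vector_derivative A t ** U t) (at t within {0..T})" if "t \<in> {0..T}" for t
    using bounded_linear.has_vector_derivative[OF bounded_linear_transpose Z(2)[OF that]]
    by (simp add: U_def[abs_def] matrix_transpose_mul)
  have "((\<lambda>t. V t ** U t) has_vector_derivative 0) (at t within {0..T})" if "t \<in> {0..T}" for t
    using mm.has_vector_derivative[OF V(2)[OF that] U[OF that]]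
    by (simp add: mm.minus_left matrix_mul_assoc)
  then obtain c where c: "\<And>t. t \<in> {0..T} \<Longrightarrow> V t ** U t = c"
    using has_vector_derivative_zero_constant[of "{0..T}" "\<lambda>t. V t ** U t"] by auto
  have "V 0 ** U 0 = mat 1" by (simp add: V Z U_def transpose_mat)
  then have "V t ** U t = mat 1" if "t \<in> {0..T}" for t using c[OF that] c[of 0] T by simp
  then have "invertible (V t)" if "t \<in> {0..T}" for t using that invertible_right_inverse by blast
  then show ?thesis using V by blast
qed

section \<open>Maximal inequality for exponential mixtures\<close>

lemma nn_integral_exp_normal_density:
  assumes s: "s > 0"
  shows "(\<integral>\<^sup>+x. ennreal (normal_density 0 s x) * ennreal (exp (c * x)) \<partial>lborel) = ennreal (exp (c\<^sup>2 * s\<^sup>2 / 2))"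
proof -
  have eq: "normal_density 0 s x * exp (c * x) = exp (c\<^sup>2 * s\<^sup>2 / 2) * normal_density (c * s\<^sup>2) s x" for x
  proof -
    have "- (x - 0)\<^sup>2 / (2 * s\<^sup>2) + c * x = c\<^sup>2 * s\<^sup>2 / 2 + - (x - c * s\<^sup>2)\<^sup>2 / (2 * s\<^sup>2)"
      using s by (simp add: field_simps power2_eq_square)
    then show ?thesis
      unfolding normal_density_def by (simp add: exp_add[symmetric] mult.commute mult.left_commute)
  qed
  interpret N: prob_space "density lborel (\<lambda>x. ennreal (normal_density (c * s\<^sup>2) s x))"
    by (rule prob_space_normal_density[OF s])
  have "(\<integral>\<^sup>+x. ennreal (normal_density (c * s\<^sup>2) s x) \<partial>lborel) = 1"
    using N.emeasure_space_1 by (simp add: emeasure_density)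
  then have "(\<integral>\<^sup>+x. ennreal (exp (c\<^sup>2 * s\<^sup>2 / 2)) * ennreal (normal_density (c * s\<^sup>2) s x) \<partial>lborel)
     = ennreal (exp (c\<^sup>2 * s\<^sup>2 / 2))"
    by (subst nn_integral_cmult) auto
  then show ?thesis
    by (simp add: ennreal_mult[symmetric] eq)
qed

context prob_space
begin

lemma indep_var_nn_integral_mult:
  fixes f g :: "'a \<Rightarrow> ennreal"
  assumes "indep_var borel f borel g"
  shows "(\<integral>\<^sup>+\<omega>. f \<omega> * g \<omega> \<partial>M) = (\<integral>\<^sup>+\<omega>. f \<omega> \<partial>M) * (\<integral>\<^sup>+\<omega>. g \<omega> \<partial>M)"
proof -
  have "indep_vars (\<lambda>_. borel) (case_bool f g) UNIV"
  proof -
    have "case_bool borel borel = (\<lambda>_. borel :: ennreal measure)" by (auto split: bool.split)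
    then show ?thesis using assms by (simp add: indep_var_def)
  qed
  from indep_vars_nn_integral[OF _ this] show ?thesis by (simp add: UNIV_bool mult.commute)
qed

lemma nn_integral_exp_sum_normal:
  fixes X :: "'i \<Rightarrow> 'a \<Rightarrow> real"
  assumes J: "finite J" and ind: "indep_vars (\<lambda>_. borel) X J"
    and dist: "\<And>p. p \<in> J \<Longrightarrow> distributed M lborel (X p) (\<lambda>x. ennreal (normal_density 0 (s p) x))"
    and s: "\<And>p. p \<in> J \<Longrightarrow> s p > 0"
  shows "(\<integral>\<^sup>+\<omega>. ennreal (exp (\<Sum>p\<in>J. X p \<omega> * c p)) \<partial>M) = ennreal (exp (\<Sum>p\<in>J. (c p)\<^sup>2 * (s p)\<^sup>2 / 2))"
proof -
  have ind': "indep_vars (\<lambda>_. borel) (\<lambda>p \<omega>. ennreal (exp (c p * X p \<omega>))) J"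
    by (rule indep_vars_compose2[OF ind, where Y="\<lambda>p x. ennreal (exp (c p * x))"]) measurable
  have "(\<integral>\<^sup>+\<omega>. ennreal (exp (\<Sum>p\<in>J. X p \<omega> * c p)) \<partial>M) = (\<integral>\<^sup>+\<omega>. (\<Prod>p\<in>J. ennreal (exp (c p * X p \<omega>))) \<partial>M)"
    by (simp add: exp_sum[OF J] prod_ennreal mult.commute)
  also have "\<dots> = (\<Prod>p\<in>J. \<integral>\<^sup>+\<omega>. ennreal (exp (c p * X p \<omega>)) \<partial>M)"
    by (rule indep_vars_nn_integral[OF J ind']) auto
  also have "\<dots> = (\<Prod>p\<in>J. ennreal (exp ((c p)\<^sup>2 * (s p)\<^sup>2 / 2)))"
  proof (rule prod.cong[OF refl])
    fix p assume p: "p \<in> J"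
    show "(\<integral>\<^sup>+\<omega>. ennreal (exp (c p * X p \<omega>)) \<partial>M) = ennreal (exp ((c p)\<^sup>2 * (s p)\<^sup>2 / 2))"
      using distributed_nn_integral[OF dist[OF p], of "\<lambda>x. ennreal (exp (c p * x))"]
        nn_integral_exp_normal_density[OF s[OF p], of "c p"] by simp
  qed
  also have "\<dots> = ennreal (exp (\<Sum>p\<in>J. (c p)\<^sup>2 * (s p)\<^sup>2 / 2))"
    by (simp add: exp_sum[OF J] prod_ennreal)
  finally show ?thesis .
qed

text \<open>Each exponential has independent multiplicative increments with mean at least one, so that
  Doob's argument works without conditional expectations.\<close>
lemma exponential_mixture_maximal_inequality:
  fixes X :: "nat \<times> 'k::finite \<Rightarrow> 'a \<Rightarrow> real" and d :: "nat \<times> 'k \<Rightarrow> real^'n" and w :: "real^'n \<Rightarrow> ennreal"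
  defines "S \<equiv> \<lambda>l x. \<Sum>p\<in>{..<l}\<times>UNIV. x p *\<^sub>R d p"
  assumes ind: "indep_vars (\<lambda>_. borel) X ({..<m}\<times>UNIV)"
    and dist: "\<And>p. p \<in> {..<m}\<times>UNIV \<Longrightarrow> distributed M lborel (X p) (\<lambda>x. ennreal (normal_density 0 (s p) x))"
    and s: "\<And>p. p \<in> {..<m}\<times>UNIV \<Longrightarrow> s p > 0"
    and w[measurable]: "w \<in> borel_measurable borel"
  defines "f \<equiv> \<lambda>x. \<integral>\<^sup>+\<xi>. ennreal (exp (x \<bullet> \<xi>)) * w \<xi> \<partial>lborel"
  shows "a * emeasure M {\<omega>\<in>space M. \<exists>l\<le>m. a \<le> f (S l (\<lambda>p. X p \<omega>))}
    \<le> (\<integral>\<^sup>+\<xi>. ennreal (exp (\<Sum>p\<in>{..<m}\<times>UNIV. (d p \<bullet> \<xi>)\<^sup>2 * (s p)\<^sup>2 / 2)) * w \<xi> \<partial>lborel)"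
proof -
  have Xm[measurable]: "X p \<in> borel_measurable M" if "p \<in> {..<m}\<times>UNIV" for p
    using ind that by (auto simp: indep_vars_def)
  have Sm: "(\<lambda>\<omega>. S l (\<lambda>p. X p \<omega>)) \<in> borel_measurable M" if "l \<le> m" for l
    unfolding S_def by (intro borel_measurable_sum borel_measurable_scaleR Xm) (use that in auto)
  have fm[measurable]: "f \<in> borel_measurable borel"
    unfolding f_def by measurable
  have pull: "f x * c = (\<integral>\<^sup>+\<xi>. ennreal (exp (x \<bullet> \<xi>)) * c * w \<xi> \<partial>lborel)" for x c
  proof -
    have "(\<integral>\<^sup>+\<xi>. ennreal (exp (x \<bullet> \<xi>)) * c * w \<xi> \<partial>lborel) = (\<integral>\<^sup>+\<xi>. ennreal (exp (x \<bullet> \<xi>)) * w \<xi> * c \<partial>lborel)"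
      by (rule nn_integral_cong) (simp only: mult.assoc mult.commute[of c])
    also have "\<dots> = f x * c" unfolding f_def by (rule nn_integral_multc) measurable
    finally show ?thesis by simp
  qed
  \<comment> \<open>Integrals of the mixture over an event are mixtures of integrals of single
    exponentials, so any comparison valid for each \<open>\<xi>\<close> passes to
    \<open>f\<close>.\<close>
  have fub: "(\<integral>\<^sup>+\<omega>. f (S l (\<lambda>p. X p \<omega>)) * indicator E \<omega> \<partial>M)
    = (\<integral>\<^sup>+\<xi>. (\<integral>\<^sup>+\<omega>. ennreal (exp (S l (\<lambda>p. X p \<omega>) \<bullet> \<xi>)) * indicator E \<omega> \<partial>M) * w \<xi> \<partial>lborel)"
    if l: "l \<le> m" and E[measurable]: "E \<in> sets M" for l E
  proof -
    note Sm[OF l, measurable]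
    interpret PS: pair_sigma_finite M "lborel :: (real^'n) measure" ..
    have "(\<integral>\<^sup>+\<omega>. f (S l (\<lambda>p. X p \<omega>)) * indicator E \<omega> \<partial>M)
      = (\<integral>\<^sup>+\<omega>. (\<integral>\<^sup>+\<xi>. ennreal (exp (S l (\<lambda>p. X p \<omega>) \<bullet> \<xi>)) * indicator E \<omega> * w \<xi> \<partial>lborel) \<partial>M)"
      by (rule nn_integral_cong) (rule pull)
    also have "\<dots> = (\<integral>\<^sup>+\<xi>. (\<integral>\<^sup>+\<omega>. ennreal (exp (S l (\<lambda>p. X p \<omega>) \<bullet> \<xi>)) * indicator E \<omega> * w \<xi> \<partial>M) \<partial>lborel)"
      by (rule PS.Fubini'[symmetric]) measurable
    also have "\<dots> = (\<integral>\<^sup>+\<xi>. (\<integral>\<^sup>+\<omega>. ennreal (exp (S l (\<lambda>p. X p \<omega>) \<bullet> \<xi>)) * indicator E \<omega> \<partial>M) * w \<xi> \<partial>lborel)"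
      by (intro nn_integral_cong nn_integral_multc) measurable
    finally show ?thesis .
  qed
  \<comment> \<open>First passage at step \<open>l\<close>: these events partition the event that
    the level \<open>a\<close> is ever reached.\<close>
  define E where "E l = {\<omega>\<in>space M. a \<le> f (S l (\<lambda>p. X p \<omega>)) \<and> (\<forall>l'\<in>{..<l}. f (S l' (\<lambda>p. X p \<omega>)) < a)}" for l
  have Em: "E l \<in> sets M" if "l \<le> m" for l
  proof -
    have "Measurable.pred M (\<lambda>\<omega>. f (S l' (\<lambda>p. X p \<omega>)) < a)" if "l' < l" for l'
    proof -
      have [measurable]: "(\<lambda>\<omega>. S l' (\<lambda>p. X p \<omega>)) \<in> borel_measurable M" using that \<open>l \<le> m\<close> by (intro Sm) auto
      show ?thesis by measurable
    qed
    moreover have [measurable]: "(\<lambda>\<omega>. S l (\<lambda>p. X p \<omega>)) \<in> borel_measurable M" using that by (rule Sm)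
    ultimately have "Measurable.pred M (\<lambda>\<omega>. a \<le> f (S l (\<lambda>p. X p \<omega>)) \<and> (\<forall>l'\<in>{..<l}. f (S l' (\<lambda>p. X p \<omega>)) < a))"
      by (intro pred_intros_logic pred_intros_finite) auto
    then show ?thesis unfolding E_def by (rule predE)
  qed
  have growth: "(\<integral>\<^sup>+\<omega>. ennreal (exp (S l (\<lambda>p. X p \<omega>) \<bullet> \<xi>)) * indicator (E l) \<omega> \<partial>M)
     \<le> (\<integral>\<^sup>+\<omega>. ennreal (exp (S m (\<lambda>p. X p \<omega>) \<bullet> \<xi>)) * indicator (E l) \<omega> \<partial>M)" if l: "l \<le> m" for l \<xi>
  proof -
    define J1 where "J1 = {..<l} \<times> (UNIV :: 'k set)"
    define J2 where "J2 = {l..<m} \<times> (UNIV :: 'k set)"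
    have J: "{..<m} \<times> (UNIV :: 'k set) = J1 \<union> J2" "J1 \<inter> J2 = {}" "finite J1" "finite J2"
      using l by (auto simp: J1_def J2_def)
    let ?P1 = "PiM J1 (\<lambda>_. borel :: real measure)" and ?P2 = "PiM J2 (\<lambda>_. borel :: real measure)"
    \<comment> \<open>Independence is available for functions of disjoint blocks of coordinates.
      \<open>Y1\<close> expresses the exponential up to \<open>l\<close> and the first-passage event
      through the increments before \<open>l\<close>; \<open>Y2\<close> collects the later
      ones.\<close>
    define Y1 where "Y1 x = ennreal (exp (S l x \<bullet> \<xi>)) * indicator {x\<in>space ?P1. a \<le> f (S l x) \<and> (\<forall>l'\<in>{..<l}. f (S l' x) < a)} x" for x
    define Y2 where "Y2 x = ennreal (exp (\<Sum>p\<in>J2. x p * (d p \<bullet> \<xi>)))" for x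
    have Sx: "S l' \<in> borel_measurable ?P1" if "l' \<le> l" for l'
      unfolding S_def
      by (intro borel_measurable_sum borel_measurable_scaleR measurable_component_singleton) (use that in \<open>auto simp: J1_def\<close>)
    have [measurable]: "S l \<in> borel_measurable ?P1" by (rule Sx) simp
    have "Measurable.pred ?P1 (\<lambda>x. f (S l' x) < a)" if "l' < l" for l'
    proof -
      have [measurable]: "S l' \<in> borel_measurable ?P1" using that by (intro Sx) auto
      show ?thesis by measurable
    qed
    then have "Measurable.pred ?P1 (\<lambda>x. a \<le> f (S l x) \<and> (\<forall>l'\<in>{..<l}. f (S l' x) < a))"
      by (intro pred_intros_logic pred_intros_finite) auto
    then have [measurable]: "{x\<in>space ?P1. a \<le> f (S l x) \<and> (\<forall>l'\<in>{..<l}. f (S l' x) < a)} \<in> sets ?P1"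
      by (rule predE)
    have Y1[measurable]: "Y1 \<in> borel_measurable ?P1" unfolding Y1_def by measurable
    have Y2[measurable]: "Y2 \<in> borel_measurable ?P2" unfolding Y2_def by measurable
    have indY: "indep_var borel (Y1 \<circ> (\<lambda>\<omega>. restrict (\<lambda>i. X i \<omega>) J1)) borel (Y2 \<circ> (\<lambda>\<omega>. restrict (\<lambda>i. X i \<omega>) J2))"
      by (rule indep_var_compose[OF indep_var_restrict[OF ind] Y1 Y2]) (use J in auto)
    have Srestr: "S l' (restrict (\<lambda>i. X i \<omega>) J1) = S l' (\<lambda>i. X i \<omega>)" if "l' \<le> l" for l' \<omega>
      unfolding S_def by (intro sum.cong) (use that in \<open>auto simp: J1_def\<close>)
    have e1: "(Y1 \<circ> (\<lambda>\<omega>. restrict (\<lambda>i. X i \<omega>) J1)) \<omega> = ennreal (exp (S l (\<lambda>p. X p \<omega>) \<bullet> \<xi>)) * indicator (E l) \<omega>"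
      if "\<omega> \<in> space M" for \<omega>
      using that by (auto simp: Y1_def Srestr E_def space_PiM indicator_def)
    have e2: "(Y2 \<circ> (\<lambda>\<omega>. restrict (\<lambda>i. X i \<omega>) J2)) \<omega> = ennreal (exp (\<Sum>p\<in>J2. X p \<omega> * (d p \<bullet> \<xi>)))" for \<omega>
      by (simp add: Y2_def)
    have split: "exp (S m (\<lambda>p. X p \<omega>) \<bullet> \<xi>) = exp (S l (\<lambda>p. X p \<omega>) \<bullet> \<xi>) * exp (\<Sum>p\<in>J2. X p \<omega> * (d p \<bullet> \<xi>))" for \<omega>
      unfolding S_def J(1) sum.union_disjoint[OF J(3,4,2)]
      by (simp add: inner_add_left inner_sum_left exp_add J1_def)
    have I2: "(\<integral>\<^sup>+\<omega>. ennreal (exp (\<Sum>p\<in>J2. X p \<omega> * (d p \<bullet> \<xi>))) \<partial>M) \<ge> 1"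
      by (subst nn_integral_exp_sum_normal[where s=s])
        (use J in \<open>auto intro!: indep_vars_subset[OF ind] dist s sum_nonneg\<close>)
    have "(\<integral>\<^sup>+\<omega>. ennreal (exp (S m (\<lambda>p. X p \<omega>) \<bullet> \<xi>)) * indicator (E l) \<omega> \<partial>M)
      = (\<integral>\<^sup>+\<omega>. (Y1 \<circ> (\<lambda>\<omega>. restrict (\<lambda>i. X i \<omega>) J1)) \<omega> * (Y2 \<circ> (\<lambda>\<omega>. restrict (\<lambda>i. X i \<omega>) J2)) \<omega> \<partial>M)"
      by (rule nn_integral_cong) (simp only: e1 e2 split ennreal_mult exp_ge_zero mult_ac)
    also have "\<dots> = (\<integral>\<^sup>+\<omega>. ennreal (exp (S l (\<lambda>p. X p \<omega>) \<bullet> \<xi>)) * indicator (E l) \<omega> \<partial>M)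
        * (\<integral>\<^sup>+\<omega>. ennreal (exp (\<Sum>p\<in>J2. X p \<omega> * (d p \<bullet> \<xi>))) \<partial>M)"
      by (subst indep_var_nn_integral_mult[OF indY]) (intro arg_cong2[where f="(*)"] nn_integral_cong e1 e2)
    also have "\<dots> \<ge> (\<integral>\<^sup>+\<omega>. ennreal (exp (S l (\<lambda>p. X p \<omega>) \<bullet> \<xi>)) * indicator (E l) \<omega> \<partial>M) * 1"
      by (rule mult_left_mono[OF I2]) simp
    finally show ?thesis by simp
  qed
  have disj: "disjoint_family_on E {..m}"
    unfolding disjoint_family_on_def
  proof (intro ballI impI)
    fix l l' :: nat assume "l \<noteq> l'"
    then consider "l < l'" | "l' < l" by linarith
    then show "E l \<inter> E l' = {}" by cases (force simp: E_def not_less[symmetric])+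
  qed
  have un: "{\<omega>\<in>space M. \<exists>l\<le>m. a \<le> f (S l (\<lambda>p. X p \<omega>))} = (\<Union>l\<in>{..m}. E l)"
  proof -
    have "\<exists>l\<le>m. \<omega> \<in> E l" if "\<omega> \<in> space M" "l0 \<le> m" "a \<le> f (S l0 (\<lambda>p. X p \<omega>))" for \<omega> l0
    proof -
      define l where "l = (LEAST l. a \<le> f (S l (\<lambda>p. X p \<omega>)))"
      have "a \<le> f (S l (\<lambda>p. X p \<omega>))" "l \<le> l0" "\<forall>l'<l. \<not> a \<le> f (S l' (\<lambda>p. X p \<omega>))"
        unfolding l_def using that(3) LeastI[of "\<lambda>l. a \<le> f (S l (\<lambda>p. X p \<omega>))"] Least_le[of "\<lambda>l. a \<le> f (S l (\<lambda>p. X p \<omega>))"]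
          not_less_Least[of _ "\<lambda>l. a \<le> f (S l (\<lambda>p. X p \<omega>))"] by blast+
      then show ?thesis using that by (intro exI[of _ l]) (auto simp: E_def not_le)
    qed
    then have "{\<omega>\<in>space M. \<exists>l\<le>m. a \<le> f (S l (\<lambda>p. X p \<omega>))} \<subseteq> (\<Union>l\<in>{..m}. E l)" by blast
    then show ?thesis by (auto simp: E_def)
  qed
  have "a * emeasure M {\<omega>\<in>space M. \<exists>l\<le>m. a \<le> f (S l (\<lambda>p. X p \<omega>))} = (\<Sum>l\<le>m. a * emeasure M (E l))"
    unfolding un by (subst sum_emeasure[symmetric]) (use disj Em in \<open>auto simp: sum_distrib_left\<close>)
  also have "\<dots> \<le> (\<Sum>l\<le>m. \<integral>\<^sup>+\<omega>. f (S m (\<lambda>p. X p \<omega>)) * indicator (E l) \<omega> \<partial>M)"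
  proof (rule sum_mono)
    fix l assume "l \<in> {..m}"
    then have l: "l \<le> m" by simp
    have "a * emeasure M (E l) = (\<integral>\<^sup>+\<omega>. a * indicator (E l) \<omega> \<partial>M)" using Em[OF l] by (simp add: nn_integral_cmult_indicator)
    also have "\<dots> \<le> (\<integral>\<^sup>+\<omega>. f (S l (\<lambda>p. X p \<omega>)) * indicator (E l) \<omega> \<partial>M)"
      by (rule nn_integral_mono) (auto simp: E_def indicator_def)
    also have "\<dots> \<le> (\<integral>\<^sup>+\<omega>. f (S m (\<lambda>p. X p \<omega>)) * indicator (E l) \<omega> \<partial>M)"
      unfolding fub[OF l Em[OF l]] fub[OF order_refl Em[OF l]]
      by (intro nn_integral_mono mult_right_mono growth[OF l]) simp
    finally show "a * emeasure M (E l) \<le> (\<integral>\<^sup>+\<omega>. f (S m (\<lambda>p. X p \<omega>)) * indicator (E l) \<omega> \<partial>M)" .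
  qed
  also have "\<dots> = (\<integral>\<^sup>+\<omega>. (\<Sum>l\<le>m. f (S m (\<lambda>p. X p \<omega>)) * indicator (E l) \<omega>) \<partial>M)"
  proof (rule nn_integral_sum[symmetric])
    fix l assume "l \<in> {..m}"
    then have [measurable]: "E l \<in> sets M" using Em by simp
    note Sm[OF order_refl, measurable]
    show "(\<lambda>\<omega>. f (S m (\<lambda>p. X p \<omega>)) * indicator (E l) \<omega>) \<in> borel_measurable M" by measurable
  qed
  also have "\<dots> = (\<integral>\<^sup>+\<omega>. f (S m (\<lambda>p. X p \<omega>)) * indicator (\<Union>l\<in>{..m}. E l) \<omega> \<partial>M)"
    by (simp add: sum_distrib_left[symmetric] indicator_UN_disjoint[OF _ disj])
  also have "\<dots> \<le> (\<integral>\<^sup>+\<omega>. f (S m (\<lambda>p. X p \<omega>)) * indicator (space M) \<omega> \<partial>M)"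
    by (intro nn_integral_mono mult_left_mono) (auto simp: indicator_def E_def)
  also have "\<dots> = (\<integral>\<^sup>+\<xi>. (\<integral>\<^sup>+\<omega>. ennreal (exp (S m (\<lambda>p. X p \<omega>) \<bullet> \<xi>)) * indicator (space M) \<omega> \<partial>M) * w \<xi> \<partial>lborel)"
    by (rule fub) auto
  also have "\<dots> = (\<integral>\<^sup>+\<xi>. (\<integral>\<^sup>+\<omega>. ennreal (exp (\<Sum>p\<in>{..<m}\<times>UNIV. X p \<omega> * (d p \<bullet> \<xi>))) \<partial>M) * w \<xi> \<partial>lborel)"
    by (intro nn_integral_cong arg_cong2[where f="(*)"] refl) (simp add: S_def inner_sum_left)
  also have "\<dots> = (\<integral>\<^sup>+\<xi>. ennreal (exp (\<Sum>p\<in>{..<m}\<times>UNIV. (d p \<bullet> \<xi>)\<^sup>2 * (s p)\<^sup>2 / 2)) * w \<xi> \<partial>lborel)"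
    using dist s by (subst nn_integral_exp_sum_normal[OF _ ind, where s=s]) auto
  finally show ?thesis .
qed

end

section \<open>Gaussian integrals and Gaussian random walks\<close>

lemma nn_integral_exp_norm_sq_finite:
  assumes m: "m > 0"
  shows "(\<integral>\<^sup>+\<xi>. ennreal (exp (- (m * (norm \<xi>)\<^sup>2 / 2))) \<partial>(lborel :: (real^'n) measure)) < \<infinity>"
proof -
  define s where "s = 1 / sqrt m"
  have s: "s > 0" and s2: "s\<^sup>2 = 1 / m" using m by (simp_all add: s_def power_divide)
  define C where "C = sqrt (2 * pi * s\<^sup>2)"
  have C: "C > 0" using s by (simp add: C_def)
  have eq: "exp (- (m * x\<^sup>2 / 2)) = C * normal_density 0 s x" for x
    using C m by (simp add: normal_density_def C_def[symmetric]) (simp add: s2)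
  interpret N: prob_space "density lborel (\<lambda>x. ennreal (normal_density 0 s x))"
    by (rule prob_space_normal_density[OF s])
  have "(\<integral>\<^sup>+x. ennreal (normal_density 0 s x) \<partial>lborel) = 1"
    using N.emeasure_space_1 by (simp add: emeasure_density)
  then have I: "(\<integral>\<^sup>+x. ennreal (exp (- (m * x\<^sup>2 / 2))) \<partial>lborel) = ennreal C"
    unfolding eq using C by (simp add: ennreal_mult nn_integral_cmult)
  have "(\<integral>\<^sup>+\<xi>. ennreal (exp (- (m * (norm \<xi>)\<^sup>2 / 2))) \<partial>(lborel :: (real^'n) measure))
     = (\<integral>\<^sup>+\<xi>. (\<Prod>b\<in>Basis. ennreal (exp (- (m * (\<xi> \<bullet> b)\<^sup>2 / 2)))) \<partial>(lborel :: (real^'n) measure))"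
  proof (rule nn_integral_cong)
    fix \<xi> :: "real^'n"
    have "- (m * (norm \<xi>)\<^sup>2 / 2) = (\<Sum>b\<in>Basis. - (m * (\<xi> \<bullet> b)\<^sup>2 / 2))"
      by (simp only: power2_norm_eq_inner euclidean_inner[of \<xi> \<xi>] power2_eq_square[symmetric]
          sum_distrib_left sum_divide_distrib sum_negf)
    then show "ennreal (exp (- (m * (norm \<xi>)\<^sup>2 / 2))) = (\<Prod>b\<in>Basis. ennreal (exp (- (m * (\<xi> \<bullet> b)\<^sup>2 / 2))))"
      by (simp only: exp_sum[OF finite_Basis] prod_ennreal exp_ge_zero)
  qed
  also have "\<dots> = (\<Prod>b\<in>(Basis :: (real^'n) set). ennreal C)"
    by (subst nn_integral_lborel_prod) (auto simp: I)
  also have "\<dots> < \<infinity>" using C by (simp add: ennreal_power)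
  finally show ?thesis .
qed

lemma matrix_inv_mult:
  assumes "invertible X"
  shows "X ** matrix_inv X = mat 1" "matrix_inv X ** X = mat 1"
  using someI_ex[OF assms[unfolded invertible_def]] by (simp_all add: matrix_inv_def)

lemma pos_form_invertible:
  fixes X :: "real^'n^'n"
  assumes "\<mu> > 0" and pos: "\<And>z. z \<bullet> (X *v z) \<ge> \<mu> * (norm z)\<^sup>2"
  shows "invertible X"
proof -
  have "z = 0" if "X *v z = 0" for z
  proof (rule ccontr)
    assume "z \<noteq> 0"
    then have "\<mu> * (norm z)\<^sup>2 > 0" using assms(1) by simp
    then show False using pos[of z] that by simp
  qed
  then show ?thesis
    using invertible_left_inverse matrix_left_invertible_ker by blast
qed

text \<open>The constant \<open>m\<close> is kept explicit because it converts a discretisation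
  error measured by the norm into a fraction of the form of \<open>P\<close>.\<close>

locale pos_def_matrix =
  fixes P :: "real^'n^'n" and m :: real
  assumes sym: "transpose P = P" and m: "m > 0" and pos: "\<And>z. z \<bullet> (P *v z) \<ge> m * (norm z)\<^sup>2"
begin

definition q where "q \<xi> = \<xi> \<bullet> (P *v \<xi>)"

lemma adj: "(P *v u) \<bullet> v = u \<bullet> (P *v v)"
  by (metis dot_lmul_matrix sym transpose_matrix_vector)

lemma q_add: "q (u + v) = q u + q v + 2 * ((P *v u) \<bullet> v)"
  using adj[of u v] by (simp add: q_def matrix_vector_right_distrib inner_add_left inner_add_right inner_commute)

lemma q_scaleR: "q (c *\<^sub>R u) = c\<^sup>2 * q u"
  by (simp add: q_def matrix_vector_mult_scaleR power2_eq_square)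

lemma q_nonneg: "q u \<ge> 0"
  using pos[of u] m by (simp add: q_def) (meson mult_nonneg_nonneg less_imp_le order_trans zero_le_power2)

lemma invertible_P: "invertible P"
  by (rule pos_form_invertible[OF m pos])

lemma P_inv: "P *v (matrix_inv P *v x) = x" "matrix_inv P *v (P *v x) = x"
  using invertible_P by (simp_all add: matrix_vector_mul_assoc matrix_inv_mult)

lemma q_measurable [measurable]: "q \<in> borel_measurable borel"
proof (rule borel_measurable_continuous_onI)
  show "continuous_on UNIV q"
    unfolding q_def[abs_def]
    by (intro continuous_intros linear_continuous_on_compose[OF _ matrix_vector_mul_linear])
qed

text \<open>The Gaussian normalisation. It is never evaluated, so no determinant occurs: it appears
  on both sides of the final estimate, and being positive and finite it cancels.\<close>

definition Z where "Z = (\<integral>\<^sup>+\<xi>. ennreal (exp (- q \<xi> / 2)) \<partial>lborel)"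

lemma Z_finite: "Z < \<infinity>"
proof -
  have "Z \<le> (\<integral>\<^sup>+\<xi>. ennreal (exp (- (m * (norm \<xi>)\<^sup>2 / 2))) \<partial>(lborel :: (real^'n) measure))"
    unfolding Z_def using pos by (intro nn_integral_mono ennreal_leI) (simp add: q_def)
  with nn_integral_exp_norm_sq_finite[OF m] show ?thesis by (rule le_less_trans[rotated])
qed

lemma Z_pos: "Z > 0"
proof -
  have "Z \<noteq> 0"
  proof
    assume "Z = 0"
    then have "AE \<xi> in lborel :: (real^'n) measure. ennreal (exp (- q \<xi> / 2)) = 0"
      unfolding Z_def by (subst (asm) nn_integral_0_iff_AE) auto
    then have "AE \<xi> in lborel :: (real^'n) measure. False" by simp
    then have "emeasure lborel (UNIV :: (real^'n) set) = 0" by (subst (asm) AE_iff_measurable[of UNIV]) auto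
    then show False by simp
  qed
  then show ?thesis by (simp add: zero_less_iff_neq_zero)
qed

lemma mult_Z_le_iff: "a * Z \<le> b * Z \<longleftrightarrow> a \<le> b"
  using ennreal_mult_le_mult_iff[of Z a b] Z_pos Z_finite by (simp add: mult.commute less_top)

text \<open>Substituting \<open>b *\<^sub>R \<xi>\<close> costs the Jacobian
  \<open>b ^ CARD('n)\<close>. With \<open>b = 1 - 2 * \<kappa>\<close> this is the dimensional
  factor of the theorem.\<close>

lemma nn_integral_gaussian_scaled:
  assumes b: "b > 0"
  shows "(\<integral>\<^sup>+\<xi>. ennreal (exp (- (b\<^sup>2 * q \<xi>) / 2)) \<partial>lborel) = ennreal (1 / b ^ CARD('n)) * Z"
proof -
  have "Z = ennreal (b ^ CARD('n)) * (\<integral>\<^sup>+\<xi>. ennreal (exp (- (b\<^sup>2 * q \<xi>) / 2)) \<partial>lborel)"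
    unfolding Z_def
    by (subst lborel_affine[of b 0])
      (use b in \<open>simp_all add: nn_integral_density nn_integral_distr nn_integral_cmult q_scaleR ennreal_power\<close>)
  then have "ennreal (1 / b ^ CARD('n)) * Z
      = (ennreal (1 / b ^ CARD('n)) * ennreal (b ^ CARD('n))) * (\<integral>\<^sup>+\<xi>. ennreal (exp (- (b\<^sup>2 * q \<xi>) / 2)) \<partial>lborel)"
    by (simp add: mult.assoc)
  also have "ennreal (1 / b ^ CARD('n)) * ennreal (b ^ CARD('n)) = 1"
    using b by (subst ennreal_mult[symmetric]) auto
  finally show ?thesis by simp
qed

text \<open>Translation by \<open>matrix_inv P *v x\<close> completes the square. Thus the
  exponential of the inverse form is a mixture with weight \<open>exp (- q \<xi> / 2)\<close>, as
  required by the maximal inequality.\<close>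

lemma nn_integral_gaussian_shifted:
  "(\<integral>\<^sup>+\<xi>. ennreal (exp (x \<bullet> \<xi>)) * ennreal (exp (- q \<xi> / 2)) \<partial>lborel)
     = ennreal (exp (x \<bullet> (matrix_inv P *v x) / 2)) * Z"
proof -
  define \<zeta> where "\<zeta> = matrix_inv P *v x"
  have x: "x = P *v \<zeta>" by (simp add: \<zeta>_def P_inv)
  have *: "ennreal (exp (x \<bullet> (\<zeta> + 1 *\<^sub>R \<xi>))) * ennreal (exp (- q (\<zeta> + 1 *\<^sub>R \<xi>) / 2))
     = ennreal (exp (x \<bullet> \<zeta> / 2)) * ennreal (exp (- q \<xi> / 2))" for \<xi>
  proof -
    have "x \<bullet> (\<zeta> + 1 *\<^sub>R \<xi>) - q (\<zeta> + 1 *\<^sub>R \<xi>) / 2 = x \<bullet> \<zeta> / 2 + - q \<xi> / 2"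
      by (simp add: q_add inner_add_right x) (simp add: q_def adj field_simps)
    then have "exp (x \<bullet> (\<zeta> + 1 *\<^sub>R \<xi>)) * exp (- q (\<zeta> + 1 *\<^sub>R \<xi>) / 2) = exp (x \<bullet> \<zeta> / 2) * exp (- q \<xi> / 2)"
      by (simp only: mult_exp_exp) simp
    then show ?thesis by (simp only: ennreal_mult[symmetric] exp_ge_zero)
  qed
  have "(\<integral>\<^sup>+\<xi>. ennreal (exp (x \<bullet> \<xi>)) * ennreal (exp (- q \<xi> / 2)) \<partial>lborel)
    = (\<integral>\<^sup>+\<xi>. ennreal (exp (x \<bullet> (\<zeta> + 1 *\<^sub>R \<xi>))) * ennreal (exp (- q (\<zeta> + 1 *\<^sub>R \<xi>) / 2)) \<partial>lborel)"
    by (subst lborel_affine[of 1 \<zeta>]) (simp_all add: nn_integral_density nn_integral_distr)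
  also have "\<dots> = ennreal (exp (x \<bullet> \<zeta> / 2)) * Z"
    unfolding * Z_def by (rule nn_integral_cmult) measurable
  finally show ?thesis by (simp add: \<zeta>_def)
qed

text \<open>The slack between the exponents \<open>n\<close> and \<open>n/2\<close> of \<open>1/(1 - 2\<kappa>)\<close> is used up by the
  tolerance \<open>1 + (1 - 2\<kappa>)\<close> on the covariance: \<open>1 - 2\<kappa>(2 - 2\<kappa>) = (1 - 2\<kappa>)\<^sup>2\<close>.\<close>
lemma gaussian_walk_maximal_inequality:
  fixes X :: "nat \<times> 'k::finite \<Rightarrow> 'a \<Rightarrow> real" and d :: "nat \<times> 'k \<Rightarrow> real^'n" and \<kappa> :: real
  defines "S \<equiv> \<lambda>l x. \<Sum>p\<in>{..<l}\<times>UNIV. x p *\<^sub>R d p"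
  assumes M: "prob_space M"
    and ind: "prob_space.indep_vars M (\<lambda>_. borel) X ({..<k}\<times>UNIV)"
    and dist: "\<And>p. p \<in> {..<k}\<times>UNIV \<Longrightarrow> distributed M lborel (X p) (\<lambda>x. ennreal (normal_density 0 (s p) x))"
    and s: "\<And>p. p \<in> {..<k}\<times>UNIV \<Longrightarrow> s p > 0"
    and kappa: "0 < \<kappa>" "\<kappa> < 1/2"
    and var: "\<And>\<xi>. (\<Sum>p\<in>{..<k}\<times>UNIV. (d p \<bullet> \<xi>)\<^sup>2 * (s p)\<^sup>2) \<le> (2 - 2 * \<kappa>) * q \<xi>"
  shows "measure M {\<omega>\<in>space M. \<exists>l\<le>k. \<alpha> \<le> S l (\<lambda>p. X p \<omega>) \<bullet> (matrix_inv P *v S l (\<lambda>p. X p \<omega>))}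
    \<le> (1 / (1 - 2 * \<kappa>)) ^ CARD('n) * exp (- \<kappa> * \<alpha>)"
proof -
  interpret prob_space M by (rule M)
  define w where "w \<xi> = ennreal (exp (- q \<xi> / 2))" for \<xi>
  have w[measurable]: "w \<in> borel_measurable borel" unfolding w_def by measurable
  \<comment> \<open>The mixture produces half the inverse form in the exponent; scaling the walk by
    \<open>r\<close> turns the factor 1/2 into \<open>\<kappa>\<close>, and \<open>a\<close> is then
    the value of the mixture at the level \<open>\<alpha>\<close>.\<close>
  define r where "r = sqrt (2 * \<kappa>)"
  have r: "r\<^sup>2 = 2 * \<kappa>" "r > 0" using kappa by (simp_all add: r_def)
  define d' where "d' p = r *\<^sub>R d p" for p
  define a where "a = ennreal (exp (\<kappa> * \<alpha>)) * Z"
  let ?f = "\<lambda>x. \<integral>\<^sup>+\<xi>. ennreal (exp (x \<bullet> \<xi>)) * w \<xi> \<partial>lborel"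
  have S': "(\<Sum>p\<in>{..<l}\<times>UNIV. x p *\<^sub>R d' p) = r *\<^sub>R S l x" for l x
    by (simp add: S_def d'_def scaleR_sum_right mult.commute)
  have ev: "a \<le> ?f (\<Sum>p\<in>{..<l}\<times>UNIV. x p *\<^sub>R d' p) \<longleftrightarrow> \<alpha> \<le> S l x \<bullet> (matrix_inv P *v S l x)" for l x
  proof -
    have "?f (r *\<^sub>R S l x) = ennreal (exp (\<kappa> * (S l x \<bullet> (matrix_inv P *v S l x)))) * Z"
      unfolding w_def nn_integral_gaussian_shifted using r(1)
      by (simp add: matrix_vector_mult_scaleR power2_eq_square mult.assoc[symmetric])
    moreover have "a \<le> ennreal (exp (\<kappa> * y)) * Z \<longleftrightarrow> \<alpha> \<le> y" for y
    proof -
      have "a \<le> ennreal (exp (\<kappa> * y)) * Z \<longleftrightarrow> ennreal (exp (\<kappa> * \<alpha>)) \<le> ennreal (exp (\<kappa> * y))"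
        unfolding a_def by (rule mult_Z_le_iff)
      then show ?thesis using kappa by simp
    qed
    ultimately show ?thesis by (simp add: S')
  qed
  define b where "b = 1 - 2 * \<kappa>"
  have b: "b > 0" using kappa by (simp add: b_def)
  let ?A = "{\<omega>\<in>space M. \<exists>l\<le>k. \<alpha> \<le> S l (\<lambda>p. X p \<omega>) \<bullet> (matrix_inv P *v S l (\<lambda>p. X p \<omega>))}"
  have "a * emeasure M ?A
    \<le> (\<integral>\<^sup>+\<xi>. ennreal (exp (\<Sum>p\<in>{..<k}\<times>UNIV. (d' p \<bullet> \<xi>)\<^sup>2 * (s p)\<^sup>2 / 2)) * w \<xi> \<partial>lborel)"
    using exponential_mixture_maximal_inequality[OF ind dist s w, where a=a and d=d'] unfolding ev by simp
  also have "\<dots> \<le> (\<integral>\<^sup>+\<xi>. ennreal (exp (- (b\<^sup>2 * q \<xi>) / 2)) \<partial>lborel)"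
  proof (rule nn_integral_mono)
    fix \<xi>
    have "(\<Sum>p\<in>{..<k}\<times>UNIV. (d' p \<bullet> \<xi>)\<^sup>2 * (s p)\<^sup>2 / 2) = \<kappa> * (\<Sum>p\<in>{..<k}\<times>UNIV. (d p \<bullet> \<xi>)\<^sup>2 * (s p)\<^sup>2)"
      by (simp add: d'_def power_mult_distrib r sum_distrib_left mult.assoc)
    also have "\<dots> \<le> \<kappa> * ((2 - 2 * \<kappa>) * q \<xi>)" using var kappa by (intro mult_left_mono) auto
    finally have "(\<Sum>p\<in>{..<k}\<times>UNIV. (d' p \<bullet> \<xi>)\<^sup>2 * (s p)\<^sup>2 / 2) + - q \<xi> / 2 \<le> - (b\<^sup>2 * q \<xi>) / 2"
      by (simp add: b_def power2_eq_square algebra_simps)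
    then show "ennreal (exp (\<Sum>p\<in>{..<k}\<times>UNIV. (d' p \<bullet> \<xi>)\<^sup>2 * (s p)\<^sup>2 / 2)) * w \<xi> \<le> ennreal (exp (- (b\<^sup>2 * q \<xi>) / 2))"
      unfolding w_def by (simp only: ennreal_mult[symmetric] exp_ge_zero mult_exp_exp) (intro ennreal_leI, simp)
  qed
  also have "\<dots> = ennreal (1 / b ^ CARD('n)) * Z" by (rule nn_integral_gaussian_scaled[OF b])
  finally have "ennreal (exp (\<kappa> * \<alpha>)) * emeasure M ?A * Z \<le> ennreal (1 / b ^ CARD('n)) * Z"
    by (simp only: a_def mult.assoc mult.commute[of Z])
  then have "ennreal (exp (\<kappa> * \<alpha>)) * emeasure M ?A \<le> ennreal (1 / b ^ CARD('n))"
    by (simp only: mult_Z_le_iff)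
  then have "exp (\<kappa> * \<alpha>) * measure M ?A \<le> 1 / b ^ CARD('n)"
    using b by (simp add: emeasure_eq_measure ennreal_mult[symmetric])
  then have "exp (- \<kappa> * \<alpha>) * (exp (\<kappa> * \<alpha>) * measure M ?A) \<le> exp (- \<kappa> * \<alpha>) * (1 / b ^ CARD('n))"
    by (intro mult_left_mono) auto
  then show ?thesis
    by (simp add: mult.assoc[symmetric] mult_exp_exp b_def power_divide mult.commute)
qed

end

section \<open>Riemann sums for Wiener integrals\<close>

text \<open>The inverse bound controls only \<open>norm (X *v z)\<close>, and \<open>X\<close> is
  not known to be symmetric. The estimate is therefore carried to \<open>X0\<close>, where symmetry
  and nonnegativity turn it into a bound on the form, and carried back. Each passage costs
  \<open>\<eta>\<close>.\<close>

lemma perturbed_psd_lower_bound: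
  fixes X X0 :: "real^'n^'n"
  assumes sym: "transpose X0 = X0" and psd: "\<And>z. z \<bullet> (X0 *v z) \<ge> 0"
    and close: "norm (X - X0) \<le> \<eta>" and inv: "invertible X" and K: "norm (matrix_inv X) \<le> K" "K > 0"
  shows "z \<bullet> (X *v z) \<ge> (1 / K - 2 * \<eta>) * (norm z)\<^sup>2"
proof -
  have diff: "norm (X *v z - X0 *v z) \<le> \<eta> * norm z" for z
  proof -
    have "norm ((X - X0) *v z) \<le> norm (X - X0) * norm z" by (rule norm_matrix_vector_mult_le)
    also have "\<dots> \<le> \<eta> * norm z" using close by (intro mult_right_mono) auto
    finally show ?thesis by (simp add: matrix_vector_mult_diff_rdistrib)
  qed
  have below: "norm (X0 *v z) \<ge> (1 / K - \<eta>) * norm z" for z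
  proof -
    have "norm z = norm (matrix_inv X *v (X *v z))"
      by (simp add: matrix_vector_mul_assoc matrix_inv_mult[OF inv])
    also have "\<dots> \<le> norm (matrix_inv X) * norm (X *v z)" by (rule norm_matrix_vector_mult_le)
    also have "\<dots> \<le> K * norm (X *v z)" using K by (intro mult_right_mono) auto
    finally have "norm z / K \<le> norm (X *v z)" using K by (simp add: field_simps)
    moreover have "norm (X *v z) \<le> norm (X0 *v z) + norm (X *v z - X0 *v z)"
      by (rule norm_triangle_sub)
    ultimately show ?thesis using diff[of z] by (simp add: algebra_simps)
  qed
  have "(1 / K - \<eta>) * (norm z)\<^sup>2 \<le> z \<bullet> (X0 *v z)"
    by (rule symmetric_psd_lower_bound[OF sym psd below])
  moreover have "\<bar>z \<bullet> (X *v z - X0 *v z)\<bar> \<le> norm z * (\<eta> * norm z)"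
    by (rule order_trans[OF Cauchy_Schwarz_ineq2]) (intro mult_left_mono diff, simp)
  ultimately show ?thesis by (simp add: inner_diff_right algebra_simps power2_eq_square)
qed

lemma matrix_matrix_transpose_form: "z \<bullet> ((G ** transpose G) *v z) = (norm (transpose G *v z))\<^sup>2"
  for G :: "real^'k^'n"
  unfolding power2_norm_eq_inner matrix_vector_mul_assoc[symmetric]
  by (metis dot_lmul_matrix transpose_matrix_vector)

lemma sum_column_inner_sq:
  fixes F :: "real^'k^'n"
  shows "(\<Sum>j\<in>UNIV. (column j F \<bullet> \<xi>)\<^sup>2) = (norm (transpose F *v \<xi>))\<^sup>2"
  unfolding norm_vec_sq
  by (intro sum.cong refl) (simp add: matrix_vector_mult_def transpose_def column_def inner_vec_def)

lemma norm_transpose_mult_sq_diff: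
  fixes F F' :: "real^'k^'n"
  shows "(norm (transpose F *v \<xi>))\<^sup>2 \<le> (norm (transpose F' *v \<xi>))\<^sup>2 + norm (F - F') * (norm F + norm F') * (norm \<xi>)\<^sup>2"
proof -
  let ?a = "transpose F *v \<xi>" and ?b = "transpose F' *v \<xi>"
  have a: "norm ?a \<le> norm F * norm \<xi>" and b: "norm ?b \<le> norm F' * norm \<xi>"
    using norm_matrix_vector_mult_le[of "transpose F" \<xi>] norm_matrix_vector_mult_le[of "transpose F'" \<xi>]
    by (simp_all only: norm_transpose)
  have "norm ?a - norm ?b \<le> norm (?a - ?b)" by (rule norm_triangle_ineq2)
  also have "?a - ?b = transpose (F - F') *v \<xi>"
    by (simp add: vec_eq_iff matrix_vector_mult_def transpose_def sum_subtractf left_diff_distrib)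
  also have "norm \<dots> \<le> norm (F - F') * norm \<xi>"
    using norm_matrix_vector_mult_le[of "transpose (F - F')" \<xi>] by (simp only: norm_transpose)
  finally have "(norm ?a - norm ?b) * (norm ?a + norm ?b) \<le> (norm (F - F') * norm \<xi>) * (norm F * norm \<xi> + norm F' * norm \<xi>)"
    using a b by (intro mult_mono add_mono) auto
  then show ?thesis by (simp add: power2_eq_square algebra_simps)
qed

section \<open>Uniform grids and convergence of Riemann sums\<close>

definition grid :: "real \<Rightarrow> nat \<Rightarrow> nat \<Rightarrow> real" where "grid u m i = real i * u / real m"

lemma grid_0: "grid u m 0 = 0" and grid_Suc: "grid u m (Suc i) = grid u m i + u / real m"
  by (simp_all add: grid_def field_simps add_divide_distrib)

lemma grid_mem: "u > 0 \<Longrightarrow> m > 0 \<Longrightarrow> i \<le> m \<Longrightarrow> grid u m i \<in> {0..u}"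
  by (simp add: grid_def field_simps)

lemma grid_less: "u > 0 \<Longrightarrow> m > 0 \<Longrightarrow> grid u m i < grid u m (Suc i)"
  by (simp add: grid_Suc)

context
  fixes u :: real and F F' :: "real \<Rightarrow> real^'k^'n"
  assumes u: "u > 0"
    and F: "\<And>s. s \<in> {0..u} \<Longrightarrow> (F has_vector_derivative F' s) (at s within {0..u})"
    and F': "continuous_on {0..u} F'"
begin

lemma integrand_continuous: "continuous_on {0..u} F"
  by (rule continuous_on_vector_derivative) (rule F)

lemma fine_grid:
  assumes f: "continuous_on {0..u} (f :: real \<Rightarrow> 'b::metric_space)" and e: "e > 0"
  shows "\<forall>\<^sub>F m in sequentially. m > 0 \<and> (\<forall>i<m. \<forall>s\<in>{grid u m i..grid u m (Suc i)}. \<forall>s'\<in>{grid u m i..grid u m (Suc i)}. dist (f s) (f s') < e)"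
proof -
  have "uniformly_continuous_on {0..u} f" using f by (simp add: compact_uniformly_continuous)
  then obtain d where d: "d > 0" "\<And>s s'. s \<in> {0..u} \<Longrightarrow> s' \<in> {0..u} \<Longrightarrow> dist s s' < d \<Longrightarrow> dist (f s) (f s') < e"
    using e unfolding uniformly_continuous_on_def by metis
  have "(\<lambda>m. u / real m) \<longlonglongrightarrow> 0" by (rule lim_const_over_n)
  then have "\<forall>\<^sub>F m in sequentially. u / real m < d" using d(1) by (rule order_tendstoD)
  with eventually_gt_at_top[of 0] show ?thesis
  proof eventually_elim
    case (elim m)
    show ?case
    proof (intro conjI allI impI ballI)
      fix i s s' assume i: "i < m" and s: "s \<in> {grid u m i..grid u m (Suc i)}" "s' \<in> {grid u m i..grid u m (Suc i)}"
      then have "dist s s' < d" using elim by (auto simp: grid_Suc dist_real_def)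
      moreover have "s \<in> {0..u}" "s' \<in> {0..u}"
        using s grid_mem[OF u, of m i] grid_mem[OF u, of m "Suc i"] i by auto
      ultimately show "dist (f s) (f s') < e" using d(2) by blast
    qed (use elim in auto)
  qed
qed

text \<open>By the mean value theorem each summand is compared with an increment of
  \<open>p\<close>, and the increments telescope. Discarding the nonnegative
  \<open>p \<xi> 0\<close> is where the form dominates the covariance instead of being equal to it.
  The error is a multiple of the squared norm so that one grid serves all
  \<open>\<xi>\<close>.\<close>

lemma variance_riemann_sum_le:
  fixes p :: "real^'n \<Rightarrow> real \<Rightarrow> real"
  assumes p: "\<And>\<xi> s. s \<in> {0..u} \<Longrightarrow> (p \<xi> has_real_derivative a * (norm (transpose (F s) *v \<xi>))\<^sup>2) (at s within {0..u})"
    and p0: "\<And>\<xi>. p \<xi> 0 \<ge> 0" and a: "a \<ge> 0" and \<eta>: "\<eta> > 0"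
  shows "\<forall>\<^sub>F m in sequentially. \<forall>\<xi>. (\<Sum>i<m. a * (norm (transpose (F (grid u m i)) *v \<xi>))\<^sup>2 * (u / real m)) \<le> p \<xi> u + \<eta> * (norm \<xi>)\<^sup>2"
proof -
  obtain b where b: "b > 0" "\<And>s. s \<in> {0..u} \<Longrightarrow> norm (F s) \<le> b"
    using compact_imp_bounded[OF compact_continuous_image[OF integrand_continuous compact_Icc]] by (auto simp: bounded_pos)
  \<comment> \<open>Chosen so that the total error \<open>a * (e * (2 * b)) * u\<close> stays below
    \<open>\<eta>\<close>; dividing by \<open>a + 1\<close> covers \<open>a = 0\<close>.\<close>
  define e where "e = \<eta> / (a + 1) / (2 * b * u)"
  have e: "e > 0" using \<eta> a b u by (simp add: e_def)
  have ae: "a * (e * (2 * b)) * u \<le> \<eta>"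
  proof -
    have "e * (2 * b * u) = \<eta> / (a + 1)" using b u by (simp add: e_def)
    then have "a * (e * (2 * b)) * u = a / (a + 1) * \<eta>" by (simp add: mult.assoc)
    also have "\<dots> \<le> 1 * \<eta>" using a \<eta> by (intro mult_right_mono) (auto simp: field_simps)
    finally show ?thesis by simp
  qed
  from fine_grid[OF integrand_continuous e] show ?thesis
  proof eventually_elim
    case (elim m)
    then have m: "m > 0" by simp
    show ?case
    proof
      fix \<xi>
      have step: "a * (norm (transpose (F (grid u m i)) *v \<xi>))\<^sup>2 * (u / real m)
          \<le> p \<xi> (grid u m (Suc i)) - p \<xi> (grid u m i) + a * (e * (2 * b)) * (norm \<xi>)\<^sup>2 * (u / real m)" if i: "i < m" for i
      proof -
        have mem: "grid u m i \<in> {0..u}" "grid u m (Suc i) \<in> {0..u}" using grid_mem[OF u m] i by auto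
        then have sub: "{grid u m i..grid u m (Suc i)} \<subseteq> {0..u}" by auto
        have "\<exists>s\<in>{grid u m i<..<grid u m (Suc i)}. p \<xi> (grid u m (Suc i)) - p \<xi> (grid u m i)
           = (grid u m (Suc i) - grid u m i) * (a * (norm (transpose (F s) *v \<xi>))\<^sup>2)"
        proof (rule mvt_simple[OF grid_less[OF u m], where f'="\<lambda>s h. h * (a * (norm (transpose (F s) *v \<xi>))\<^sup>2)"])
          fix s assume "grid u m i \<le> s" "s \<le> grid u m (Suc i)"
          then have "s \<in> {0..u}" using sub by auto
          from has_field_derivative_subset[OF p[OF this] sub]
          show "(p \<xi> has_derivative (\<lambda>h. h * (a * (norm (transpose (F s) *v \<xi>))\<^sup>2))) (at s within {grid u m i..grid u m (Suc i)})"
            by (simp add: has_field_derivative_def mult.commute[of _ "a * _"])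
        qed
        then obtain s where s': "s \<in> {grid u m i<..<grid u m (Suc i)}"
          and eq: "p \<xi> (grid u m (Suc i)) - p \<xi> (grid u m i) = (u / real m) * (a * (norm (transpose (F s) *v \<xi>))\<^sup>2)"
          by (metis add_diff_cancel_left' grid_Suc)
        from s' have s: "s \<in> {grid u m i..grid u m (Suc i)}" by auto
        have "dist (F (grid u m i)) (F s) < e" using elim i s grid_less[OF u m, of i] by auto
        then have "norm (F (grid u m i) - F s) * (norm (F (grid u m i)) + norm (F s)) \<le> e * (2 * b)"
          using b(2)[OF mem(1)] b(2)[of s] s sub e by (intro mult_mono) (auto simp: dist_norm subset_iff)
        then have "norm (F (grid u m i) - F s) * (norm (F (grid u m i)) + norm (F s)) * (norm \<xi>)\<^sup>2 \<le> e * (2 * b) * (norm \<xi>)\<^sup>2"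
          by (rule mult_right_mono) simp
        with norm_transpose_mult_sq_diff[of "F (grid u m i)" \<xi> "F s"]
        have "(norm (transpose (F (grid u m i)) *v \<xi>))\<^sup>2 \<le> (norm (transpose (F s) *v \<xi>))\<^sup>2 + e * (2 * b) * (norm \<xi>)\<^sup>2"
          by linarith
        then have "a * (norm (transpose (F (grid u m i)) *v \<xi>))\<^sup>2 * (u / real m)
           \<le> a * ((norm (transpose (F s) *v \<xi>))\<^sup>2 + e * (2 * b) * (norm \<xi>)\<^sup>2) * (u / real m)"
          using a u by (intro mult_right_mono mult_left_mono) auto
        then show ?thesis unfolding eq by (simp add: algebra_simps)
      qed
      have "(\<Sum>i<m. a * (norm (transpose (F (grid u m i)) *v \<xi>))\<^sup>2 * (u / real m))
         \<le> (\<Sum>i<m. p \<xi> (grid u m (Suc i)) - p \<xi> (grid u m i) + a * (e * (2 * b)) * (norm \<xi>)\<^sup>2 * (u / real m))"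
        by (intro sum_mono step) simp
      also have "\<dots> = p \<xi> (grid u m m) - p \<xi> (grid u m 0) + a * (e * (2 * b)) * u * (norm \<xi>)\<^sup>2"
        using m by (simp add: sum.distrib sum_lessThan_telescope[of "\<lambda>i. p \<xi> (grid u m i)"])
      also have "\<dots> \<le> p \<xi> u - 0 + \<eta> * (norm \<xi>)\<^sup>2"
      proof -
        have "grid u m m = u" using m by (simp add: grid_def)
        then show ?thesis using p0[of \<xi>] mult_right_mono[OF ae, of "(norm \<xi>)\<^sup>2"] by (simp add: grid_0)
      qed
      finally show "(\<Sum>i<m. a * (norm (transpose (F (grid u m i)) *v \<xi>))\<^sup>2 * (u / real m)) \<le> p \<xi> u + \<eta> * (norm \<xi>)\<^sup>2" by simp
    qed
  qed
qed

text \<open>Summation by parts for a single continuous path: since the integrand is continuously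
  differentiable, the convergence is pathwise and no limit in mean square is involved.\<close>

lemma wiener_riemann_sum_tendsto:
  fixes w :: "real \<Rightarrow> real^'k"
  assumes w: "continuous_on {0..u} w" and w0: "w 0 = 0" and r: "r \<in> {0..u}"
  shows "\<exists>l. (\<forall>m. l m \<le> m) \<and>
    (\<lambda>m. \<Sum>i<l m. F (grid u m i) *v (w (grid u m (Suc i)) - w (grid u m i))) \<longlonglongrightarrow> F r *v w r - integral {0..r} (\<lambda>s. F' s *v w s)"
proof -
  interpret mv: bounded_bilinear "(*v) :: real^'k^'n \<Rightarrow> real^'k \<Rightarrow> real^'n"
    by (rule bounded_bilinear_matrix_vector_mult)
  define Y where "Y r = F r *v w r - integral {0..r} (\<lambda>s. F' s *v w s)" for r
  \<comment> \<open>The number of complete grid cells before \<open>r\<close>.\<close>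
  define l where "l m = nat \<lfloor>r * real m / u\<rfloor>" for m
  have ru: "0 \<le> r / u" "r / u \<le> 1" using r u by auto
  have lm: "l m \<le> m" for m
  proof -
    have "r * real m / u \<le> real m" using mult_right_mono[OF ru(2), of "real m"] by simp
    then have "\<lfloor>r * real m / u\<rfloor> \<le> int m" by linarith
    then show ?thesis by (simp add: l_def)
  qed
  obtain b where b: "b > 0" "\<And>s. s \<in> {0..u} \<Longrightarrow> norm (F' s) \<le> b"
    using compact_imp_bounded[OF compact_continuous_image[OF F' compact_Icc]] by (auto simp: bounded_pos)
  have contF'w: "continuous_on {0..u} (\<lambda>s. F' s *v w s)" by (intro mv.continuous_on F' w)
  define D where "D m l = (\<Sum>i<l. F (grid u m i) *v (w (grid u m (Suc i)) - w (grid u m i))) - Y (grid u m l)" for m l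
  have D_small: "\<forall>\<^sub>F m in sequentially. \<forall>l\<le>m. norm (D m l) \<le> e" if e: "e > 0" for e
  proof -
    have "e / (b * u) > 0" using e b u by simp
    from fine_grid[OF w this] show ?thesis
    proof eventually_elim
      case (elim m)
      then have m: "m > 0" by simp
      have "norm (D m l) \<le> real l * (e / real m)" if "l \<le> m" for l
        using that
      proof (induction l)
        case 0 show ?case by (simp add: D_def Y_def grid_0 w0)
      next
        case (Suc l)
        define t0 where "t0 = grid u m l" define t1 where "t1 = grid u m (Suc l)"
        have t: "t0 \<in> {0..u}" "t1 \<in> {0..u}" "t0 \<le> t1" "t1 - t0 = u / real m"
          using grid_mem[OF u m, of l] grid_mem[OF u m, of "Suc l"] Suc.prems grid_less[OF u m, of l]
          by (simp_all add: t0_def t1_def) (simp add: grid_Suc)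
        have sub: "{t0..t1} \<subseteq> {0..u}" using t by auto
        have i1: "(F' has_integral F t1 - F t0) {t0..t1}"
          by (rule fundamental_theorem_of_calculus[OF t(3)])
            (use sub in \<open>auto intro!: has_vector_derivative_within_subset[OF F]\<close>)
        have i1': "((\<lambda>s. F' s *v w t1) has_integral (F t1 - F t0) *v w t1) {t0..t1}"
          using has_integral_linear[OF i1 mv.bounded_linear_left[of "w t1"]] by (simp add: o_def)
        have int: "(\<lambda>s. F' s *v w s) integrable_on {0..t}" if "t \<in> {0..u}" for t
          by (rule integrable_continuous_interval, rule continuous_on_subset[OF contF'w]) (use that in auto)
        have i2: "(\<lambda>s. F' s *v w s) integrable_on {t0..t1}"
          by (rule integrable_continuous_interval, rule continuous_on_subset[OF contF'w sub])
        have comb: "integral {0..t0} (\<lambda>s. F' s *v w s) + integral {t0..t1} (\<lambda>s. F' s *v w s) = integral {0..t1} (\<lambda>s. F' s *v w s)"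
          using t by (intro Henstock_Kurzweil_Integration.integral_combine int) auto
        \<comment> \<open>The error made on one cell is the integral of
          \<open>F' s *v (w s - w t1)\<close>, which is small by uniform continuity of the
          path.\<close>
        have "D m (Suc l) - D m l = integral {t0..t1} (\<lambda>s. F' s *v w s) - (F t1 - F t0) *v w t1"
          using comb by (simp add: D_def Y_def t0_def[symmetric] t1_def[symmetric] mv.diff_left mv.diff_right algebra_simps)
        also have "\<dots> = integral {t0..t1} (\<lambda>s. F' s *v w s - F' s *v w t1)"
          using Henstock_Kurzweil_Integration.integral_diff[OF i2 has_integral_integrable[OF i1']] integral_unique[OF i1'] by simp
        finally have eq: "D m (Suc l) - D m l = integral {t0..t1} (\<lambda>s. F' s *v w s - F' s *v w t1)" .
        have "norm (integral {t0..t1} (\<lambda>s. F' s *v w s - F' s *v w t1)) \<le> (b * (e / (b * u))) * (t1 - t0)"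
        proof (rule integral_bound[OF t(3)])
          show "continuous_on {t0..t1} (\<lambda>s. F' s *v w s - F' s *v w t1)"
            by (intro continuous_intros mv.continuous_on continuous_on_subset[OF F' sub] continuous_on_subset[OF w sub])
          fix s assume s: "s \<in> {t0..t1}"
          have "norm (F' s *v (w s - w t1)) \<le> norm (F' s) * norm (w s - w t1)"
            by (rule norm_matrix_vector_mult_le)
          also have "\<dots> \<le> b * (e / (b * u))"
          proof -
            have "dist (w s) (w t1) < e / (b * u)"
            proof -
              have "l < m" "s \<in> {grid u m l..grid u m (Suc l)}" "t1 \<in> {grid u m l..grid u m (Suc l)}"
                using Suc.prems s t(3) by (simp_all add: t0_def t1_def)
              then show ?thesis using elim by blast
            qed
            then show ?thesis using b(2)[of s] s sub b(1) by (intro mult_mono) (auto simp: dist_norm subset_iff)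
          qed
          finally show "norm (F' s *v w s - F' s *v w t1) \<le> b * (e / (b * u))" by (simp add: mv.diff_right)
        qed
        also have "\<dots> = e / real m" using b u m by (simp add: t(4))
        finally have "norm (D m (Suc l) - D m l) \<le> e / real m" by (simp add: eq)
        moreover have "norm (D m (Suc l)) \<le> norm (D m l) + norm (D m (Suc l) - D m l)"
          by (rule norm_triangle_sub)
        ultimately show ?case using Suc by (simp add: algebra_simps add_divide_distrib)
      qed
      moreover have "real l * (e / real m) \<le> e" if "l \<le> m" for l
        using that m e by (simp add: field_simps)
      ultimately show ?case using order_trans by blast
    qed
  qed
  have "(\<lambda>m. D m (l m)) \<longlonglongrightarrow> 0"
  proof (rule tendstoI)
    fix e :: real assume "e > 0"
    then have "e / 2 > 0" by simp
    from D_small[OF this] show "\<forall>\<^sub>F m in sequentially. dist (D m (l m)) 0 < e"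
    proof eventually_elim
      case (elim m)
      then have "norm (D m (l m)) \<le> e / 2" using lm by blast
      then show ?case using \<open>e > 0\<close> by simp
    qed
  qed
  moreover have "(\<lambda>m. Y (grid u m (l m))) \<longlonglongrightarrow> Y r"
  proof -
    have contY: "continuous_on {0..u} Y"
      unfolding Y_def[abs_def]
      by (intro continuous_intros mv.continuous_on integrand_continuous w indefinite_integral_continuous_1 integrable_continuous_interval contF'w)
    have close: "\<bar>grid u m (l m) - r\<bar> \<le> u / real m" if m: "m > 0" for m
    proof -
      have "0 \<le> r * real m / u" using r u by auto
      then have "real (l m) \<le> r * real m / u" "r * real m / u \<le> real (l m) + 1"
        unfolding l_def by linarith+
      then have "real (l m) * (u / real m) \<le> (r * real m / u) * (u / real m)"
        "(r * real m / u) * (u / real m) \<le> (real (l m) + 1) * (u / real m)"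
        using u m by (intro mult_right_mono; simp)+
      then show ?thesis using u m by (simp add: grid_def algebra_simps add_divide_distrib)
    qed
    have "(\<lambda>m. grid u m (l m)) \<longlonglongrightarrow> r"
    proof (rule LIM_zero_cancel, rule Lim_null_comparison)
      show "\<forall>\<^sub>F m in sequentially. norm (grid u m (l m) - r) \<le> u / real m"
        using eventually_gt_at_top[of 0] by eventually_elim (use close in auto)
      show "(\<lambda>m. u / real m) \<longlonglongrightarrow> 0" by (rule lim_const_over_n)
    qed
    moreover have "\<forall>\<^sub>F m in sequentially. grid u m (l m) \<in> {0..u}"
      using eventually_gt_at_top[of 0] by eventually_elim (use grid_mem[OF u] lm in blast)
    ultimately show ?thesis using continuous_on_tendsto_compose[OF contY _ r] by blast
  qed
  ultimately have "(\<lambda>m. D m (l m) + Y (grid u m (l m))) \<longlonglongrightarrow> 0 + Y r" by (rule tendsto_add)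
  then show ?thesis using lm by (intro exI[of _ l]) (simp add: D_def Y_def)
qed

end

section \<open>Wiener integrals and linear stochastic differential equations\<close>

text \<open>Fatou for a lower limit of events, by continuity along the increasing tail
  intersections. It is phrased as a covering so that later events need only be included in a
  measurable set, not shown to be measurable.\<close>

lemma (in prob_space) prob_eventually_le:
  assumes A: "\<And>m. A m \<in> sets M" and B: "\<forall>\<^sub>F m in sequentially. prob (A m) \<le> B"
  shows "\<exists>E\<in>sets M. {\<omega>\<in>space M. \<forall>\<^sub>F m in sequentially. \<omega> \<in> A m} \<subseteq> E \<and> prob E \<le> B"
proof -
  define C where "C k = (\<Inter>m\<in>{k..}. A m)" for k
  have C: "C k \<in> sets M" for k unfolding C_def using A by (intro sets.countable_INT) auto
  have "incseq C" unfolding C_def by (intro incseq_SucI INF_superset_mono) auto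
  then have "(\<lambda>k. prob (C k)) \<longlonglongrightarrow> prob (\<Union>k. C k)"
    using C by (intro finite_Lim_measure_incseq) auto
  moreover obtain m0 where m0: "\<And>m. m \<ge> m0 \<Longrightarrow> prob (A m) \<le> B"
    using B by (auto simp: eventually_sequentially)
  have "prob (C k) \<le> B" for k
  proof -
    have "prob (C k) \<le> prob (A (max k m0))" using A by (intro finite_measure_mono) (auto simp: C_def)
    also have "\<dots> \<le> B" by (rule m0) simp
    finally show ?thesis .
  qed
  ultimately have "prob (\<Union>k. C k) \<le> B" by (intro LIMSEQ_le_const2[of _ _ B]) auto
  moreover have "{\<omega>\<in>space M. \<forall>\<^sub>F m in sequentially. \<omega> \<in> A m} \<subseteq> (\<Union>k. C k)"
    by (auto simp: C_def eventually_sequentially)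
  ultimately show ?thesis using C by (intro bexI[of _ "\<Union>k. C k"]) auto
qed

lemma brownian_increments:
  fixes W :: "real \<Rightarrow> 'a \<Rightarrow> real^'k"
  assumes BM: "std_brownian_motion M W" and u: "u > 0" and m: "m > 0"
  defines "X \<equiv> \<lambda>p \<omega>. (W (grid u m (Suc (fst p))) \<omega> - W (grid u m (fst p)) \<omega>) $ snd p"
  shows "prob_space.indep_vars M (\<lambda>_. borel) X ({..<m} \<times> UNIV)"
    and "p \<in> {..<m} \<times> UNIV \<Longrightarrow> distributed M lborel (X p) (\<lambda>x. ennreal (normal_density 0 (sqrt (u / real m)) x))"
proof -
  let ?ts = "grid u m"
  have ts: "0 \<le> ?ts 0 \<and> (\<forall>i<m. ?ts i < ?ts (Suc i))"
    using u m by (simp add: grid_0 grid_less)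
  have Xeq: "X = (\<lambda>(i, j) \<omega>. (W (?ts (Suc i)) \<omega> - W (?ts i) \<omega>) $ j)"
    by (auto simp: X_def)
  have B: "prob_space.indep_vars M (\<lambda>_. borel)
           (\<lambda>(i, j) \<omega>. (W (?ts (Suc i)) \<omega> - W (?ts i) \<omega>) $ j) ({..<m} \<times> UNIV) \<and>
        (\<forall>i<m. \<forall>j. distributed M lborel (\<lambda>\<omega>. (W (?ts (Suc i)) \<omega> - W (?ts i) \<omega>) $ j)
             (\<lambda>x. ennreal (normal_density 0 (sqrt (?ts (Suc i) - ?ts i)) x)))"
    using BM ts unfolding std_brownian_motion_def by blast
  then show "prob_space.indep_vars M (\<lambda>_. borel) X ({..<m} \<times> UNIV)"
    unfolding Xeq by blast
  have "?ts (Suc i) - ?ts i = u / real m" for i by (simp add: grid_Suc)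
  then show "distributed M lborel (X p) (\<lambda>x. ennreal (normal_density 0 (sqrt (u / real m)) x))" if "p \<in> {..<m} \<times> UNIV"
    using B that by (auto simp: X_def)
qed

text \<open>A path that exceeds \<open>\<alpha>\<close> strictly at some time is exceeded by its
  Riemann sums at all fine grids, so the event lies in the lower limit of the corresponding events
  for the Gaussian walks, which are bounded uniformly. The strict inequality is what survives the
  approximation.\<close>

lemma (in pos_def_matrix) wiener_integral_maximal_inequality:
  fixes W :: "real \<Rightarrow> 'a \<Rightarrow> real^'k" and F F' :: "real \<Rightarrow> real^'k^'n" and p :: "real^'n \<Rightarrow> real \<Rightarrow> real"
  assumes BM: "std_brownian_motion M W" and u: "u > 0" and kappa: "0 < \<kappa>" "\<kappa> < 1/2"
    and F: "\<And>s. s \<in> {0..u} \<Longrightarrow> (F has_vector_derivative F' s) (at s within {0..u})"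
    and F': "continuous_on {0..u} F'"
    and p: "\<And>\<xi> s. s \<in> {0..u} \<Longrightarrow> (p \<xi> has_real_derivative c\<^sup>2 * (norm (transpose (F s) *v \<xi>))\<^sup>2) (at s within {0..u})"
    and p0: "\<And>\<xi>. p \<xi> 0 \<ge> 0" and pu: "\<And>\<xi>. p \<xi> u \<le> q \<xi>"
  defines "N \<equiv> \<lambda>r \<omega>. c *\<^sub>R (F r *v W r \<omega> - integral {0..r} (\<lambda>s. F' s *v W s \<omega>))"
  shows "\<exists>E\<in>sets M. {\<omega>\<in>space M. \<exists>r\<in>{0..u}. \<alpha> < N r \<omega> \<bullet> (matrix_inv P *v N r \<omega>)} \<subseteq> E
     \<and> measure M E \<le> (1 / (1 - 2 * \<kappa>)) ^ CARD('n) * exp (- \<kappa> * \<alpha>)"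
proof -
  interpret prob_space M using BM by (simp add: std_brownian_motion_def)
  have Wm: "W t \<in> borel_measurable M" if "t \<ge> 0" for t
    using BM that by (simp add: std_brownian_motion_def)
  define X where "X m p \<omega> = (W (grid u m (Suc (fst p))) \<omega> - W (grid u m (fst p)) \<omega>) $ snd p" for m :: nat and p :: "nat \<times> 'k" and \<omega>
  define d where "d m p = c *\<^sub>R column (snd p) (F (grid u m (fst p)))" for m :: nat and p :: "nat \<times> 'k"
  define S where "S m l \<omega> = (\<Sum>p\<in>{..<l}\<times>UNIV. X m p \<omega> *\<^sub>R d m p)" for m l \<omega>
  have S_eq: "S m l \<omega> = c *\<^sub>R (\<Sum>i<l. F (grid u m i) *v (W (grid u m (Suc i)) \<omega> - W (grid u m i) \<omega>))" for m l \<omega>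
    unfolding S_def sum.cartesian_product[symmetric, of "\<lambda>i j. X m (i, j) \<omega> *\<^sub>R d m (i, j)", unfolded split_def prod.collapse]
    by (simp add: X_def d_def matrix_mult_sum scaleR_sum_right scalar_mult_eq_scaleR mult.commute)
  define A where "A m = {\<omega>\<in>space M. \<exists>l\<le>m. \<alpha> \<le> S m l \<omega> \<bullet> (matrix_inv P *v S m l \<omega>)}" for m
  have grid_nn: "grid u m i \<ge> 0" for m i using u by (simp add: grid_def)
  have cont_form: "continuous_on UNIV (\<lambda>x. x \<bullet> (matrix_inv P *v x))"
    by (intro continuous_intros linear_continuous_on_compose[OF _ matrix_vector_mul_linear])
  have A: "A m \<in> sets M" for m
  proof -
    have [measurable]: "(\<lambda>x. x \<bullet> (matrix_inv P *v x)) \<in> borel_measurable borel"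
      by (rule borel_measurable_continuous_onI[OF cont_form])
    have [measurable]: "S m l \<in> borel_measurable M" for l
    proof -
      have "continuous_on UNIV (\<lambda>x :: real^'k. x $ j)" for j by (intro continuous_intros)
      then have [measurable]: "(\<lambda>x :: real^'k. x $ j) \<in> borel_measurable borel" for j
        by (rule borel_measurable_continuous_onI)
      have [measurable]: "X m p \<in> borel_measurable M" for p
      proof -
        note Wm[OF grid_nn, measurable]
        show ?thesis unfolding X_def[abs_def] by measurable
      qed
      show ?thesis unfolding S_def[abs_def] by measurable
    qed
    have "Measurable.pred M (\<lambda>\<omega>. \<exists>l\<in>{..m}. \<alpha> \<le> S m l \<omega> \<bullet> (matrix_inv P *v S m l \<omega>))" by measurable
    then have "{\<omega>\<in>space M. \<exists>l\<in>{..m}. \<alpha> \<le> S m l \<omega> \<bullet> (matrix_inv P *v S m l \<omega>)} \<in> sets M" by (rule predE)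
    then show ?thesis by (simp add: A_def Bex_def)
  qed
  have A_le: "\<forall>\<^sub>F k in sequentially. prob (A k) \<le> (1 / (1 - 2 * \<kappa>)) ^ CARD('n) * exp (- \<kappa> * \<alpha>)"
  proof -
    \<comment> \<open>Here \<open>m\<close> is the constant of positive definiteness,
      \<open>k\<close> the number of steps. The choice makes the discretisation error at most
      \<open>(1 - 2 * \<kappa>) * q \<xi>\<close>, the excess over \<open>q \<xi>\<close> that the
      walk inequality tolerates.\<close>
    define \<eta> where "\<eta> = (1 - 2 * \<kappa>) * m"
    have \<eta>: "\<eta> > 0" using kappa m by (simp add: \<eta>_def)
    have "\<forall>\<^sub>F k in sequentially. \<forall>\<xi>. (\<Sum>i<k. c\<^sup>2 * (norm (transpose (F (grid u k i)) *v \<xi>))\<^sup>2 * (u / real k)) \<le> p \<xi> u + \<eta> * (norm \<xi>)\<^sup>2"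
      by (rule variance_riemann_sum_le[OF u F F' p p0]) (use \<eta> in auto)
    with eventually_gt_at_top[of 0] show ?thesis
    proof eventually_elim
      case (elim k)
      have s: "sqrt (u / real k) > 0" using u elim by simp
      show ?case
        unfolding A_def S_def
      proof (rule gaussian_walk_maximal_inequality[where s="\<lambda>_. sqrt (u / real k)"])
        show "indep_vars (\<lambda>_. borel) (X k) ({..<k} \<times> UNIV)"
          unfolding X_def[abs_def] by (rule brownian_increments(1)[OF BM u]) (use elim in simp)
        show "distributed M lborel (X k p) (\<lambda>x. ennreal (normal_density 0 (sqrt (u / real k)) x))"
          if "p \<in> {..<k} \<times> UNIV" for p
          unfolding X_def[abs_def] by (rule brownian_increments(2)[OF BM u _ that]) (use elim in simp)
        fix \<xi>
        have "(\<Sum>p\<in>{..<k}\<times>UNIV. (d k p \<bullet> \<xi>)\<^sup>2 * (sqrt (u / real k))\<^sup>2)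
          = (\<Sum>i<k. \<Sum>j\<in>UNIV. c\<^sup>2 * (column j (F (grid u k i)) \<bullet> \<xi>)\<^sup>2 * (u / real k))"
          using s unfolding sum.cartesian_product
          by (intro sum.cong refl) (auto simp: d_def power_mult_distrib)
        also have "\<dots> = (\<Sum>i<k. c\<^sup>2 * (norm (transpose (F (grid u k i)) *v \<xi>))\<^sup>2 * (u / real k))"
          by (simp only: sum_distrib_left[symmetric] sum_distrib_right[symmetric] sum_column_inner_sq)
        also have "\<dots> \<le> p \<xi> u + \<eta> * (norm \<xi>)\<^sup>2" using elim by blast
        also have "\<dots> \<le> q \<xi> + (1 - 2 * \<kappa>) * q \<xi>"
          using pu[of \<xi>] pos[of \<xi>] kappa by (intro add_mono) (auto simp: \<eta>_def q_def mult.assoc)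
        finally show "(\<Sum>p\<in>{..<k}\<times>UNIV. (d k p \<bullet> \<xi>)\<^sup>2 * (sqrt (u / real k))\<^sup>2) \<le> (2 - 2 * \<kappa>) * q \<xi>"
          by (simp add: algebra_simps)
      qed (use s kappa prob_space_axioms in auto)
    qed
  qed
  have "{\<omega>\<in>space M. \<exists>r\<in>{0..u}. \<alpha> < N r \<omega> \<bullet> (matrix_inv P *v N r \<omega>)} \<subseteq> {\<omega>\<in>space M. \<forall>\<^sub>F m in sequentially. \<omega> \<in> A m}"
  proof safe
    fix \<omega> r assume \<omega>: "\<omega> \<in> space M" and r: "r \<in> {0..u}" and gt: "\<alpha> < N r \<omega> \<bullet> (matrix_inv P *v N r \<omega>)"
    have w: "continuous_on {0..u} (\<lambda>t. W t \<omega>)" "W 0 \<omega> = 0"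
      using BM \<omega> unfolding std_brownian_motion_def by (auto intro: continuous_on_subset)
    from wiener_riemann_sum_tendsto[OF u F F' w r] obtain l where l: "\<And>m. l m \<le> m"
      and lim: "(\<lambda>m. \<Sum>i<l m. F (grid u m i) *v (W (grid u m (Suc i)) \<omega> - W (grid u m i) \<omega>))
        \<longlonglongrightarrow> F r *v W r \<omega> - integral {0..r} (\<lambda>s. F' s *v W s \<omega>)" by blast
    have "(\<lambda>m. S m (l m) \<omega>) \<longlonglongrightarrow> N r \<omega>"
      unfolding S_eq N_def by (intro tendsto_intros lim)
    then have "(\<lambda>m. S m (l m) \<omega> \<bullet> (matrix_inv P *v S m (l m) \<omega>)) \<longlonglongrightarrow> N r \<omega> \<bullet> (matrix_inv P *v N r \<omega>)"
      using continuous_on_tendsto_compose[OF cont_form] by simp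
    then have "\<forall>\<^sub>F m in sequentially. \<alpha> < S m (l m) \<omega> \<bullet> (matrix_inv P *v S m (l m) \<omega>)"
      using gt by (rule order_tendstoD)
    then show "\<forall>\<^sub>F m in sequentially. \<omega> \<in> A m"
      by eventually_elim (use l \<omega> in \<open>auto simp: A_def intro: less_imp_le\<close>)
  qed
  with prob_eventually_le[OF A A_le] show ?thesis by blast
qed

text \<open>\<open>x = y - c G W\<close> is differentiable along almost every path, so \<open>V x\<close> is differentiated by the
  ordinary product rule.\<close>
lemma linear_sde_variation_of_constants:
  fixes V A :: "real \<Rightarrow> real^'n^'n" and G G' :: "real \<Rightarrow> real^'k^'n" and y :: "real \<Rightarrow> real^'n" and w :: "real \<Rightarrow> real^'k"
  assumes V: "\<And>s. s \<in> {0..T} \<Longrightarrow> (V has_vector_derivative - (V s ** A s)) (at s within {0..T})"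
    and G: "\<And>s. s \<in> {0..T} \<Longrightarrow> (G has_vector_derivative G' s) (at s within {0..T})"
    and cont: "continuous_on {0..T} A" "continuous_on {0..T} G'" "continuous_on {0..T} y" "continuous_on {0..T} w"
    and eq: "\<And>t. t \<in> {0..T} \<Longrightarrow> y t = integral {0..t} (\<lambda>s. A s *v y s) + c *\<^sub>R (G t *v w t - integral {0..t} (\<lambda>s. G' s *v w s))"
    and w0: "w 0 = 0" and r: "r \<in> {0..T}"
  shows "V r *v y r = c *\<^sub>R ((V r ** G r) *v w r - integral {0..r} (\<lambda>s. (V s ** G' s - (V s ** A s) ** G s) *v w s))"
proof -
  interpret mv: bounded_bilinear "(*v) :: real^'k^'n \<Rightarrow> real^'k \<Rightarrow> real^'n"
    by (rule bounded_bilinear_matrix_vector_mult)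
  interpret mn: bounded_bilinear "(*v) :: real^'n^'n \<Rightarrow> real^'n \<Rightarrow> real^'n"
    by (rule bounded_bilinear_matrix_vector_mult)
  define x where "x t = integral {0..t} (\<lambda>s. A s *v y s) - c *\<^sub>R integral {0..t} (\<lambda>s. G' s *v w s)" for t
  have yx: "y t = x t + c *\<^sub>R (G t *v w t)" if "t \<in> {0..T}" for t
    unfolding eq[OF that] x_def by (simp add: scaleR_diff_right)
  have dx: "(x has_vector_derivative (A s *v y s - c *\<^sub>R (G' s *v w s))) (at s within {0..T})" if "s \<in> {0..T}" for s
  proof -
    have "((\<lambda>t. integral {0..t} (\<lambda>s. A s *v y s)) has_vector_derivative A s *v y s) (at s within {0..T})"
      "((\<lambda>t. integral {0..t} (\<lambda>s. G' s *v w s)) has_vector_derivative G' s *v w s) (at s within {0..T})"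
      by (rule integral_has_vector_derivative[OF _ that], intro mv.continuous_on mn.continuous_on cont)+
    then show ?thesis unfolding x_def[abs_def] by (auto intro!: derivative_eq_intros)
  qed
  let ?H = "\<lambda>s. (V s ** G' s - (V s ** A s) ** G s) *v w s"
  have dVx: "((\<lambda>s. V s *v x s) has_vector_derivative - (c *\<^sub>R ?H s)) (at s within {0..T})" if "s \<in> {0..T}" for s
  proof -
    have "((\<lambda>s. V s *v x s) has_vector_derivative V s *v (A s *v y s - c *\<^sub>R (G' s *v w s)) + (- (V s ** A s)) *v x s) (at s within {0..T})"
      by (rule mn.has_vector_derivative[OF V[OF that] dx[OF that]])
    moreover have "V s *v (A s *v y s - c *\<^sub>R (G' s *v w s)) + (- (V s ** A s)) *v x s = - (c *\<^sub>R ?H s)"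
      unfolding yx[OF that]
      by (simp add: mn.minus_left mn.diff_right mn.add_right mn.scaleR_right mv.diff_left matrix_vector_mul_assoc[symmetric] scaleR_diff_right)
    ultimately show ?thesis by simp
  qed
  have "((\<lambda>s. - (c *\<^sub>R ?H s)) has_integral V r *v x r - V 0 *v x 0) {0..r}"
    by (rule fundamental_theorem_of_calculus) (use r in \<open>auto intro!: has_vector_derivative_within_subset[OF dVx]\<close>)
  from integral_unique[OF this] have "integral {0..r} (\<lambda>s. - (c *\<^sub>R ?H s)) = V r *v x r"
    by (simp add: x_def)
  then have "V r *v x r = - (c *\<^sub>R integral {0..r} ?H)" by simp
  then show ?thesis
    unfolding yx[OF r]
    by (simp add: mn.add_right mn.scaleR_right matrix_vector_mul_assoc scaleR_diff_right)
qed

section \<open>The tail bound\<close>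

text \<open>Order reversal under inversion, for a single vector: expand the nonnegative value of
  \<open>q\<close> at \<open>matrix_inv P *v x\<close> minus \<open>\<eta>\<close> divided by
  \<open>E\<close>. Working vectorwise avoids inverting the matrix form at the earlier time.\<close>

lemma (in pos_def_matrix) inner_le_inv_form:
  assumes E: "E > 0" and q: "q \<eta> \<le> E * (x \<bullet> \<eta>)"
  shows "x \<bullet> \<eta> \<le> E * (x \<bullet> (matrix_inv P *v x))"
proof -
  define \<zeta> where "\<zeta> = matrix_inv P *v x"
  have x: "P *v \<zeta> = x" by (simp add: \<zeta>_def P_inv)
  have "0 \<le> q (\<zeta> + (- 1 / E) *\<^sub>R \<eta>)" by (rule q_nonneg)
  also have "\<dots> = x \<bullet> \<zeta> + q \<eta> / E\<^sup>2 - 2 * (x \<bullet> \<eta>) / E"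
    unfolding q_add q_scaleR x by (simp add: q_def[of \<zeta>] x power_divide inner_commute)
  also have "q \<eta> / E\<^sup>2 \<le> (x \<bullet> \<eta>) / E"
    using q E by (simp add: field_simps power2_eq_square)
  finally show ?thesis using E by (simp add: \<zeta>_def field_simps)
qed

text \<open>Needed to keep the values under the real supremum bounded above, without which that
  supremum could not be traced to a point.\<close>

lemma inv_form_le:
  fixes X :: "real^'n^'n"
  assumes mu: "\<mu> > 0" and pos: "\<And>z. z \<bullet> (X *v z) \<ge> \<mu> * (norm z)\<^sup>2"
  shows "y \<bullet> (matrix_inv X *v y) \<le> (norm y)\<^sup>2 / \<mu>"
proof -
  define w where "w = matrix_inv X *v y"
  have "X *v w = y"
    by (simp add: w_def matrix_vector_mul_assoc matrix_inv_mult[OF pos_form_invertible[OF assms]])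
  then have 1: "\<mu> * (norm w)\<^sup>2 \<le> y \<bullet> w" using pos[of w] by (simp add: inner_commute)
  have 2: "y \<bullet> w \<le> norm y * norm w" by (rule norm_cauchy_schwarz)
  have "norm w \<le> norm y / \<mu>"
  proof (cases "norm w = 0")
    case False
    have "(\<mu> * norm w) * norm w \<le> norm y * norm w" using 1 2 by (simp add: power2_eq_square mult.assoc)
    then have "\<mu> * norm w \<le> norm y" using False by (simp add: mult_le_cancel_right)
    then show ?thesis using mu by (simp add: field_simps)
  qed (use mu in auto)
  then have "norm y * norm w \<le> norm y * (norm y / \<mu>)" by (intro mult_left_mono) auto
  with 2 show ?thesis by (simp add: w_def power2_eq_square)
qed

lemma gronwall_exp:
  fixes f f' :: "real \<Rightarrow> real"
  assumes f: "\<And>s. s \<in> {0..T} \<Longrightarrow> (f has_real_derivative f' s) (at s within {0..T})"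
    and le: "\<And>s. s \<in> {0..T} \<Longrightarrow> f' s \<le> k * f s" and ru: "0 \<le> r" "r \<le> u" "u \<le> T"
  shows "f u \<le> exp (k * (u - r)) * f r"
proof -
  define g where "g s = exp (- k * s) * f s" for s
  have dg: "(g has_real_derivative exp (- k * s) * (f' s - k * f s)) (at s within {0..T})" if "s \<in> {0..T}" for s
    unfolding g_def by (auto intro!: derivative_eq_intros f that simp: algebra_simps)
  have "g u \<le> g r"
  proof (rule DERIV_nonpos_imp_decreasing_open[OF ru(2)])
    fix s assume s: "r < s" "s < u"
    then have sT: "s \<in> {0..T}" "at s within {0..T} = at s" using ru by (auto simp: at_within_Icc_at)
    show "\<exists>y. (g has_real_derivative y) (at s) \<and> y \<le> 0"
      using dg[OF sT(1)] le[OF sT(1)] unfolding sT(2)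
      by (intro exI conjI) (auto simp: mult_le_0_iff)
  next
    have "continuous_on {0..T} g" using dg by (rule DERIV_continuous_on)
    then show "continuous_on {r..u} g" by (rule continuous_on_subset) (use ru in auto)
  qed
  then have "exp (k * u) * (exp (- k * u) * f u) \<le> exp (k * u) * (exp (- k * r) * f r)"
    by (simp add: g_def)
  moreover have "exp (k * u) * exp (- k * u) = 1" by (simp add: mult_exp_exp)
  moreover have "exp (k * u) * exp (- k * r) = exp (k * (u - r))" by (simp add: mult_exp_exp algebra_simps)
  ultimately show ?thesis by (simp only: mult.assoc[symmetric] mult_1_left)
qed

lemma block_cover:
  fixes T r :: real
  assumes T: "T > 0" and K: "K > 0" and r: "r \<in> {0..T}"
  obtains k where "k < K" "r \<le> real (Suc k) * T / real K" "real (Suc k) * T / real K \<le> r + T / real K"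
proof (cases "r = 0")
  case True
  then show ?thesis using assms by (intro that[of 0]) auto
next
  case False
  define x where "x = r * real K / T"
  have x: "0 < x" "x \<le> real K" using False assms by (auto simp: x_def field_simps)
  \<comment> \<open>The blocks are open on the left and closed on the right, so the time 0 belongs
    to none of them and was assigned to the first block separately.\<close>
  define k where "k = nat (\<lceil>x\<rceil> - 1)"
  have k: "real (Suc k) = of_int \<lceil>x\<rceil>" using x(1) by (simp add: k_def)
  then have k': "x \<le> real (Suc k)" "real (Suc k) \<le> x + 1" by linarith+
  have "\<lceil>x\<rceil> \<le> int K" using x(2) by (simp add: ceiling_le_iff)
  then have "k < K" using k by linarith
  moreover have "x * T / real K = r" using T K by (simp add: x_def)
  moreover have "x * T / real K \<le> real (Suc k) * T / real K"
    using k' T by (intro divide_right_mono mult_right_mono) auto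
  moreover have "real (Suc k) * T / real K \<le> (x + 1) * T / real K"
    using k' T by (intro divide_right_mono mult_right_mono) auto
  ultimately show ?thesis by (intro that[of k]) (auto simp: add_divide_distrib algebra_simps)
qed

text \<open>The estimate with explicit constants for one fixed choice of parameters. Stability has
  been replaced by positivity of the form of \<open>X\<close> and by its domination of the noise;
  \<open>\<mu>\<close> does not enter the bound, and \<open>C\<close> enters only through the
  freezing loss \<open>exp (- C * \<epsilon>)\<close>.\<close>

lemma linear_sde_tail_bound:
  fixes A :: "real \<Rightarrow> real^'n^'n" and G G' :: "real \<Rightarrow> real^'k^'n" and X :: "real \<Rightarrow> real^'n^'n"
    and W :: "real \<Rightarrow> 'a \<Rightarrow> real^'k" and y :: "real \<Rightarrow> 'a \<Rightarrow> real^'n"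
  assumes pars: "\<epsilon> > 0" "\<sigma> > 0" "T > 0" "0 < \<kappa>" "\<kappa> < 1/2" "\<mu> > 0" "C \<ge> 0"
    and A: "continuous_on {0..T} A"
    and G: "\<And>s. s \<in> {0..T} \<Longrightarrow> (G has_vector_derivative G' s) (at s within {0..T})"
    and G': "continuous_on {0..T} G'"
    and X: "\<And>s. s \<in> {0..T} \<Longrightarrow> \<exists>D. (X has_vector_derivative D) (at s within {0..T}) \<and>
        \<epsilon> *\<^sub>R D = A s ** X s + X s ** transpose (A s) + \<sigma>\<^sup>2 *\<^sub>R (G s ** transpose (G s))"
    and pos: "\<And>s z. s \<in> {0..T} \<Longrightarrow> z \<bullet> (X s *v z) \<ge> \<mu> * (norm z)\<^sup>2"
    and GX: "\<And>s z. s \<in> {0..T} \<Longrightarrow> \<sigma>\<^sup>2 * (norm (transpose (G s) *v z))\<^sup>2 \<le> C * (z \<bullet> (X s *v z))"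
    and BM: "std_brownian_motion M W"
    and y: "\<And>\<omega>. \<omega> \<in> space M \<Longrightarrow> continuous_on {0..T} (\<lambda>t. y t \<omega>)"
    and eq: "AE \<omega> in M. \<forall>t\<in>{0..T}. y t \<omega> = (1 / \<epsilon>) *\<^sub>R integral {0..t} (\<lambda>s. A s *v y s \<omega>)
        + (\<sigma> / sqrt \<epsilon>) *\<^sub>R (G t *v W t \<omega> - integral {0..t} (\<lambda>s. G' s *v W s \<omega>))"
  shows "measure M {\<omega> \<in> space M. (SUP s\<in>{0..T}. y s \<omega> \<bullet> (matrix_inv (X s) *v y s \<omega>)) \<ge> H}
      \<le> (T / \<epsilon>\<^sup>2 + 1) * (1 / (1 - 2 * \<kappa>)) ^ CARD('n) * exp (- \<kappa> * (exp (- C * \<epsilon>) * H))"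
proof -
  interpret prob_space M using BM by (simp add: std_brownian_motion_def)
  interpret mm: bounded_bilinear "(**) :: real^'n^'n \<Rightarrow> real^'k^'n \<Rightarrow> real^'k^'n"
    by (rule bounded_bilinear_matrix_matrix_mult)
  interpret mn: bounded_bilinear "(**) :: real^'n^'n \<Rightarrow> real^'n^'n \<Rightarrow> real^'n^'n"
    by (rule bounded_bilinear_matrix_matrix_mult)
  interpret mv: bounded_bilinear "(*v) :: real^'n^'n \<Rightarrow> real^'n \<Rightarrow> real^'n"
    by (rule bounded_bilinear_matrix_vector_mult)
  define A' where "A' s = (1 / \<epsilon>) *\<^sub>R A s" for s
  have A': "continuous_on {0..T} A'" unfolding A'_def[abs_def] by (intro continuous_intros A)
  obtain V where V': "V 0 = mat 1 \<and> (\<forall>s\<in>{0..T}. (V has_vector_derivative - (V s ** A' s)) (at s within {0..T}) \<and> invertible (V s))"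
    using linear_matrix_ode_invertible[OF A' less_imp_le[OF pars(3)]] by (elim exE)
  then have V: "\<And>s. s \<in> {0..T} \<Longrightarrow> (V has_vector_derivative - (V s ** A' s)) (at s within {0..T})"
    and Vinv: "\<And>s. s \<in> {0..T} \<Longrightarrow> invertible (V s)"
    by auto
  have Vc: "continuous_on {0..T} V" by (rule continuous_on_vector_derivative) (rule V)
  have Gc: "continuous_on {0..T} G" by (rule continuous_on_vector_derivative) (rule G)
  define c where "c = \<sigma> / sqrt \<epsilon>"
  have c2: "c\<^sup>2 = \<sigma>\<^sup>2 / \<epsilon>" using pars by (simp add: c_def power_divide)
  define F where "F s = V s ** G s" for s
  define F' where "F' s = V s ** G' s - (V s ** A' s) ** G s" for s
  have F: "(F has_vector_derivative F' s) (at s within {0..T})" if "s \<in> {0..T}" for s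
    using mm.has_vector_derivative[OF V[OF that] G[OF that]]
    unfolding F_def[abs_def] F'_def by (simp add: mm.minus_left)
  have F'c: "continuous_on {0..T} F'"
    unfolding F'_def[abs_def] by (intro continuous_intros mm.continuous_on mn.continuous_on Vc Gc G' A')
  define z where "z \<xi> s = transpose (V s) *v \<xi>" for \<xi> s
  \<comment> \<open>The form of V X V^T at \<open>\<xi>\<close>, written through the transported
    vector \<open>z\<close>. The drift terms in the equation for \<open>X\<close> cancel against z'
    = - A'^T z, leaving only the noise term in the derivative.\<close>
  define p where "p \<xi> s = z \<xi> s \<bullet> (X s *v z \<xi> s)" for \<xi> s
  have Fz: "transpose (F s) *v \<xi> = transpose (G s) *v z \<xi> s" for s \<xi>
    by (simp only: F_def z_def matrix_transpose_mul matrix_vector_mul_assoc)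
  have p: "(p \<xi> has_real_derivative c\<^sup>2 * (norm (transpose (F s) *v \<xi>))\<^sup>2) (at s within {0..T})"
    if s: "s \<in> {0..T}" for \<xi> s
  proof -
    obtain D where D: "(X has_vector_derivative D) (at s within {0..T})"
      and De: "\<epsilon> *\<^sub>R D = A s ** X s + X s ** transpose (A s) + \<sigma>\<^sup>2 *\<^sub>R (G s ** transpose (G s))"
      using X[OF s] by blast
    have "D = (1 / \<epsilon>) *\<^sub>R (\<epsilon> *\<^sub>R D)" using pars by simp
    also have "\<dots> = (A' s ** X s + X s ** transpose (A' s)) + c\<^sup>2 *\<^sub>R (G s ** transpose (G s))"
      unfolding De c2 A'_def
      using bounded_linear.linear[OF bounded_linear_transpose[where 'n='n and 'm='n], THEN linear_scale]
      by (simp add: scaleR_add_right mn.scaleR_left mn.scaleR_right)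
    finally have D': "D = (A' s ** X s + X s ** transpose (A' s)) + c\<^sup>2 *\<^sub>R (G s ** transpose (G s))" .
    have dz: "(z \<xi> has_vector_derivative - (transpose (A' s) *v z \<xi> s)) (at s within {0..T})"
    proof -
      have "transpose (- (V s ** A' s)) *v \<xi> = - (transpose (A' s) *v z \<xi> s)"
        using bounded_linear.linear[OF bounded_linear_transpose[where 'n='n and 'm='n], THEN linear_neg]
        by (simp only: z_def mv.minus_left matrix_transpose_mul matrix_vector_mul_assoc)
      then show ?thesis
        using bounded_linear.has_vector_derivative[OF mv.bounded_linear_left
            bounded_linear.has_vector_derivative[OF bounded_linear_transpose V[OF s]], of \<xi>]
        unfolding z_def[abs_def] by (simp only:)
    qed
    let ?z = "z \<xi> s"
    have "(p \<xi> has_vector_derivative ?z \<bullet> (X s *v (- (transpose (A' s) *v ?z)) + D *v ?z) + (- (transpose (A' s) *v ?z)) \<bullet> (X s *v ?z))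
        (at s within {0..T})"
      unfolding p_def[abs_def]
      by (rule bounded_bilinear.has_vector_derivative[OF bounded_bilinear_inner dz mv.has_vector_derivative[OF D dz]])
    also have "?z \<bullet> (X s *v (- (transpose (A' s) *v ?z)) + D *v ?z) + (- (transpose (A' s) *v ?z)) \<bullet> (X s *v ?z)
        = ?z \<bullet> (D *v ?z) - (?z \<bullet> (X s *v (transpose (A' s) *v ?z)) + (transpose (A' s) *v ?z) \<bullet> (X s *v ?z))"
      by (simp only: mv.minus_right inner_minus_left inner_add_right inner_minus_right)
    also have "\<dots> = c\<^sup>2 * (?z \<bullet> ((G s ** transpose (G s)) *v ?z))"
      unfolding form_lyapunov_eq D' by (simp only: mv.add_left mv.scaleR_left inner_add_right inner_scaleR_right)
    also have "\<dots> = c\<^sup>2 * (norm (transpose (F s) *v \<xi>))\<^sup>2"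
      unfolding Fz matrix_matrix_transpose_form ..
    finally show ?thesis by (simp add: has_real_derivative_iff_has_vector_derivative)
  qed
  have p0: "p \<xi> s \<ge> 0" if "s \<in> {0..T}" for \<xi> s
    using pos[OF that, of "z \<xi> s"] pars by (simp add: p_def) (meson mult_nonneg_nonneg less_imp_le order_trans zero_le_power2)
  have growth: "p \<xi> u \<le> exp (C * \<epsilon>) * p \<xi> r" if ru: "0 \<le> r" "r \<le> u" "u \<le> T" "u \<le> r + \<epsilon>\<^sup>2" for \<xi> r u
  proof -
    have "p \<xi> u \<le> exp (C / \<epsilon> * (u - r)) * p \<xi> r"
    proof (rule gronwall_exp[OF p _ ru(1-3)])
      fix s assume s: "s \<in> {0..T}"
      have "c\<^sup>2 * (norm (transpose (F s) *v \<xi>))\<^sup>2 = (\<sigma>\<^sup>2 * (norm (transpose (G s) *v z \<xi> s))\<^sup>2) / \<epsilon>"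
        by (simp only: Fz c2 times_divide_eq_left)
      also have "\<dots> \<le> (C * p \<xi> s) / \<epsilon>" unfolding p_def using pars by (intro divide_right_mono GX s) auto
      finally show "c\<^sup>2 * (norm (transpose (F s) *v \<xi>))\<^sup>2 \<le> C / \<epsilon> * p \<xi> s" by simp
    qed
    also have "\<dots> \<le> exp (C * \<epsilon>) * p \<xi> r"
    proof (intro mult_right_mono)
      have "C / \<epsilon> * (u - r) \<le> C / \<epsilon> * \<epsilon>\<^sup>2" using ru pars by (intro mult_left_mono) auto
      also have "\<dots> = C * \<epsilon>" using pars by (simp add: power2_eq_square)
      finally show "exp (C / \<epsilon> * (u - r)) \<le> exp (C * \<epsilon>)" by simp
    qed (use p0 ru in auto)
    finally show ?thesis .
  qed
  define P where "P u = V u ** ((1/2) *\<^sub>R (X u + transpose (X u))) ** transpose (V u)" for u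
  have Pform: "\<xi> \<bullet> (P u *v \<xi>) = p \<xi> u" for \<xi> u
  proof -
    have "\<xi> \<bullet> (P u *v \<xi>) = z \<xi> u \<bullet> (((1/2) *\<^sub>R (X u + transpose (X u))) *v z \<xi> u)"
      unfolding P_def z_def matrix_vector_mul_assoc[symmetric] by (metis dot_lmul_matrix transpose_matrix_vector)
    also have "\<dots> = (1/2) * (z \<xi> u \<bullet> (X u *v z \<xi> u) + z \<xi> u \<bullet> (transpose (X u) *v z \<xi> u))"
      by (simp only: mv.scaleR_left mv.add_left inner_scaleR_right inner_add_right)
    also have "z \<xi> u \<bullet> (transpose (X u) *v z \<xi> u) = z \<xi> u \<bullet> (X u *v z \<xi> u)"
      by (metis dot_lmul_matrix inner_commute transpose_matrix_vector)
    finally show ?thesis by (simp add: p_def)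
  qed
  have Psym: "transpose (P u) = P u" for u
  proof -
    have "transpose ((1/2) *\<^sub>R (X u + transpose (X u))) = (1/2) *\<^sub>R (X u + transpose (X u))"
      by (simp add: transpose_def vec_eq_iff add.commute)
    then show ?thesis by (simp add: P_def matrix_transpose_mul matrix_mul_assoc)
  qed
  \<comment> \<open>The constant may depend on \<open>u\<close>: the maximal inequality does not
    involve it.\<close>
  have PD: "\<exists>m. pos_def_matrix (P u) m" if u: "u \<in> {0..T}" for u
  proof -
    define k where "k = norm (matrix_inv (transpose (V u))) + 1"
    have k: "k > 0" by (simp add: k_def add_nonneg_pos)
    have "invertible (transpose (V u))" using Vinv[OF u] by (simp add: transpose_invertible)
    from matrix_inv_mult(2)[OF this] have "norm \<xi> \<le> k * norm (z \<xi> u)" for \<xi>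
    proof -
      have "\<xi> = matrix_inv (transpose (V u)) *v z \<xi> u"
        using \<open>matrix_inv (transpose (V u)) ** transpose (V u) = mat 1\<close>
        by (simp only: z_def matrix_vector_mul_assoc matrix_vector_mul_lid)
      then have "norm \<xi> \<le> norm (matrix_inv (transpose (V u))) * norm (z \<xi> u)"
        by (metis norm_matrix_vector_mult_le)
      also have "\<dots> \<le> k * norm (z \<xi> u)" by (intro mult_right_mono) (auto simp: k_def)
      finally show ?thesis .
    qed
    then have "(norm \<xi>)\<^sup>2 \<le> k\<^sup>2 * (norm (z \<xi> u))\<^sup>2" for \<xi>
      by (metis norm_ge_zero power_mono power_mult_distrib)
    then have "\<mu> / k\<^sup>2 * (norm \<xi>)\<^sup>2 \<le> p \<xi> u" for \<xi>
    proof -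
      have "\<mu> / k\<^sup>2 * (norm \<xi>)\<^sup>2 \<le> \<mu> / k\<^sup>2 * (k\<^sup>2 * (norm (z \<xi> u))\<^sup>2)"
        using \<open>\<And>\<xi>. (norm \<xi>)\<^sup>2 \<le> k\<^sup>2 * (norm (z \<xi> u))\<^sup>2\<close> pars by (intro mult_left_mono) auto
      also have "\<dots> = \<mu> * (norm (z \<xi> u))\<^sup>2" using k by simp
      also have "\<dots> \<le> p \<xi> u" unfolding p_def by (rule pos[OF u])
      finally show ?thesis .
    qed
    moreover have "\<mu> / k\<^sup>2 > 0" using pars k by simp
    ultimately show ?thesis
      by (intro exI[of _ "\<mu> / k\<^sup>2"]) (simp add: pos_def_matrix_def Psym Pform)
  qed
  define N where "N r \<omega> = c *\<^sub>R (F r *v W r \<omega> - integral {0..r} (\<lambda>s. F' s *v W s \<omega>))" for r \<omega>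
  define b where "b = (1 / (1 - 2 * \<kappa>)) ^ CARD('n)"
  have b: "b \<ge> 0" using pars by (simp add: b_def)
  \<comment> \<open>The estimate covers all times from 0, where the Wiener integral starts, although
    it is used only on the last block before \<open>u\<close>.\<close>
  have block: "\<exists>E\<in>sets M. {\<omega>\<in>space M. \<exists>r\<in>{0..u}. \<alpha> < N r \<omega> \<bullet> (matrix_inv (P u) *v N r \<omega>)} \<subseteq> E
     \<and> measure M E \<le> b * exp (- \<kappa> * \<alpha>)" if u: "0 < u" "u \<le> T" for u \<alpha>
  proof -
    obtain m where m: "pos_def_matrix (P u) m" using PD[of u] u by auto
    then interpret Q: pos_def_matrix "P u" m .
    have sub: "{0..u} \<subseteq> {0..T}" using u by auto
    show ?thesis
      unfolding N_def b_def
    proof (rule Q.wiener_integral_maximal_inequality[OF BM u(1) pars(4,5), where p=p])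
      show "(F has_vector_derivative F' s) (at s within {0..u})" if "s \<in> {0..u}" for s
        by (rule has_vector_derivative_within_subset[OF F sub]) (use that sub in auto)
      show "continuous_on {0..u} F'" by (rule continuous_on_subset[OF F'c sub])
      show "(p \<xi> has_real_derivative c\<^sup>2 * (norm (transpose (F s) *v \<xi>))\<^sup>2) (at s within {0..u})" if "s \<in> {0..u}" for \<xi> s
        by (rule has_field_derivative_subset[OF p sub]) (use that sub in auto)
      show "p \<xi> 0 \<ge> 0" for \<xi> using pars by (intro p0) auto
      show "p \<xi> u \<le> Q.q \<xi>" for \<xi> by (simp add: Q.q_def Pform)
    qed
  qed
  obtain N0 where N0: "N0 \<in> null_sets M"
    and good: "\<And>\<omega> t. \<omega> \<in> space M - N0 \<Longrightarrow> t \<in> {0..T} \<Longrightarrow> y t \<omega> = (1 / \<epsilon>) *\<^sub>R integral {0..t} (\<lambda>s. A s *v y s \<omega>)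
        + (\<sigma> / sqrt \<epsilon>) *\<^sub>R (G t *v W t \<omega> - integral {0..t} (\<lambda>s. G' s *v W s \<omega>))"
    using eq by (auto elim!: AE_E3)
  have Ny: "V r *v y r \<omega> = N r \<omega>" if \<omega>: "\<omega> \<in> space M - N0" and r: "r \<in> {0..T}" for r \<omega>
    unfolding N_def F_def F'_def
  proof (rule linear_sde_variation_of_constants[OF V G A' G' _ _ _ _ r])
    show "continuous_on {0..T} (\<lambda>t. y t \<omega>)" using y \<omega> by auto
    show "continuous_on {0..T} (\<lambda>t. W t \<omega>)" "W 0 \<omega> = 0"
      using BM \<omega> unfolding std_brownian_motion_def by (auto intro: continuous_on_subset)
    show "y t \<omega> = integral {0..t} (\<lambda>s. A' s *v y s \<omega>) + c *\<^sub>R (G t *v W t \<omega> - integral {0..t} (\<lambda>s. G' s *v W s \<omega>))"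
      if "t \<in> {0..T}" for t
      unfolding good[OF \<omega> that] by (simp add: A'_def c_def mv.scaleR_left)
  qed
  have compare: "y r \<omega> \<bullet> (matrix_inv (X r) *v y r \<omega>) \<le> exp (C * \<epsilon>) * (N r \<omega> \<bullet> (matrix_inv (P u) *v N r \<omega>))"
    if \<omega>: "\<omega> \<in> space M - N0" and ru: "0 \<le> r" "r \<le> u" "u \<le> T" "u \<le> r + \<epsilon>\<^sup>2" for \<omega> r u
  proof -
    have r: "r \<in> {0..T}" "u \<in> {0..T}" using ru by auto
    obtain m where m: "pos_def_matrix (P u) m" using PD[OF r(2)] by auto
    then interpret Q: pos_def_matrix "P u" m .
    define w where "w = matrix_inv (X r) *v y r \<omega>"
    have Xw: "X r *v w = y r \<omega>"
      by (simp add: w_def matrix_vector_mul_assoc matrix_inv_mult[OF pos_form_invertible[OF pars(6) pos[OF r(1)]]])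
    \<comment> \<open>Chosen so that \<open>z \<eta> r = w\<close>. Then \<open>p \<eta> r\<close>,
      \<open>N r \<omega> \<bullet> \<eta>\<close> and the form of \<open>y r \<omega>\<close> under
      the inverse of \<open>X r\<close> all coincide, and the growth bound becomes the hypothesis of
      the order reversal.\<close>
    define \<eta> where "\<eta> = matrix_inv (transpose (V r)) *v w"
    have "invertible (transpose (V r))" using Vinv[OF r(1)] by (simp add: transpose_invertible)
    then have zw: "z \<eta> r = w" by (simp only: z_def \<eta>_def matrix_vector_mul_assoc matrix_inv_mult matrix_vector_mul_lid)
    have "N r \<omega> \<bullet> \<eta> = y r \<omega> \<bullet> z \<eta> r"
      unfolding Ny[OF \<omega> r(1), symmetric] z_def by (metis dot_lmul_matrix inner_commute transpose_matrix_vector)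
    then have Ne: "N r \<omega> \<bullet> \<eta> = y r \<omega> \<bullet> w" by (simp add: zw)
    have "Q.q \<eta> = p \<eta> u" by (simp add: Q.q_def Pform)
    also have "\<dots> \<le> exp (C * \<epsilon>) * p \<eta> r" by (rule growth[OF ru])
    also have "p \<eta> r = N r \<omega> \<bullet> \<eta>" by (simp only: p_def zw Xw Ne) (rule inner_commute)
    finally have "N r \<omega> \<bullet> \<eta> \<le> exp (C * \<epsilon>) * (N r \<omega> \<bullet> (matrix_inv (P u) *v N r \<omega>))"
      by (rule Q.inner_le_inv_form[rotated]) simp
    then show ?thesis by (simp add: Ne w_def)
  qed
  \<comment> \<open>Rounding up makes the blocks no longer than \<epsilon>^2, and their number is at
    most the prefactor \<open>T / \<epsilon>\<^sup>2 + 1\<close>.\<close>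
  define K where "K = nat \<lceil>T / \<epsilon>\<^sup>2\<rceil>"
  have Te: "T / \<epsilon>\<^sup>2 > 0" using pars by simp
  have K: "K > 0" "real K \<le> T / \<epsilon>\<^sup>2 + 1" "T / \<epsilon>\<^sup>2 \<le> real K"
    using Te unfolding K_def by linarith+
  have TK: "T / real K \<le> \<epsilon>\<^sup>2" using K pars by (simp add: field_simps)
  define S where "S = {\<omega> \<in> space M. (SUP s\<in>{0..T}. y s \<omega> \<bullet> (matrix_inv (X s) *v y s \<omega>)) \<ge> H}"
  \<comment> \<open>The covering events need a level exceeded strictly, while the theorem has a
    non-strict inequality; so a level \<open>\<beta>\<close> below \<open>H\<close> is used first
    and then tends to \<open>H\<close> from the left.\<close>
  have main: "measure M S \<le> real K * (b * exp (- \<kappa> * (exp (- C * \<epsilon>) * \<beta>)))" if beta: "\<beta> < H" for \<beta>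
  proof (cases "S \<in> sets M")
    \<comment> \<open>A set that is not measurable has \<open>measure\<close> 0 by
      convention.\<close>
    case False
    then show ?thesis using b by (simp add: measure_notin_sets)
  next
    case True
    define \<alpha> where "\<alpha> = exp (- C * \<epsilon>) * \<beta>"
    define u where "u k = real (Suc k) * T / real K" for k
    have u: "0 < u k" "u k \<le> T" if "k < K" for k
    proof -
      show "0 < u k" using pars K by (simp add: u_def)
      have "real (Suc k) * T \<le> real K * T" using that pars by (intro mult_right_mono) auto
      then show "u k \<le> T" using K by (simp add: u_def field_simps)
    qed
    define R where "R k E \<longleftrightarrow> E \<in> sets M \<and> {\<omega>\<in>space M. \<exists>r\<in>{0..u k}. \<alpha> < N r \<omega> \<bullet> (matrix_inv (P (u k)) *v N r \<omega>)} \<subseteq> E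
       \<and> measure M E \<le> b * exp (- \<kappa> * \<alpha>)" for k E
    define E where "E k = (SOME E. R k E)" for k
    have "R k (E k)" if "k < K" for k
    proof -
      have "\<exists>E. R k E" using block[OF u[OF that], of \<alpha>] unfolding R_def by blast
      then show ?thesis unfolding E_def by (rule someI_ex)
    qed
    then have E: "\<And>k. k < K \<Longrightarrow> E k \<in> sets M"
      "\<And>k. k < K \<Longrightarrow> {\<omega>\<in>space M. \<exists>r\<in>{0..u k}. \<alpha> < N r \<omega> \<bullet> (matrix_inv (P (u k)) *v N r \<omega>)} \<subseteq> E k"
      "\<And>k. k < K \<Longrightarrow> measure M (E k) \<le> b * exp (- \<kappa> * \<alpha>)"
      by (simp_all only: R_def)
    have "S \<subseteq> N0 \<union> (\<Union>k<K. E k)"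
    proof
      fix \<omega> assume \<omega>: "\<omega> \<in> S"
      show "\<omega> \<in> N0 \<union> (\<Union>k<K. E k)"
      proof (cases "\<omega> \<in> N0")
        case False
        with \<omega> have \<omega>': "\<omega> \<in> space M - N0" by (simp add: S_def)
        let ?g = "\<lambda>s. y s \<omega> \<bullet> (matrix_inv (X s) *v y s \<omega>)"
        have "compact ((\<lambda>t. y t \<omega>) ` {0..T})"
          using y \<omega>' by (intro compact_continuous_image) auto
        then obtain B where B: "\<And>s. s \<in> {0..T} \<Longrightarrow> norm (y s \<omega>) \<le> B"
          unfolding image_def by (blast dest: compact_imp_bounded[THEN bounded_iff[THEN iffD1]])
        have "bdd_above (?g ` {0..T})"
        proof (rule bdd_aboveI2)
          fix s assume s: "s \<in> {0..T}"
          have "?g s \<le> (norm (y s \<omega>))\<^sup>2 / \<mu>" by (rule inv_form_le[OF pars(6) pos[OF s]])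
          also have "\<dots> \<le> B\<^sup>2 / \<mu>" using pars B[OF s] by (intro divide_right_mono power_mono) auto
          finally show "?g s \<le> B\<^sup>2 / \<mu>" .
        qed
        moreover have "{0..T} \<noteq> {}" using pars by auto
        moreover have "\<beta> < (SUP s\<in>{0..T}. ?g s)" using \<omega> beta by (simp add: S_def)
        ultimately obtain r where r: "r \<in> {0..T}" "\<beta> < ?g r" by (subst (asm) less_cSUP_iff) auto
        obtain k where k: "k < K" "r \<le> u k" "u k \<le> r + T / real K"
          using block_cover[OF pars(3) K(1) r(1)] unfolding u_def by blast
        have "\<beta> < exp (C * \<epsilon>) * (N r \<omega> \<bullet> (matrix_inv (P (u k)) *v N r \<omega>))"
          using r(2) compare[OF \<omega>' _ k(2) u(2)[OF k(1)]] k(3) TK r(1) by force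
        then have "exp (- C * \<epsilon>) * \<beta> < exp (- C * \<epsilon>) * (exp (C * \<epsilon>) * (N r \<omega> \<bullet> (matrix_inv (P (u k)) *v N r \<omega>)))"
          by (intro mult_strict_left_mono) auto
        then have "\<alpha> < N r \<omega> \<bullet> (matrix_inv (P (u k)) *v N r \<omega>)"
          by (simp add: \<alpha>_def mult.assoc[symmetric] mult_exp_exp)
        moreover have "\<omega> \<in> space M" "r \<in> {0..u k}" using \<omega>' r(1) k(2) by auto
        ultimately have "\<omega> \<in> E k" using E(2)[OF k(1)] by blast
        then show ?thesis using k(1) by auto
      qed simp
    qed
    then have "measure M S \<le> measure M (N0 \<union> (\<Union>k<K. E k))"
      using N0 E(1) by (intro finite_measure_mono) auto
    also have "\<dots> \<le> measure M N0 + measure M (\<Union>k<K. E k)"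
      using N0 E(1) by (intro measure_Un_le) auto
    also have "measure M N0 = 0" using N0 by (simp add: null_sets_def measure_def)
    also have "measure M (\<Union>k<K. E k) \<le> (\<Sum>k<K. measure M (E k))"
      using E(1) by (intro measure_UNION_le) auto
    also have "\<dots> \<le> (\<Sum>k<K. b * exp (- \<kappa> * \<alpha>))" using E(3) by (intro sum_mono) auto
    finally show ?thesis by (simp add: \<alpha>_def)
  qed
  define f where "f \<beta> = real K * (b * exp (- \<kappa> * (exp (- C * \<epsilon>) * \<beta>)))" for \<beta>
  have "(f \<longlongrightarrow> f H) (at_left H)"
    unfolding f_def[abs_def] by (intro tendsto_intros)
  moreover have "\<forall>\<^sub>F \<beta> in at_left H. measure M S \<le> f \<beta>"
    unfolding eventually_at_filter f_def by (intro always_eventually allI impI main) (auto dest: lessThan_iff[THEN iffD1])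
  ultimately have "measure M S \<le> f H"
    by (intro tendsto_lowerbound) auto
  also have "\<dots> \<le> (T / \<epsilon>\<^sup>2 + 1) * (b * exp (- \<kappa> * (exp (- C * \<epsilon>) * H)))"
    unfolding f_def using K b by (intro mult_right_mono) auto
  finally show ?thesis by (simp add: S_def b_def mult.assoc)
qed

section \<open>Uniform positivity and constants independent of the small parameters\<close>

theorem theorem6p1:
  fixes A :: "real \<Rightarrow> real^'n^'n"
    and G :: "real \<Rightarrow> real^'k^'n"
    and a0 :: real
    and Xbar :: "real \<Rightarrow> real \<Rightarrow> real \<Rightarrow> real^'n^'n"
    and Xk :: "nat \<Rightarrow> real \<Rightarrow> real \<Rightarrow> real^'n^'n"
    and \<kappa> :: real
  assumes A_smooth: "smooth_on {0..} A"
    and G_smooth: "smooth_on {0..} G"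
    and A_bdd: "\<exists>B. \<forall>t\<ge>0. norm (A t) \<le> B"
    and G_bdd: "\<exists>B. \<forall>t\<ge>0. norm (G t) \<le> B"
    and a0_pos: "a0 > 0"
    and eig: "\<And>t z. t \<ge> 0 \<Longrightarrow> complex_eigenvalue (A t) z \<Longrightarrow> Re z < - a0"
    \<comment> \<open>Xbar \<sigma> \<epsilon> solves  \<epsilon> X' = A X + X A^T + \<sigma>^2 G G^T\<close>
    and Xbar_ode: "\<And>\<sigma> \<epsilon> t. \<sigma> > 0 \<Longrightarrow> \<epsilon> > 0 \<Longrightarrow> t \<ge> 0 \<Longrightarrow>
        \<exists>D. (Xbar \<sigma> \<epsilon> has_vector_derivative D) (at t within {0..}) \<and>
            \<epsilon> *\<^sub>R D = A t ** Xbar \<sigma> \<epsilon> t + Xbar \<sigma> \<epsilon> t ** transpose (A t)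
                      + \<sigma>\<^sup>2 *\<^sub>R (G t ** transpose (G t))"
    \<comment> \<open>terms of the asymptotic expansion\<close>
    and X0_eq: "\<And>\<sigma> t. \<sigma> > 0 \<Longrightarrow> t \<ge> 0 \<Longrightarrow>
        A t ** Xk 0 \<sigma> t + Xk 0 \<sigma> t ** transpose (A t) = - (\<sigma>\<^sup>2 *\<^sub>R (G t ** transpose (G t)))"
    and Xk_eq: "\<And>k \<sigma> t. \<sigma> > 0 \<Longrightarrow> t \<ge> 0 \<Longrightarrow>
        \<exists>D. (Xk k \<sigma> has_vector_derivative D) (at t within {0..}) \<and>
            A t ** Xk (Suc k) \<sigma> t + Xk (Suc k) \<sigma> t ** transpose (A t) = D"
    \<comment> \<open>Xbar admits the asymptotic expansion  Xbar = X_0 + \<epsilon> X_1 + \<epsilon>^2 X_2 + ...\<close>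
    and Xbar_expansion: "\<And>N. \<exists>C e. e > 0 \<and> (\<forall>\<sigma>>0. \<forall>\<epsilon>. 0 < \<epsilon> \<and> \<epsilon> \<le> e \<longrightarrow> (\<forall>t\<ge>0.
        norm (Xbar \<sigma> \<epsilon> t - (\<Sum>j<N. \<epsilon> ^ j *\<^sub>R Xk j \<sigma> t)) \<le> C * \<sigma>\<^sup>2 * \<epsilon> ^ N))"
    \<comment> \<open>\<sigma>^2 Xbar^{-1} is bounded in norm\<close>
    and Xbar_inv_bdd: "\<exists>M e. e > 0 \<and> (\<forall>\<sigma>>0. \<forall>\<epsilon>. 0 < \<epsilon> \<and> \<epsilon> \<le> e \<longrightarrow> (\<forall>t\<ge>0.
        invertible (Xbar \<sigma> \<epsilon> t) \<and> norm (\<sigma>\<^sup>2 *\<^sub>R matrix_inv (Xbar \<sigma> \<epsilon> t)) \<le> M))"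
    and kappa: "0 < \<kappa>" "\<kappa> < 1/2"
  shows "\<exists>c \<epsilon>0 \<sigma>0. \<epsilon>0 > 0 \<and> \<sigma>0 > 0 \<and>
    (\<forall>\<sigma> \<epsilon> (M :: 'a measure) W y t h.
       0 < \<sigma> \<and> \<sigma> \<le> \<sigma>0 \<and> 0 < \<epsilon> \<and> \<epsilon> \<le> \<epsilon>0 \<and> t > 0 \<and> h > 0 \<and>
       std_brownian_motion M W \<and> solves_linear_sde M \<epsilon> \<sigma> A G W y \<longrightarrow>
       measure M {\<omega> \<in> space M.
           (SUP s\<in>{0..t}. y s \<omega> \<bullet> (matrix_inv (Xbar \<sigma> \<epsilon> s) *v y s \<omega>)) \<ge> h\<^sup>2}
         \<le> (t / \<epsilon>\<^sup>2 + 1) * (1 / (1 - 2 * \<kappa>)) ^ CARD('n) * exp (- \<kappa> * h\<^sup>2 * (1 - c * \<epsilon>)))"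
proof -
  obtain DA where DA: "DA 0 = A" "\<And>k t. t \<ge> 0 \<Longrightarrow> (DA k has_vector_derivative DA (Suc k) t) (at t within {0..})"
    using A_smooth unfolding smooth_on_def by auto
  obtain DG where DG: "DG 0 = G" "\<And>k t. t \<ge> 0 \<Longrightarrow> (DG k has_vector_derivative DG (Suc k) t) (at t within {0..})"
    using G_smooth unfolding smooth_on_def by auto
  have A_cont: "continuous_on {0..} A" and G'_cont: "continuous_on {0..} (DG 1)"
    using DA(2)[of _ 0] DG(2)[of _ 1] unfolding DA(1) by (auto intro!: continuous_on_vector_derivative)
  have G': "(G has_vector_derivative DG 1 t) (at t within {0..})" if "t \<ge> 0" for t
    using DG(2)[OF that, of 0] by (simp add: DG(1))
  \<comment> \<open>At time 0 the derivative is one-sided; its uniqueness rests on the right-hand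
    neighbourhoods being nontrivial.\<close>
  have vdG: "vector_derivative G (at t within {0..}) = DG 1 t" if "t \<ge> 0" for t
  proof (rule vector_derivative_within[OF _ G'[OF that]])
    have "at_right t \<le> at t within {0..}" using that by (intro at_le) auto
    then show "at t within {0..} \<noteq> bot" using trivial_limit_at_right_real[of t] by (metis bot.extremum_uniqueI)
  qed
  obtain B where B: "\<And>t. t \<ge> 0 \<Longrightarrow> norm (G t) \<le> B" using G_bdd by blast
  obtain C1 e1 where e1: "e1 > 0" and C1: "\<And>\<sigma> \<epsilon> t. \<sigma> > 0 \<Longrightarrow> 0 < \<epsilon> \<Longrightarrow> \<epsilon> \<le> e1 \<Longrightarrow> t \<ge> 0 \<Longrightarrow>
      norm (Xbar \<sigma> \<epsilon> t - Xk 0 \<sigma> t) \<le> C1 * \<sigma>\<^sup>2 * \<epsilon>"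
    using Xbar_expansion[of 1] by (simp only: lessThan_Suc lessThan_0 One_nat_def sum.insert sum.empty finite.emptyI
        empty_iff not_False_eq_True power_0 power_Suc mult_1_right scaleR_one add_0_right) blast
  obtain M1 e2 where e2: "e2 > 0" and M1: "\<And>\<sigma> \<epsilon> t. \<sigma> > 0 \<Longrightarrow> 0 < \<epsilon> \<Longrightarrow> \<epsilon> \<le> e2 \<Longrightarrow> t \<ge> 0 \<Longrightarrow>
      invertible (Xbar \<sigma> \<epsilon> t) \<and> norm (\<sigma>\<^sup>2 *\<^sub>R matrix_inv (Xbar \<sigma> \<epsilon> t)) \<le> M1"
    using Xbar_inv_bdd by blast
  define M' where "M' = max M1 1"
  define C' where "C' = max C1 1"
  have MC: "M' > 0" "C' > 0" by (auto simp: M'_def C'_def)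
  \<comment> \<open>The last entry makes the perturbation loss \<open>2 * C' * \<epsilon>\<close> at
    most half of \<open>1 / M'\<close>; the remaining half is \<open>m\<close>.\<close>
  define \<epsilon>0 where "\<epsilon>0 = min (min e1 e2) (1 / (4 * M' * C'))"
  have \<epsilon>0: "\<epsilon>0 > 0" using e1 e2 MC by (simp add: \<epsilon>0_def)
  define m where "m = 1 / (2 * M')"
  have m: "m > 0" using MC by (simp add: m_def)
  have pos: "z \<bullet> (Xbar \<sigma> \<epsilon> t *v z) \<ge> (m * \<sigma>\<^sup>2) * (norm z)\<^sup>2"
    if s: "\<sigma> > 0" and e: "0 < \<epsilon>" "\<epsilon> \<le> \<epsilon>0" and t: "t \<ge> 0" for \<sigma> \<epsilon> t z
  proof -
    have e': "\<epsilon> \<le> e1" "\<epsilon> \<le> e2" "\<epsilon> \<le> 1 / (4 * M' * C')" using e by (auto simp: \<epsilon>0_def)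
    have eig': "Re w < 0" if "complex_eigenvalue (A t) w" for w using eig[OF t that] a0_pos by simp
    let ?Q = "\<sigma>\<^sup>2 *\<^sub>R (G t ** transpose (G t))"
    have psd: "w \<bullet> (Xk 0 \<sigma> t *v w) \<ge> 0" for w
    proof (rule lyapunov_solution_psd[OF eig' X0_eq[OF s t]])
      show "w \<bullet> (?Q *v w) \<ge> 0" for w
        by (simp add: bounded_bilinear.scaleR_left[OF bounded_bilinear_matrix_vector_mult] matrix_matrix_transpose_form)
    qed
    have sym: "transpose (Xk 0 \<sigma> t) = Xk 0 \<sigma> t"
    proof (rule lyapunov_solution_symmetric[OF eig' X0_eq[OF s t]])
      show "transpose ?Q = ?Q"
        using bounded_linear.linear[OF bounded_linear_transpose[where 'n='n and 'm='n], THEN linear_scale, of "\<sigma>\<^sup>2" "G t ** transpose (G t)"]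
        by (simp add: matrix_transpose_mul)
    qed
    have "\<sigma>\<^sup>2 * norm (matrix_inv (Xbar \<sigma> \<epsilon> t)) \<le> M'"
      using M1[OF s e(1) e'(2) t] by (auto simp: M'_def)
    then have inv: "norm (matrix_inv (Xbar \<sigma> \<epsilon> t)) \<le> M' / \<sigma>\<^sup>2" using s by (simp add: field_simps)
    have "C1 * \<sigma>\<^sup>2 * \<epsilon> \<le> C' * \<sigma>\<^sup>2 * \<epsilon>" using e s by (intro mult_right_mono) (auto simp: C'_def)
    with C1[OF s e(1) e'(1) t] have close: "norm (Xbar \<sigma> \<epsilon> t - Xk 0 \<sigma> t) \<le> C' * \<sigma>\<^sup>2 * \<epsilon>" by linarith
    have "(1 / (M' / \<sigma>\<^sup>2) - 2 * (C' * \<sigma>\<^sup>2 * \<epsilon>)) * (norm z)\<^sup>2 \<le> z \<bullet> (Xbar \<sigma> \<epsilon> t *v z)"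
      by (rule perturbed_psd_lower_bound[OF sym psd close _ inv]) (use M1[OF s e(1) e'(2) t] MC s in auto)
    moreover have "m * \<sigma>\<^sup>2 \<le> 1 / (M' / \<sigma>\<^sup>2) - 2 * (C' * \<sigma>\<^sup>2 * \<epsilon>)"
    proof -
      have "2 * C' * \<epsilon> \<le> 2 * C' * (1 / (4 * M' * C'))" using e'(3) MC by (intro mult_left_mono) auto
      also have "\<dots> = 1 / M' - m" using MC by (simp add: m_def field_simps)
      finally have "m \<le> 1 / M' - 2 * C' * \<epsilon>" by simp
      then have "m * \<sigma>\<^sup>2 \<le> (1 / M' - 2 * C' * \<epsilon>) * \<sigma>\<^sup>2" by (rule mult_right_mono) simp
      then show ?thesis by (simp add: algebra_simps)
    qed
    ultimately show ?thesis using mult_right_mono[of "m * \<sigma>\<^sup>2" _ "(norm z)\<^sup>2"] by (meson order_trans zero_le_power2)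
  qed
  \<comment> \<open>The noise form is at most B^2 \<sigma>^2 times the squared norm, and the form of
    \<open>Xbar\<close> at least \<open>m\<close> \<sigma>^2 times it. The powers of
    \<open>\<sigma>\<close> cancel, so the ratio depends on neither parameter.\<close>
  define C where "C = B\<^sup>2 / m"
  have C: "C \<ge> 0" using m by (simp add: C_def)
  show ?thesis
  \<comment> \<open>The constant of the O(\<epsilon>) term is \<open>C\<close> itself; the value 1
    for \<open>\<sigma>0\<close> is an arbitrary positive choice.\<close>
  proof (rule exI[of _ C], rule exI[of _ \<epsilon>0], rule exI[of _ 1], intro conjI allI impI)
    fix \<sigma> \<epsilon> :: real and M :: "'a measure" and W y and t h :: real
    assume asm: "0 < \<sigma> \<and> \<sigma> \<le> 1 \<and> 0 < \<epsilon> \<and> \<epsilon> \<le> \<epsilon>0 \<and> t > 0 \<and> h > 0 \<and>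
       std_brownian_motion M W \<and> solves_linear_sde M \<epsilon> \<sigma> A G W y"
    have sub: "{0..t} \<subseteq> {0..}" by auto
    let ?b = "(t / \<epsilon>\<^sup>2 + 1) * (1 / (1 - 2 * \<kappa>)) ^ CARD('n)"
    have "measure M {\<omega> \<in> space M. (SUP s\<in>{0..t}. y s \<omega> \<bullet> (matrix_inv (Xbar \<sigma> \<epsilon> s) *v y s \<omega>)) \<ge> h\<^sup>2}
      \<le> ?b * exp (- \<kappa> * (exp (- C * \<epsilon>) * h\<^sup>2))"
    proof (rule linear_sde_tail_bound[where \<mu>="m * \<sigma>\<^sup>2" and \<sigma>=\<sigma> and G'="DG 1" and A=A and G=G and W=W])
      show "continuous_on {0..t} A" "continuous_on {0..t} (DG 1)"
        using A_cont G'_cont sub by (auto intro: continuous_on_subset)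
      show "(G has_vector_derivative DG 1 s) (at s within {0..t})" if "s \<in> {0..t}" for s
        by (rule has_vector_derivative_within_subset[OF G' sub]) (use that in auto)
      show "\<exists>D. (Xbar \<sigma> \<epsilon> has_vector_derivative D) (at s within {0..t}) \<and>
          \<epsilon> *\<^sub>R D = A s ** Xbar \<sigma> \<epsilon> s + Xbar \<sigma> \<epsilon> s ** transpose (A s) + \<sigma>\<^sup>2 *\<^sub>R (G s ** transpose (G s))" if "s \<in> {0..t}" for s
        using Xbar_ode[of \<sigma> \<epsilon> s] that asm has_vector_derivative_within_subset[OF _ sub] by (metis atLeastAtMost_iff)
      show pos': "m * \<sigma>\<^sup>2 * (norm z)\<^sup>2 \<le> z \<bullet> (Xbar \<sigma> \<epsilon> s *v z)" if "s \<in> {0..t}" for s z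
        by (rule pos) (use that asm in auto)
      show "\<sigma>\<^sup>2 * (norm (transpose (G s) *v z))\<^sup>2 \<le> C * (z \<bullet> (Xbar \<sigma> \<epsilon> s *v z))" if s: "s \<in> {0..t}" for s z
      proof -
        have "norm (transpose (G s) *v z) \<le> norm (G s) * norm z"
          using norm_matrix_vector_mult_le[of "transpose (G s)" z] by (simp only: norm_transpose)
        also have "\<dots> \<le> B * norm z" using s by (intro mult_right_mono B) auto
        finally have "(norm (transpose (G s) *v z))\<^sup>2 \<le> (B * norm z)\<^sup>2" by (rule power_mono) simp
        then have "\<sigma>\<^sup>2 * (norm (transpose (G s) *v z))\<^sup>2 \<le> \<sigma>\<^sup>2 * (B * norm z)\<^sup>2" by (rule mult_left_mono) simp
        also have "\<dots> = C * (m * \<sigma>\<^sup>2 * (norm z)\<^sup>2)" using m by (simp add: C_def power_mult_distrib)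
        also have "\<dots> \<le> C * (z \<bullet> (Xbar \<sigma> \<epsilon> s *v z))" by (rule mult_left_mono[OF pos'[OF s] C])
        finally show ?thesis .
      qed
      show "continuous_on {0..t} (\<lambda>s. y s \<omega>)" if "\<omega> \<in> space M" for \<omega>
        using asm that sub unfolding solves_linear_sde_def by (blast intro: continuous_on_subset)
      have "AE \<omega> in M. \<forall>t\<ge>0. y t \<omega> = (1 / \<epsilon>) *\<^sub>R integral {0..t} (\<lambda>s. A s *v y s \<omega>)
               + (\<sigma> / sqrt \<epsilon>) *\<^sub>R (G t *v W t \<omega>
                   - integral {0..t} (\<lambda>s. vector_derivative G (at s within {0..}) *v W s \<omega>))"
        using asm unfolding solves_linear_sde_def by blast
      moreover have "integral {0..t} (\<lambda>s. vector_derivative G (at s within {0..}) *v W s \<omega>) = integral {0..t} (\<lambda>s. DG 1 s *v W s \<omega>)" for t \<omega>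
        by (rule Henstock_Kurzweil_Integration.integral_cong) (simp add: vdG)
      ultimately have "AE \<omega> in M. \<forall>t\<ge>0. y t \<omega> = (1 / \<epsilon>) *\<^sub>R integral {0..t} (\<lambda>s. A s *v y s \<omega>)
        + (\<sigma> / sqrt \<epsilon>) *\<^sub>R (G t *v W t \<omega> - integral {0..t} (\<lambda>s. DG 1 s *v W s \<omega>))"
        by (simp only:)
      then show "AE \<omega> in M. \<forall>t\<in>{0..t}. y t \<omega> = (1 / \<epsilon>) *\<^sub>R integral {0..t} (\<lambda>s. A s *v y s \<omega>)
        + (\<sigma> / sqrt \<epsilon>) *\<^sub>R (G t *v W t \<omega> - integral {0..t} (\<lambda>s. DG 1 s *v W s \<omega>))"
        by eventually_elim auto
    qed (use asm kappa m C in auto)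
    also have "\<dots> \<le> ?b * exp (- \<kappa> * h\<^sup>2 * (1 - C * \<epsilon>))"
    proof (rule mult_left_mono)
      \<comment> \<open>Convexity of the exponential turns the multiplicative freezing loss into the
        linear factor of the statement.\<close>
      have "1 - C * \<epsilon> \<le> exp (- C * \<epsilon>)" using exp_ge_add_one_self[of "- C * \<epsilon>"] by simp
      then have "(\<kappa> * h\<^sup>2) * (1 - C * \<epsilon>) \<le> (\<kappa> * h\<^sup>2) * exp (- C * \<epsilon>)"
        using kappa by (intro mult_left_mono) auto
      then show "exp (- \<kappa> * (exp (- C * \<epsilon>) * h\<^sup>2)) \<le> exp (- \<kappa> * h\<^sup>2 * (1 - C * \<epsilon>))"
        by (simp add: mult_ac)
      show "0 \<le> ?b" using asm kappa by (intro mult_nonneg_nonneg add_nonneg_nonneg) auto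
    qed
    finally show "measure M {\<omega> \<in> space M. (SUP s\<in>{0..t}. y s \<omega> \<bullet> (matrix_inv (Xbar \<sigma> \<epsilon> s) *v y s \<omega>)) \<ge> h\<^sup>2}
      \<le> ?b * exp (- \<kappa> * h\<^sup>2 * (1 - C * \<epsilon>))" .
  qed (use \<epsilon>0 in auto)
qed

end
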